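(* Assume initial values have finite second moment ($\mathbb{E}|\xi|^2<\infty$). Assume there is $\lambda_3>0$ such that for all $x_1,x_2\in\mathbb{R}^d$, $\mu_1,\mu_2\in\mathcal{P}_2(\mathbb{R}^d)$, $$|g(x_1,\mu_1)-g(x_2,\mu_2)|^2\vee\int_Z|\gamma(x_1,\mu_1,z)-\gamma(x_2,\mu_2,z)|^2\nu(\mathrm{d}z)\le\lambda_3\big(|x_1-x_2|^2+\mathbb{W}_2^2(\mu_1,\mu_2)\big).$$ Assume $b(x,\mu)=b_1(x)+b_2(x,\mu)$ and there are constants $q,L_0,L_1,L_2,L_3,L_4,L_5>0$ such that for all $x_1,x_2\in\mathbb{R}^d$, $\mu_1,\mu_2\in\mathcal{P}_2(\mathbb{R}^d)$, \begin{align*} |b_1(x_1)-b_1(x_2)|^2&\le L_0(1+|x_1|^{2q}+|x_2|^{2q})|x_1-x_2|^2,\\ \langle x_1-x_2,b_1(x_1)-b_1(x_2)\rangle&\le-L_1(1+|x_1|^q+|x_2|^q)|x_1-x_2|^2,\\ \langle x_1-x_2,b_1(x_1)|x_2|^q-b_1(x_2)|x_1|^q\rangle&\le\big(L_2(1+|x_1|^q+|x_2|^q)-L_3|x_1|^q|x_2|^q\big)|x_1-x_2|^2,\\ \big|b_1(x_1)|x_2|^q-b_1(x_2)|x_1|^q\big|^2&\le L_4(1+|x_1|^{2q}+|x_2|^{2q}+|x_1|^{2q}|x_2|^{2q})|x_1-x_2|^2,\\ |b_2(x_1,\mu_1)-b_2(x_2,\mu_2)|^2&\le L_5\big(|x_1-x_2|^2+\mathbb{W}_2^2(\mu_1,\mu_2)\big).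 \end{align*} Suppose $(L_1\wedge2L_3)-1-6L_5-2(m+1)\lambda_3>0$. Put $\rho:=L_1-1-6L_5-2(m+1)\lambda_3$, $\bar\lambda^*:=\frac12\big[(L_1\wedge2L_3)-1-6L_5-2(m+1)\lambda_3\big]$ and $$\Delta^*:=1\wedge\left(\frac{L_1}{2L_2}\right)^2\wedge\left(\frac{\bar\lambda^*}{8(3L_0+4L_4)}\right)^2\wedge\left(\frac{\rho}{4L_0}\right)^2\wedge\frac1\rho.$$ Then for every $\Delta\in(0,\Delta^*]$ there exists a unique invariant probability measure $\Pi^{\Delta,N}\in\mathcal{P}_2((\mathbb{R}^d)^N)$ of the tamed Euler scheme, and it satisfies, for all $\mu\in\mathcal{P}_2(\mathbb{R}^d)$ and $k\in\mathbb{N}_0$, $$\mathbb{W}_2^2\big(\mathbf{P}^{\Delta,N}_{t_k}\mu^{\otimes N},\Pi^{\Delta,N}\big)\le e^{-\bar\lambda^*t_k}\,\mathbb{W}_2^2\big(\mu^{\otimes N},\Pi^{\Delta,N}\big).$$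
   Context: $|\cdot|$ is the Euclidean norm on vectors and the Frobenius norm on matrices; $a\vee b=\max\{a,b\}$, $a\wedge b=\min\{a,b\}$; $\mathbb{N}_0=\mathbb{N}\cup\{0\}$. $\mathcal{P}_2(E)$ ($E=\mathbb{R}^d$ or $(\mathbb{R}^d)^N$) is the set of Borel probability measures on $E$ with finite second moment, with the $L^2$-Wasserstein distance $\mathbb{W}_2$ for the Euclidean norm. $b_1:\mathbb{R}^d\to\mathbb{R}^d$, $b_2:\mathbb{R}^d\times\mathcal{P}_2(\mathbb{R}^d)\to\mathbb{R}^d$, $g:\mathbb{R}^d\times\mathcal{P}_2(\mathbb{R}^d)\to\mathbb{R}^{d\times m}$, $\gamma:\mathbb{R}^d\times\mathcal{P}_2(\mathbb{R}^d)\times Z\to\mathbb{R}^d$ are Borel measurable. $B$ is an $m$-dimensional standard Brownian motion; $N(\mathrm{d}t,\mathrm{d}z)$ is a Poisson random measure independent of $B$ with intensity measure $\nu$ on $Z\subseteq\mathbb{R}^d\setminus\{0\}$, $\nu(Z)<\infty$; $\widetilde N(\mathrm{d}t,\mathrm{d}z)=N(\mathrm{d}t,\mathrm{d}z)-\nu(\mathrm{d}z)\mathrm{d}t$. For $i=1,\dots,N$ ($N\in\mathbb{N}$), $(\xi^i,B^i,\widetilde N^i)$ are i.i.d. copies of $(\xi,B,\widetilde N)$, where $\xi$ is the initial value. Tamed Euler scheme: for $\Delta\in(0,1)$, $t_k=k\Delta$, $X^{i,N}(0)=\xi^i$ and \begin{align*}X^{i,N}(t_{k+1})=&X^{i,N}(t_k)+b_\Delta(X^{i,N}(t_k),\mu^{X,N}_{t_k})\Delta+g(X^{i,N}(t_k),\mu^{X,N}_{t_k})\big(B^i(t_{k+1})-B^i(t_k)\big)\\&+\int_{t_k}^{t_{k+1}}\int_Z\gamma(X^{i,N}(t_k),\mu^{X,N}_{t_k},z)\widetilde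 N^i(\mathrm{d}s,\mathrm{d}z),\end{align*} where $\mu^{X,N}_{t_k}=\frac1N\sum_{j=1}^N\delta_{X^{j,N}(t_k)}$ and $b_\Delta(x,\mu)=\frac{b_1(x)}{1+\sqrt\Delta|x|^q}+b_2(x,\mu)$. $\mathbf{P}^{\Delta,N}_{t_k}$ maps the law of the initial vector $(X^{1,N}(0),\dots,X^{N,N}(0))$ to the law of $(X^{1,N}(t_k),\dots,X^{N,N}(t_k))$; in particular $\mathbf{P}^{\Delta,N}_{t_k}\mu^{\otimes N}$ is the joint law started from i.i.d. particles with law $\mu$. A measure $\Pi\in\mathcal{P}_2((\mathbb{R}^d)^N)$ is invariant for the scheme if $\mathbf{P}^{\Delta,N}_{t_k}\Pi=\Pi$ for all $k\in\mathbb{N}_0$.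
   Formalization: The formal theorem adds that γ(x,μ,·) is square-integrable with respect to ν for every x and every μ in P_2; without it (e.g. γ(x,μ,z)=z, ν with infinite second moment) the scheme leaves P_2 and no invariant measure in P_2 exists. *)

theory Defs
  imports "HOL-Probability.Probability"
begin

section \<open>Probability measures with finite second moment and the Wasserstein distance\<close>

definition P2 :: "'a::euclidean_space measure set" where
  "P2 = {\<mu>. prob_space \<mu> \<and> sets \<mu> = sets borel \<and> integrable \<mu> (\<lambda>x. (norm x)\<^sup>2)}"

definition couplings ::
    "'a::euclidean_space measure \<Rightarrow> 'a measure \<Rightarrow> ('a \<times> 'a) measure set" where
  "couplings \<mu> \<nu> = {\<pi>. prob_space \<pi> \<and> sets \<pi> = sets borel \<and>
                        distr \<pi> borel fst = \<mu> \<and> distr \<pi> borel snd = \<nu>}"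

text \<open>
  On \<^const>\<open>P2\<close> the infimum is finite (the product measure is a coupling of finite cost), so
  the conversion to a real number is faithful there; the definition is meaningful only on
  \<^const>\<open>P2\<close>.
\<close>

definition W2 :: "'a::euclidean_space measure \<Rightarrow> 'a measure \<Rightarrow> real" where
  "W2 \<mu> \<nu> = sqrt (enn2real (INF \<pi>\<in>couplings \<mu> \<nu>.
                     \<integral>\<^sup>+ p. ennreal ((norm (fst p - snd p))\<^sup>2) \<partial>\<pi>))"

definition W2_open :: "'a::euclidean_space measure set \<Rightarrow> bool" where
  "W2_open U \<longleftrightarrow> U \<subseteq> P2 \<and> (\<forall>\<mu>\<in>U. \<exists>e>0. \<forall>\<nu>\<in>P2. W2 \<mu> \<nu> < e \<longrightarrow> \<nu> \<in> U)"

text \<open>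
  The Borel sigma-algebra of the metric space \<open>(P2, W2)\<close>. That space is separable, so
  the product sigma-algebra \<open>borel \<Otimes>\<^sub>M P2_borel\<close> is the Borel sigma-algebra of
  the product space.
\<close>

definition P2_borel :: "'a::euclidean_space measure measure" where
  "P2_borel = sigma P2 {U. W2_open U}"

text \<open>
  A configuration of \<open>N = CARD('n)\<close> particles in \<open>d\<close>-dimensional space (\<open>d = CARD('d)\<close>) is
  a vector of type \<^typ>\<open>real^'d^'n\<close>, whose norm is the Euclidean one. Likewise
  \<^typ>\<open>real^'m^'d\<close> consists of the matrices with \<open>d\<close> rows and \<open>m\<close> columns, and its norm is
  the Frobenius norm. The empirical measure \<open>1/N \<Sum>\<^sub>j \<delta>(x\<^sub>j)\<close> is the law of a uniformly
  chosen particle.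
\<close>

definition empirical_measure :: "real^'d^'n \<Rightarrow> (real^'d) measure" where
  "empirical_measure x = distr (uniform_count_measure (UNIV :: 'n set)) borel (\<lambda>j. x $ j)"

lemma emeasure_empirical_measure:
  fixes x :: "real^'d^'n"
  assumes "A \<in> sets borel"
  shows "emeasure (empirical_measure x) A = ennreal (card {j. x $ j \<in> A} / CARD('n))"
proof -
  have "(\<lambda>j. x $ j) -` A \<inter> space (uniform_count_measure (UNIV :: 'n set)) = {j. x $ j \<in> A}"
    by (auto simp: space_uniform_count_measure)
  moreover have "(\<lambda>j. x $ j) \<in> measurable (uniform_count_measure (UNIV :: 'n set)) borel"
    by (auto simp: measurable_def space_uniform_count_measure sets_uniform_count_measure)
  ultimately show ?thesis
    using assms unfolding empirical_measure_def
    by (simp add: emeasure_distr emeasure_uniform_count_measure)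
qed

definition iid_law :: "(real^'d) measure \<Rightarrow> (real^'d^'n) measure" where
  "iid_law \<mu> = distr (\<Pi>\<^sub>M j\<in>(UNIV :: 'n set). \<mu>) borel (\<lambda>f. \<chi> j. f j)"


section \<open>Driving noise\<close>

text \<open>
  Standard \<open>m\<close>-dimensional Brownian motion. Only times \<open>t \<ge> 0\<close> matter. The increment over
  \<open>[s, t]\<close> has independent centred Gaussian components of variance \<open>t - s\<close>; note that
  \<^const>\<open>normal_density\<close> takes the standard deviation.
\<close>

definition std_brownian_motion :: "'w measure \<Rightarrow> (real \<Rightarrow> 'w \<Rightarrow> real^'m) \<Rightarrow> bool" where
  "std_brownian_motion M B \<longleftrightarrow>
     (\<forall>t\<ge>0. B t \<in> borel_measurable M) \<and>
     (AE \<omega> in M. B 0 \<omega> = 0) \<and>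
     (AE \<omega> in M. continuous_on {0..} (\<lambda>t. B t \<omega>)) \<and>
     (\<forall>t :: nat \<Rightarrow> real. 0 \<le> t 0 \<and> mono t \<longrightarrow>
        prob_space.indep_vars M (\<lambda>_. borel) (\<lambda>i \<omega>. B (t (Suc i)) \<omega> - B (t i) \<omega>) UNIV) \<and>
     (\<forall>s t. 0 \<le> s \<and> s < t \<longrightarrow>
        prob_space.indep_vars M (\<lambda>_. borel) (\<lambda>j \<omega>. (B t \<omega> - B s \<omega>) $ j) UNIV \<and>
        (\<forall>j. distributed M lborel (\<lambda>\<omega>. (B t \<omega> - B s \<omega>) $ j) (normal_density 0 (sqrt (t - s)))))"

text \<open>The measure \<open>dt \<nu>(dz)\<close> on \<open>[0, \<infinity>) \<times> Z\<close>, where \<open>Z = space \<nu>\<close>.\<close>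

definition intensity :: "'z measure \<Rightarrow> (real \<times> 'z) measure" where
  "intensity \<nu> = restrict_space lborel {0..} \<Otimes>\<^sub>M \<nu>"

text \<open>
  Poisson random measure on \<open>[0, \<infinity>) \<times> Z\<close> with intensity \<open>dt \<nu>(dz)\<close>, for finite \<open>\<nu>\<close>.
  Every realization \<open>N \<omega>\<close> is an integer-valued measure with finitely many atoms up to any
  finite time. In the Poisson probabilities \<open>0^0 = 1\<close>, so null sets carry no atoms a.s. Sets of
  infinite intensity need no separate clause, since the intensity is sigma-finite.
\<close>

definition poisson_random_measure ::
    "'w measure \<Rightarrow> 'z measure \<Rightarrow> ('w \<Rightarrow> (real \<times> 'z) measure) \<Rightarrow> bool" where
  "poisson_random_measure M \<nu> N \<longleftrightarrow>
     (\<forall>\<omega>\<in>space M. sets (N \<omega>) = sets (intensity \<nu>) \<and>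
        (\<forall>A\<in>sets (intensity \<nu>). emeasure (N \<omega>) A \<in> range ennreal_of_enat) \<and>
        (\<forall>t\<ge>0. emeasure (N \<omega>) ({0..t} \<times> space \<nu>) < \<infinity>)) \<and>
     (\<forall>A\<in>sets (intensity \<nu>). (\<lambda>\<omega>. emeasure (N \<omega>) A) \<in> borel_measurable M) \<and>
     (\<forall>A\<in>sets (intensity \<nu>). emeasure (intensity \<nu>) A < \<infinity> \<longrightarrow>
        (\<forall>k::nat. measure M {\<omega>\<in>space M. emeasure (N \<omega>) A = of_nat k} =
           exp (- measure (intensity \<nu>) A) * measure (intensity \<nu>) A ^ k / fact k)) \<and>
     (\<forall>A :: nat \<Rightarrow> (real \<times> 'z) set. range A \<subseteq> sets (intensity \<nu>) \<and> disjoint_family A \<longrightarrow>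
        prob_space.indep_vars M (\<lambda>_. borel) (\<lambda>i \<omega>. emeasure (N \<omega>) (A i)) UNIV)"

definition process_sigma :: "'w measure \<Rightarrow> (real \<Rightarrow> 'w \<Rightarrow> real^'m) \<Rightarrow> 'w set set" where
  "process_sigma M B =
     sigma_sets (space M) {B t -` A \<inter> space M | t A. 0 \<le> t \<and> A \<in> sets borel}"

definition random_measure_sigma ::
    "'w measure \<Rightarrow> 'z measure \<Rightarrow> ('w \<Rightarrow> (real \<times> 'z) measure) \<Rightarrow> 'w set set" where
  "random_measure_sigma M \<nu> N =
     sigma_sets (space M)
       {(\<lambda>\<omega>. emeasure (N \<omega>) C) -` A \<inter> space M | C A. C \<in> sets (intensity \<nu>) \<and> A \<in> sets borel}"

text \<open>
  Independent pairs \<open>(B i, N i)\<close> with \<open>B i\<close> independent of \<open>N i\<close>: all \<open>2 N\<close> objects are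
  mutually independent, indexed here by the sum type \<^typ>\<open>'n + 'n\<close>. That the pairs are
  identically distributed is implied, since the definitions above fix the laws.
\<close>

definition particle_noise ::
    "'w measure \<Rightarrow> 'z measure \<Rightarrow> ('n::finite \<Rightarrow> real \<Rightarrow> 'w \<Rightarrow> real^'m) \<Rightarrow>
     ('n \<Rightarrow> 'w \<Rightarrow> (real \<times> 'z) measure) \<Rightarrow> bool" where
  "particle_noise M \<nu> B N \<longleftrightarrow>
     prob_space M \<and>
     (\<forall>i. std_brownian_motion M (B i)) \<and>
     (\<forall>i. poisson_random_measure M \<nu> (N i)) \<and>
     prob_space.indep_sets M
       (case_sum (\<lambda>i. process_sigma M (B i)) (\<lambda>i. random_measure_sigma M \<nu> (N i))) UNIV"

text \<open>
  Integral over \<open>A\<close> against the compensated measure \<open>N(dt,dz) - dt \<nu>(dz)\<close> for one realization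
  \<open>n\<close> of \<open>N\<close>. As \<open>\<nu>\<close> is finite, this pathwise difference is the stochastic integral for
  the integrands used below.
\<close>

definition compensated_integral ::
    "'z measure \<Rightarrow> (real \<times> 'z) measure \<Rightarrow> (real \<times> 'z) set \<Rightarrow> (real \<times> 'z \<Rightarrow> real^'d) \<Rightarrow> real^'d" where
  "compensated_integral \<nu> n A f = (LINT p:A|n. f p) - (LINT p:A|intensity \<nu>. f p)"


section \<open>The tamed Euler scheme\<close>

definition tamed_drift ::
    "real \<Rightarrow> real \<Rightarrow> (real^'d \<Rightarrow> real^'d) \<Rightarrow> (real^'d \<Rightarrow> (real^'d) measure \<Rightarrow> real^'d) \<Rightarrow>
     real^'d \<Rightarrow> (real^'d) measure \<Rightarrow> real^'d" where
  "tamed_drift \<Delta> q b1 b2 x \<mu> = b1 x /\<^sub>R (1 + sqrt \<Delta> * norm x powr q) + b2 x \<mu>"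

text \<open>
  \<open>tamed_euler \<dots> x0 \<omega> k\<close> is the particle configuration at time \<open>k \<Delta>\<close> of the scheme started
  from \<open>x0\<close>, driven by the noise realization \<open>\<omega>\<close>.
\<close>

primrec tamed_euler ::
    "real \<Rightarrow> real \<Rightarrow> (real^'d \<Rightarrow> real^'d) \<Rightarrow> (real^'d \<Rightarrow> (real^'d) measure \<Rightarrow> real^'d) \<Rightarrow>
     (real^'d \<Rightarrow> (real^'d) measure \<Rightarrow> real^'m^'d) \<Rightarrow>
     (real^'d \<Rightarrow> (real^'d) measure \<Rightarrow> 'z \<Rightarrow> real^'d) \<Rightarrow>
     'z measure \<Rightarrow> ('n \<Rightarrow> real \<Rightarrow> 'w \<Rightarrow> real^'m) \<Rightarrow> ('n \<Rightarrow> 'w \<Rightarrow> (real \<times> 'z) measure) \<Rightarrow>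
     real^'d^'n \<Rightarrow> 'w \<Rightarrow> nat \<Rightarrow> real^'d^'n" where
  "tamed_euler \<Delta> q b1 b2 g \<gamma> \<nu> B N x0 \<omega> 0 = x0"
| "tamed_euler \<Delta> q b1 b2 g \<gamma> \<nu> B N x0 \<omega> (Suc k) =
     (let X = tamed_euler \<Delta> q b1 b2 g \<gamma> \<nu> B N x0 \<omega> k;
          \<mu> = empirical_measure X;
          t = real k * \<Delta>;
          t' = real (Suc k) * \<Delta>
      in \<chi> i. X $ i + \<Delta> *\<^sub>R tamed_drift \<Delta> q b1 b2 (X $ i) \<mu>
            + g (X $ i) \<mu> *v (B i t' \<omega> - B i t \<omega>)
            + compensated_integral \<nu> (N i \<omega>) ({t<..t'} \<times> space \<nu>) (\<lambda>(s, z). \<gamma> (X $ i) \<mu> z))"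

text \<open>
  The law of the configuration at time \<open>k \<Delta>\<close> when the initial vector has law \<open>\<pi>\<close> and is
  independent of the noise; the pair (initial vector, noise) is realized on the product space
  \<open>\<pi> \<Otimes>\<^sub>M M\<close>.
\<close>

definition scheme_law ::
    "real \<Rightarrow> real \<Rightarrow> (real^'d \<Rightarrow> real^'d) \<Rightarrow> (real^'d \<Rightarrow> (real^'d) measure \<Rightarrow> real^'d) \<Rightarrow>
     (real^'d \<Rightarrow> (real^'d) measure \<Rightarrow> real^'m^'d) \<Rightarrow>
     (real^'d \<Rightarrow> (real^'d) measure \<Rightarrow> 'z \<Rightarrow> real^'d) \<Rightarrow>
     'z measure \<Rightarrow> 'w measure \<Rightarrow> ('n \<Rightarrow> real \<Rightarrow> 'w \<Rightarrow> real^'m) \<Rightarrow>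
     ('n \<Rightarrow> 'w \<Rightarrow> (real \<times> 'z) measure) \<Rightarrow>
     nat \<Rightarrow> (real^'d^'n) measure \<Rightarrow> (real^'d^'n) measure" where
  "scheme_law \<Delta> q b1 b2 g \<gamma> \<nu> M B N k \<pi> =
     distr (\<pi> \<Otimes>\<^sub>M M) borel (\<lambda>(x0, \<omega>). tamed_euler \<Delta> q b1 b2 g \<gamma> \<nu> B N x0 \<omega> k)"

definition invariant_measure ::
    "(nat \<Rightarrow> (real^'d^'n) measure \<Rightarrow> (real^'d^'n) measure) \<Rightarrow> (real^'d^'n) measure \<Rightarrow> bool" where
  "invariant_measure P \<pi> \<longleftrightarrow> \<pi> \<in> P2 \<and> (\<forall>k. P k \<pi> = \<pi>)"

end

(* One step of the scheme is a random map F of the particle configuration, driven by the Brownian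
   increments and Poisson counts on one window of the time grid. The windows are independent and the
   law of F(x) is the same on each of them, so the law after k steps is the k-th iterate of
   T pi = law of F(X), where X has law pi and is independent of the noise.

   The dissipativity of b1, which survives the taming, and the Lipschitz bounds for the remaining
   coefficients give E|F(x) - F(y)|^2 <= r |x - y|^2 with r = 1 - lam Delta <= exp(- lam Delta).
   Applying F to an almost optimal coupling shows that T contracts the squared Wasserstein distance
   by r, which gives uniqueness of the fixed point and the decay. For existence, composing i.i.d.
   copies of F in reversed order, (F_1 o ... o F_n)(0), gives a sequence that converges almost surely
   and in mean square; the law of its limit is invariant. *)

theory Submission
  imports Defs
begin

section \<open>Laws and the Wasserstein distance\<close>

text \<open>Independence is given in weak forms: Poisson counts are independent over disjoint sets,
  increments within one Brownian motion. The iteration needs the whole noise of the past windows to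
  be independent of the whole noise of the present one; much of the noise part serves this.
  Couplings within \<open>e\<close> of the infimum stand in for optimal ones, and pathwise
  convergence for completeness of the Wasserstein space. The rate comes from a budget. With
  \<open>K = min L1 (2 * L3)\<close> the tamed drift is dissipative at rate \<open>K - lam\<close>,
  where \<open>lam\<close> pays for the taming and for the square of the drift increment. The cross
  term with \<open>b2\<close> costs 1 by Young's inequality; all \<open>b2\<close> terms together
  cost \<open>3 * L5\<close>, diffusion and jumps \<open>lam3\<close> each. The last three costs are
  doubled, because summed over the particles the distance of the empirical measures counts at most
  as much as that of the particles. As \<open>K - 1 - 6 * L5 - 4 * lam3\<close> is at least
  \<open>2 * lam\<close>, a rate of \<open>lam\<close> remains.\<close>

lemma le_square_plus:
  fixes a e :: real
  assumes "e > 0"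
  shows "a \<le> a\<^sup>2 / (2 * e) + e / 2"
proof -
  have "2 * e * a \<le> a\<^sup>2 + e\<^sup>2" using sum_squares_bound[of a e] by (simp add: ac_simps)
  then show ?thesis using assms by (simp add: field_simps power2_eq_square)
qed

text \<open>Closed sets form an intersection-stable generator, and the indicator of a closed set
  \<open>C\<close> is the pointwise limit of the Lipschitz functions
  \<open>max 0 (1 - real n * infdist x C)\<close>. Lipschitz test functions suit both uses:
  Wasserstein distance zero, and almost sure limits.\<close>

lemma borel_measure_eqI_lipschitz:
  fixes \<mu> \<nu> :: "'a::euclidean_space measure"
  assumes "prob_space \<mu>" "prob_space \<nu>" and s: "sets \<mu> = sets borel" "sets \<nu> = sets borel"
    and eq: "\<And>f :: 'a \<Rightarrow> real. \<And>L. (\<And>x. 0 \<le> f x \<and> f x \<le> 1) \<Longrightarrow> 0 \<le> L \<Longrightarrow>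
       (\<And>x y. \<bar>f x - f y\<bar> \<le> L * dist x y) \<Longrightarrow> integral\<^sup>L \<mu> f = integral\<^sup>L \<nu> f"
  shows "\<mu> = \<nu>"
proof (rule measure_eqI_generator_eq[where E="{C. closed C}" and \<Omega>=UNIV and A="\<lambda>_. UNIV"])
  interpret \<mu>: prob_space \<mu> by fact
  interpret \<nu>: prob_space \<nu> by fact
  show "Int_stable {C::'a set. closed C}" by (auto simp: Int_stable_def)
  show "sets \<mu> = sigma_sets UNIV {C. closed C}" "sets \<nu> = sigma_sets UNIV {C. closed C}"
    using s by (simp_all add: borel_eq_closed)
  show "emeasure \<mu> UNIV \<noteq> \<infinity>" by simp
  fix C :: "'a set" assume "C \<in> {C. closed C}"
  then have C: "closed C" by simp
  show "emeasure \<mu> C = emeasure \<nu> C"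
  \<comment> \<open>The empty set is split off because \<open>infdist x {} = 0\<close> by
    convention, which would make every \<open>f n\<close> constantly 1.\<close>
  proof (cases "C = {}")
    case False
    define f where "f n x = max 0 (1 - real n * infdist x C)" for n x
    have bd: "0 \<le> f n x \<and> f n x \<le> 1" for n x
      by (auto simp: f_def infdist_nonneg)
    have lip: "\<bar>f n x - f n y\<bar> \<le> real n * dist x y" for n x y
    proof -
      have "\<bar>f n x - f n y\<bar> \<le> \<bar>real n * infdist x C - real n * infdist y C\<bar>"
        by (auto simp: f_def)
      also have "\<dots> = real n * \<bar>infdist x C - infdist y C\<bar>"
        by (simp add: abs_mult flip: right_diff_distrib)
      also have "\<dots> \<le> real n * dist x y"
        by (intro mult_left_mono infdist_triangle_abs) auto
      finally show ?thesis .
    qed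
    have lim: "(\<lambda>n. f n x) \<longlonglongrightarrow> indicator C x" for x
    proof (cases "x \<in> C")
      case True
      then show ?thesis by (simp add: f_def)
    next
      case nin: False
      then have pos: "infdist x C > 0"
        using C False in_closed_iff_infdist_zero[of C x] infdist_nonneg[of x C] by fastforce
      obtain n0 :: nat where n0: "1 / infdist x C < real n0" using reals_Archimedean2 by blast
      have "f n x = 0" if "n \<ge> n0" for n
      proof -
        have "1 / infdist x C < real n" using n0 that by linarith
        then have "1 < real n * infdist x C" using pos by (simp add: field_simps)
        then show ?thesis by (simp add: f_def)
      qed
      then show ?thesis
        using nin by (auto intro!: tendsto_eventually eventually_sequentiallyI[of n0])
    qed
    have m: "f n \<in> borel_measurable borel" for n
      unfolding f_def by (intro borel_measurable_continuous_onI continuous_intros)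
    have 1: "(\<lambda>n. integral\<^sup>L \<mu> (f n)) \<longlonglongrightarrow> integral\<^sup>L \<mu> (indicator C :: _ \<Rightarrow> real)"
      using C bd lim by (intro integral_dominated_convergence[where w="\<lambda>_. 1"])
         (auto simp: measurable_cong_sets[OF s(1) refl] m)
    have 2: "(\<lambda>n. integral\<^sup>L \<nu> (f n)) \<longlonglongrightarrow> integral\<^sup>L \<nu> (indicator C :: _ \<Rightarrow> real)"
      using C bd lim by (intro integral_dominated_convergence[where w="\<lambda>_. 1"])
         (auto simp: measurable_cong_sets[OF s(2) refl] m)
    have "integral\<^sup>L \<mu> (f n) = integral\<^sup>L \<nu> (f n)" for n
      by (rule eq[where L="real n"]) (use bd lip in auto)
    then have "integral\<^sup>L \<mu> (indicator C :: _ \<Rightarrow> real) = integral\<^sup>L \<nu> (indicator C :: _ \<Rightarrow> real)"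
      using LIMSEQ_unique[OF 1] 2 by simp
    then show ?thesis
      using C s by (simp add: \<mu>.emeasure_eq_measure \<nu>.emeasure_eq_measure)
  qed simp
qed (use s in auto)

text \<open>Lipschitz test functions pass to almost sure limits by dominated convergence. The two
  sequences may live on different probability spaces, as only laws are compared; this carries
  equality of laws from simple to integrable integrands.\<close>

lemma distr_limit_eq:
  fixes X Y :: "nat \<Rightarrow> _ \<Rightarrow> 'b::euclidean_space"
  assumes M: "prob_space M" "prob_space M'"
    and X [measurable]: "\<And>n. X n \<in> borel_measurable M" "X' \<in> borel_measurable M"
    and Y [measurable]: "\<And>n. Y n \<in> borel_measurable M'" "Y' \<in> borel_measurable M'"
    and lX: "AE w in M. (\<lambda>n. X n w) \<longlonglongrightarrow> X' w"
    and lY: "AE w in M'. (\<lambda>n. Y n w) \<longlonglongrightarrow> Y' w"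
    and eq: "\<And>n. distr M borel (X n) = distr M' borel (Y n)"
  shows "distr M borel X' = distr M' borel Y'"
proof (rule borel_measure_eqI_lipschitz)
  interpret M: prob_space M by fact
  interpret M': prob_space M' by fact
  show "prob_space (distr M borel X')" "prob_space (distr M' borel Y')"
    by (auto intro: M.prob_space_distr M'.prob_space_distr)
  fix f :: "'b \<Rightarrow> real" and L
  assume bd: "\<And>x. 0 \<le> f x \<and> f x \<le> 1" and "0 \<le> L"
    and lip: "\<And>x y. \<bar>f x - f y\<bar> \<le> L * dist x y"
  have cont: "continuous_on UNIV f"
    by (rule lipschitz_on_continuous_on[where L=L])
       (use \<open>0 \<le> L\<close> lip in \<open>auto simp: lipschitz_on_def dist_real_def\<close>)
  then have [measurable]: "f \<in> borel_measurable borel" by (rule borel_measurable_continuous_onI)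
  have c: "isCont f x" for x using cont by (simp add: continuous_on_eq_continuous_at)
  have alX: "AE w in M. (\<lambda>n. f (X n w)) \<longlonglongrightarrow> f (X' w)"
    using lX by eventually_elim (rule isCont_tendsto_compose[OF c])
  have 1: "(\<lambda>n. \<integral>w. f (X n w) \<partial>M) \<longlonglongrightarrow> (\<integral>w. f (X' w) \<partial>M)"
    by (rule integral_dominated_convergence[where w="\<lambda>_. 1"])
       (use bd alX in auto)
  have alY: "AE w in M'. (\<lambda>n. f (Y n w)) \<longlonglongrightarrow> f (Y' w)"
    using lY by eventually_elim (rule isCont_tendsto_compose[OF c])
  have 2: "(\<lambda>n. \<integral>w. f (Y n w) \<partial>M') \<longlonglongrightarrow> (\<integral>w. f (Y' w) \<partial>M')"
    by (rule integral_dominated_convergence[where w="\<lambda>_. 1"])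
       (use bd alY in auto)
  have "(\<integral>w. f (X n w) \<partial>M) = (\<integral>w. f (Y n w) \<partial>M')" for n
    using arg_cong[OF eq[of n], of "\<lambda>m. integral\<^sup>L m f"] by (simp add: integral_distr)
  then have "(\<integral>w. f (X' w) \<partial>M) = (\<integral>w. f (Y' w) \<partial>M')"
    using LIMSEQ_unique[OF 1] 2 by simp
  then show "integral\<^sup>L (distr M borel X') f = integral\<^sup>L (distr M' borel Y') f"
    by (simp add: integral_distr)
qed auto

section \<open>Measures with finite second moment, couplings and \<open>W2\<close>\<close>

lemma P2D:
  assumes "\<mu> \<in> P2"
  shows "prob_space \<mu>" "sets \<mu> = sets borel" "space \<mu> = UNIV"
    "integrable \<mu> (\<lambda>x. (norm x)\<^sup>2)" "(\<integral>\<^sup>+x. ennreal ((norm x)\<^sup>2) \<partial>\<mu>) < \<infinity>"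
proof -
  show *: "prob_space \<mu>" "sets \<mu> = sets borel" "integrable \<mu> (\<lambda>x. (norm x)\<^sup>2)"
    using assms by (auto simp: P2_def)
  show "space \<mu> = UNIV" using sets_eq_imp_space_eq[OF *(2)] by simp
  show "(\<integral>\<^sup>+x. ennreal ((norm x)\<^sup>2) \<partial>\<mu>) < \<infinity>"
    using *(3) by (simp add: nn_integral_eq_integral)
qed

lemma P2I:
  assumes "prob_space \<mu>" "sets \<mu> = sets borel" "(\<integral>\<^sup>+x. ennreal ((norm x)\<^sup>2) \<partial>\<mu>) < \<infinity>"
  shows "\<mu> \<in> P2"
proof -
  have "(\<lambda>x. (norm x)\<^sup>2) \<in> borel_measurable \<mu>"
    by (simp add: measurable_cong_sets[OF assms(2) refl])
  then show ?thesis
    using assms by (auto simp: P2_def integrable_iff_bounded)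
qed

lemma distr_in_P2I:
  assumes "prob_space M" "X \<in> borel_measurable M" "(\<integral>\<^sup>+w. ennreal ((norm (X w))\<^sup>2) \<partial>M) < \<infinity>"
  shows "distr M borel X \<in> P2"
  using assms by (intro P2I) (auto simp: nn_integral_distr intro: prob_space.prob_space_distr)

lemma couplingsD:
  fixes \<pi> :: "('a::euclidean_space \<times> 'a) measure"
  assumes "\<pi> \<in> couplings \<mu> \<nu>"
  shows "prob_space \<pi>" "sets \<pi> = sets borel" "distr \<pi> borel fst = \<mu>" "distr \<pi> borel snd = \<nu>"
    "fst \<in> borel_measurable \<pi>" "snd \<in> borel_measurable \<pi>"
proof -
  show *: "prob_space \<pi>" "sets \<pi> = sets borel" "distr \<pi> borel fst = \<mu>" "distr \<pi> borel snd = \<nu>"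
    using assms by (auto simp: couplings_def)
  show "fst \<in> borel_measurable \<pi>" "snd \<in> borel_measurable \<pi>"
    by (simp_all add: measurable_cong_sets[OF *(2) refl] borel_measurable_continuous_onI
         continuous_on_fst continuous_on_snd continuous_on_id)
qed

lemma distr_in_couplings:
  assumes "prob_space M" and [measurable]: "X \<in> borel_measurable M" "Y \<in> borel_measurable M"
  shows "distr M borel (\<lambda>w. (X w, Y w)) \<in> couplings (distr M borel X) (distr M borel Y)"
proof -
  have [measurable]: "fst \<in> borel_measurable borel" "snd \<in> borel_measurable borel"
    by (simp_all add: borel_measurable_continuous_onI continuous_on_fst continuous_on_snd continuous_on_id)
  show ?thesis
    using assms(1) by (auto simp: couplings_def distr_distr o_def prob_space.prob_space_distr)
qed

lemma norm_add_sq_le: "(norm (x + y))\<^sup>2 \<le> 2 * (norm x)\<^sup>2 + 2 * (norm (y::'a::real_inner))\<^sup>2"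
proof -
  have "0 \<le> (norm (x - y))\<^sup>2" by simp
  then show ?thesis by (simp add: power2_norm_eq_inner inner_diff_left inner_diff_right
     inner_add_left inner_add_right inner_commute)
qed

lemma norm_diff_sq_le: "(norm (x - y))\<^sup>2 \<le> 2 * (norm x)\<^sup>2 + 2 * (norm (y::'a::real_inner))\<^sup>2"
  using norm_add_sq_le[of x "-y"] by simp

text \<open>The product measure is a coupling, of cost at most twice the sum of the second moments.
  Finiteness matters because \<open>enn2real\<close> sends infinity to 0, so that \<open>W2\<close>
  would not control an infinite infimum.\<close>

lemma P2_coupling_finite:
  assumes "\<mu> \<in> P2" "\<nu> \<in> P2"
  shows "\<exists>\<pi>\<in>couplings \<mu> \<nu>. (\<integral>\<^sup>+p. ennreal ((norm (fst p - snd p))\<^sup>2) \<partial>\<pi>) < \<infinity>"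
proof -
  interpret \<mu>: prob_space \<mu> using assms P2D by blast
  interpret \<nu>: prob_space \<nu> using assms P2D by blast
  interpret P: pair_prob_space \<mu> \<nu> ..
  have [measurable_cong]: "sets \<mu> = sets borel" "sets \<nu> = sets borel" using assms P2D by auto
  let ?D = "distr (\<mu> \<Otimes>\<^sub>M \<nu>) borel (\<lambda>w. (fst w, snd w))"
  have e: "distr (\<mu> \<Otimes>\<^sub>M \<nu>) borel fst = \<mu>" "distr (\<mu> \<Otimes>\<^sub>M \<nu>) borel snd = \<nu>"
  proof -
    show "distr (\<mu> \<Otimes>\<^sub>M \<nu>) borel fst = \<mu>"
    proof (rule measure_eqI)
      fix A assume "A \<in> sets (distr (\<mu> \<Otimes>\<^sub>M \<nu>) borel fst)"
      then have A: "A \<in> sets borel" by simp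
      have "fst -` A \<inter> space (\<mu> \<Otimes>\<^sub>M \<nu>) = A \<times> space \<nu>"
        using assms P2D(3) by (auto simp: space_pair_measure)
      then show "emeasure (distr (\<mu> \<Otimes>\<^sub>M \<nu>) borel fst) A = emeasure \<mu> A"
        using A assms P2D by (simp add: emeasure_distr \<nu>.emeasure_pair_measure_Times \<nu>.emeasure_space_1 del: space_pair_measure)
    qed (use assms P2D in auto)
    show "distr (\<mu> \<Otimes>\<^sub>M \<nu>) borel snd = \<nu>"
    proof (rule measure_eqI)
      fix A assume "A \<in> sets (distr (\<mu> \<Otimes>\<^sub>M \<nu>) borel snd)"
      then have A: "A \<in> sets borel" by simp
      have "snd -` A \<inter> space (\<mu> \<Otimes>\<^sub>M \<nu>) = space \<mu> \<times> A"
        using assms P2D(3) by (auto simp: space_pair_measure)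
      then show "emeasure (distr (\<mu> \<Otimes>\<^sub>M \<nu>) borel snd) A = emeasure \<nu> A"
        using A assms P2D by (simp add: emeasure_distr \<nu>.emeasure_pair_measure_Times \<mu>.emeasure_space_1 del: space_pair_measure)
    qed (use assms P2D in auto)
  qed
  have c: "?D \<in> couplings \<mu> \<nu>"
    using distr_in_couplings[of "\<mu> \<Otimes>\<^sub>M \<nu>" fst snd] e P.prob_space_axioms by simp
  have "(\<integral>\<^sup>+p. ennreal ((norm (fst p - snd p))\<^sup>2) \<partial>?D)
     = (\<integral>\<^sup>+p. ennreal ((norm (fst p - snd p))\<^sup>2) \<partial>(\<mu> \<Otimes>\<^sub>M \<nu>))"
    by (subst nn_integral_distr) (auto simp: borel_prod[symmetric])
  also have "\<dots> \<le> (\<integral>\<^sup>+p. 2 * ennreal ((norm (fst p))\<^sup>2) + 2 * ennreal ((norm (snd p))\<^sup>2) \<partial>(\<mu> \<Otimes>\<^sub>M \<nu>))"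
  proof (intro nn_integral_mono)
    fix p :: "'a \<times> 'a"
    have "ennreal ((norm (fst p - snd p))\<^sup>2) \<le> ennreal (2 * (norm (fst p))\<^sup>2 + 2 * (norm (snd p))\<^sup>2)"
      by (intro ennreal_leI norm_diff_sq_le)
    then show "ennreal ((norm (fst p - snd p))\<^sup>2) \<le> 2 * ennreal ((norm (fst p))\<^sup>2) + 2 * ennreal ((norm (snd p))\<^sup>2)"
      by (simp add: ennreal_plus ennreal_mult')
  qed
  also have "\<dots> = 2 * (\<integral>\<^sup>+x. ennreal ((norm x)\<^sup>2) \<partial>distr (\<mu> \<Otimes>\<^sub>M \<nu>) borel fst)
      + 2 * (\<integral>\<^sup>+x. ennreal ((norm x)\<^sup>2) \<partial>distr (\<mu> \<Otimes>\<^sub>M \<nu>) borel snd)"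
    by (simp add: nn_integral_add nn_integral_cmult nn_integral_distr)
  also have "\<dots> < \<infinity>"
    unfolding e using P2D(5)[OF assms(1)] P2D(5)[OF assms(2)] by (simp add: ennreal_mult_less_top)
  finally show ?thesis using c by blast
qed

lemma W2_nonneg [simp]: "0 \<le> W2 \<mu> \<nu>"
  by (simp add: W2_def)

lemma W2_sq_eq: "(W2 \<mu> \<nu>)\<^sup>2 = enn2real (INF \<pi>\<in>couplings \<mu> \<nu>. \<integral>\<^sup>+ p. ennreal ((norm (fst p - snd p))\<^sup>2) \<partial>\<pi>)"
  by (simp add: W2_def)

lemma W2_sq_le:
  assumes "\<pi> \<in> couplings \<mu> \<nu>" "(\<integral>\<^sup>+ p. ennreal ((norm (fst p - snd p))\<^sup>2) \<partial>\<pi>) \<le> ennreal c" "0 \<le> c"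
  shows "(W2 \<mu> \<nu>)\<^sup>2 \<le> c"
proof -
  have "(INF \<pi>\<in>couplings \<mu> \<nu>. \<integral>\<^sup>+ p. ennreal ((norm (fst p - snd p))\<^sup>2) \<partial>\<pi>) \<le> ennreal c"
    using assms by (auto intro: INF_lower2)
  then show ?thesis unfolding W2_sq_eq using assms(3) by (metis enn2real_leI)
qed

text \<open>The upper bounds on \<open>W2\<close> below arise from two random variables on a common
  space, whose joint law is the coupling.\<close>

lemma W2_sq_le_distr:
  assumes "prob_space M" and [measurable]: "X \<in> borel_measurable M" "Y \<in> borel_measurable M"
    and "(\<integral>\<^sup>+ w. ennreal ((norm (X w - Y w))\<^sup>2) \<partial>M) \<le> ennreal c" "0 \<le> c"
  shows "(W2 (distr M borel X) (distr M borel Y))\<^sup>2 \<le> c"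
proof (rule W2_sq_le[OF distr_in_couplings])
  show "(\<integral>\<^sup>+ p. ennreal ((norm (fst p - snd p))\<^sup>2) \<partial>distr M borel (\<lambda>w. (X w, Y w))) \<le> ennreal c"
    using assms(4) by (subst nn_integral_distr) (auto simp: borel_prod[symmetric])
qed (use assms in auto)

text \<open>Couplings that are optimal up to an additive \<open>e\<close> suffice, since the
  inequalities derived from them survive the passage of \<open>e\<close> to 0. Adding
  \<open>e\<close> strictly increases the infimum because it is finite.\<close>

lemma W2_approx:
  assumes "\<mu> \<in> P2" "\<nu> \<in> P2" "e > 0"
  obtains \<pi> where "\<pi> \<in> couplings \<mu> \<nu>"
    "(\<integral>\<^sup>+ p. ennreal ((norm (fst p - snd p))\<^sup>2) \<partial>\<pi>) \<le> ennreal ((W2 \<mu> \<nu>)\<^sup>2 + e)"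
proof -
  let ?I = "INF \<pi>\<in>couplings \<mu> \<nu>. \<integral>\<^sup>+ p. ennreal ((norm (fst p - snd p))\<^sup>2) \<partial>\<pi>"
  have fin: "?I < \<infinity>"
    using P2_coupling_finite[OF assms(1,2)] by (auto simp: INF_less_iff)
  then have "?I < ?I + ennreal e" using assms(3)
    by (cases ?I) (auto simp: ennreal_plus[symmetric] ennreal_less_iff simp del: ennreal_plus)
  then obtain \<pi> where \<pi>: "\<pi> \<in> couplings \<mu> \<nu>"
    "(\<integral>\<^sup>+ p. ennreal ((norm (fst p - snd p))\<^sup>2) \<partial>\<pi>) < ?I + ennreal e"
    by (auto simp: INF_less_iff)
  have "?I + ennreal e = ennreal ((W2 \<mu> \<nu>)\<^sup>2 + e)"
    unfolding W2_sq_eq using fin assms(3) by (simp add: ennreal_plus)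
  then show ?thesis using that[of \<pi>] \<pi> by auto
qed

text \<open>Under a coupling of small cost, the two integrals of an \<open>L\<close>-Lipschitz
  function differ by at most \<open>L\<close> times the mean distance, which the cost
  controls.\<close>

lemma W2_zero_imp_eq:
  fixes \<mu> \<nu> :: "'a::euclidean_space measure"
  assumes "\<mu> \<in> P2" "\<nu> \<in> P2" and W: "W2 \<mu> \<nu> = 0"
  shows "\<mu> = \<nu>"
proof (rule borel_measure_eqI_lipschitz)
  fix f :: "'a \<Rightarrow> real" and L
  assume bd: "\<And>x. 0 \<le> f x \<and> f x \<le> 1" and L: "0 \<le> L"
    and lip: "\<And>x y. \<bar>f x - f y\<bar> \<le> L * dist x y"
  have cont: "continuous_on UNIV f"
    by (rule lipschitz_on_continuous_on[where L=L])
       (use L lip in \<open>auto simp: lipschitz_on_def dist_real_def\<close>)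
  then have [measurable]: "f \<in> borel_measurable borel" by (rule borel_measurable_continuous_onI)
  \<comment> \<open>\<open>L + 1\<close> instead of \<open>L\<close> keeps the later choice
    \<open>e / (L+1)\<close> meaningful for \<open>L = 0\<close>.\<close>
  have le: "\<bar>integral\<^sup>L \<mu> f - integral\<^sup>L \<nu> f\<bar> \<le> (L+1) * e" if e: "e > 0" for e :: real
  proof -
    obtain \<pi> where \<pi>: "\<pi> \<in> couplings \<mu> \<nu>"
      "(\<integral>\<^sup>+ p. ennreal ((norm (fst p - snd p))\<^sup>2) \<partial>\<pi>) \<le> ennreal (e\<^sup>2)"
      using W2_approx[OF assms(1,2), of "e\<^sup>2"] W e by auto
    note c = couplingsD[OF \<pi>(1)]
    interpret prob_space \<pi> by fact
    have [measurable]: "fst \<in> borel_measurable \<pi>" "snd \<in> borel_measurable \<pi>" by (rule c)+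
    have int: "integrable \<pi> (\<lambda>p. (norm (fst p - snd p))\<^sup>2)"
      using \<pi>(2) by (auto simp: integrable_iff_bounded intro: le_less_trans)
    have sq: "(\<integral>p. (norm (fst p - snd p))\<^sup>2 \<partial>\<pi>) \<le> e\<^sup>2"
      using \<pi>(2) nn_integral_eq_integral[OF int] by simp
    have intd: "integrable \<pi> (\<lambda>p. norm (fst p - snd p))"
      by (rule square_integrable_imp_integrable) (use int in auto)
    have "(\<integral>p. norm (fst p - snd p) \<partial>\<pi>) \<le> (\<integral>p. (norm (fst p - snd p))\<^sup>2 / (2*e) + e/2 \<partial>\<pi>)"
      by (intro integral_mono intd le_square_plus[OF e] Bochner_Integration.integrable_add integrable_divide int) auto
    also have "\<dots> = (\<integral>p. (norm (fst p - snd p))\<^sup>2 \<partial>\<pi>) / (2*e) + e/2"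
      using int by (simp add: prob_space)
    also have "\<dots> \<le> e\<^sup>2 / (2*e) + e/2"
      using sq e by (intro add_right_mono divide_right_mono) auto
    also have "\<dots> = e" using e by (simp add: field_simps power2_eq_square)
    finally have ee: "(\<integral>p. norm (fst p - snd p) \<partial>\<pi>) \<le> e" .
    have ib: "integrable \<pi> (\<lambda>p. f (fst p))" "integrable \<pi> (\<lambda>p. f (snd p))"
      by (rule integrable_const_bound[where B=1]; use bd in auto)+
    have "integral\<^sup>L \<mu> f - integral\<^sup>L \<nu> f = (\<integral>p. f (fst p) - f (snd p) \<partial>\<pi>)"
      using ib by (simp add: c(3,4)[symmetric] integral_distr)
    also have "\<bar>\<dots>\<bar> \<le> (\<integral>p. \<bar>f (fst p) - f (snd p)\<bar> \<partial>\<pi>)"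
      by (rule integral_abs_bound)
    also have "\<dots> \<le> (\<integral>p. L * norm (fst p - snd p) \<partial>\<pi>)"
      by (rule integral_mono) (use ib intd lip in \<open>auto simp: dist_norm\<close>)
    also have "\<dots> \<le> L * e" using ee L by (simp add: mult_left_mono)
    also have "\<dots> \<le> (L+1) * e" using e by (simp add: algebra_simps)
    finally show ?thesis .
  qed
  have "\<bar>integral\<^sup>L \<mu> f - integral\<^sup>L \<nu> f\<bar> \<le> 0"
  proof (rule field_le_epsilon)
    fix e :: real assume "0 < e"
    then show "\<bar>integral\<^sup>L \<mu> f - integral\<^sup>L \<nu> f\<bar> \<le> 0 + e"
      using le[of "e / (L+1)"] L by simp
  qed
  then show "integral\<^sup>L \<mu> f = integral\<^sup>L \<nu> f" by simp
qed (use P2D[OF assms(1)] P2D[OF assms(2)] in auto)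

section \<open>Random maps that contract in mean square\<close>

text \<open>Expand the square of the norm of \<open>e *\<^sub>R x - y\<close> and divide by
  \<open>e\<close>. The weight matters: the factor 2 of \<open>norm_add_sq_le\<close> would turn a
  contraction rate \<open>r\<close> into \<open>2 * r\<close>, whereas \<open>(1 + e) * r\<close>
  stays below 1 for small \<open>e\<close>.\<close>

lemma norm_add_sq_le_weighted:
  fixes x y :: "'a::real_inner"
  assumes "e > 0"
  shows "(norm (x + y))\<^sup>2 \<le> (1 + e) * (norm x)\<^sup>2 + (1 + 1/e) * (norm y)\<^sup>2"
proof -
  have n: "(norm (e *\<^sub>R x - y))\<^sup>2 = e\<^sup>2 * (norm x)\<^sup>2 - 2 * e * (x \<bullet> y) + (norm y)\<^sup>2"
    unfolding power2_norm_eq_inner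
    by (simp add: inner_diff_left inner_diff_right inner_commute power2_eq_square algebra_simps)
  have "0 \<le> (norm (e *\<^sub>R x - y))\<^sup>2 / e" using assms by simp
  also have "\<dots> = e * (norm x)\<^sup>2 - 2 * (x \<bullet> y) + (norm y)\<^sup>2 / e"
    unfolding n using assms by (simp add: field_simps power2_eq_square)
  finally show ?thesis
    by (simp add: power2_norm_eq_inner inner_add_left inner_add_right inner_commute algebra_simps)
qed

text \<open>The maps contract on average over the noise; a single realization need not be a
  contraction. The fixed point therefore belongs to the induced map on laws.\<close>

locale contracting_random_map = prob_space M for M :: "'w measure" +
  fixes F :: "'a::euclidean_space \<Rightarrow> 'w \<Rightarrow> 'a" and r :: real
  assumes F_measurable: "(\<lambda>(x, w). F x w) \<in> borel_measurable (borel \<Otimes>\<^sub>M M)"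
    and r: "0 < r" "r < 1"
    and contraction: "\<And>x y. (\<integral>\<^sup>+w. ennreal ((norm (F x w - F y w))\<^sup>2) \<partial>M) \<le> ennreal (r * (norm (x - y))\<^sup>2)"
    and F_0_finite: "(\<integral>\<^sup>+w. ennreal ((norm (F 0 w))\<^sup>2) \<partial>M) < \<infinity>"
begin

lemma F_measurable' [measurable (raw)]:
  assumes "f \<in> borel_measurable K" "g \<in> measurable K M"
  shows "(\<lambda>x. F (f x) (g x)) \<in> borel_measurable K"
  using measurable_compose[OF measurable_Pair[OF assms] F_measurable] by simp

text \<open>The action on laws of the Markov kernel that sends \<open>x\<close> to the law of
  \<open>F x\<close>.\<close>

definition push :: "'a measure \<Rightarrow> 'a measure" where
  "push \<pi> = distr (\<pi> \<Otimes>\<^sub>M M) borel (\<lambda>(x, w). F x w)"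

definition F0_moment :: real where
  "F0_moment = enn2real (\<integral>\<^sup>+w. ennreal ((norm (F 0 w))\<^sup>2) \<partial>M)"

lemma F0_moment: "(\<integral>\<^sup>+w. ennreal ((norm (F 0 w))\<^sup>2) \<partial>M) = ennreal F0_moment" "0 \<le> F0_moment"
  using F_0_finite by (auto simp: F0_moment_def)

text \<open>The input may be realized on any probability space. With a coupling as that space, both
  marginals can be moved by the same noise.\<close>

lemma push_distr:
  assumes "prob_space P" and [measurable]: "X \<in> borel_measurable P"
  shows "push (distr P borel X) = distr (P \<Otimes>\<^sub>M M) borel (\<lambda>(p, w). F (X p) w)"
proof -
  interpret P: prob_space P by fact
  have "distr P borel X \<Otimes>\<^sub>M distr M M (\<lambda>w. w) = distr (P \<Otimes>\<^sub>M M) (borel \<Otimes>\<^sub>M M) (\<lambda>(p, w). (X p, w))"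
    by (rule pair_measure_distr) (auto simp: distr_id intro: prob_space_imp_sigma_finite prob_space_axioms)
  then show ?thesis
    unfolding push_def by (simp add: distr_id distr_distr o_def case_prod_unfold)
qed

text \<open>Compare with the image of 0. The crude factor 2 is harmless because only finiteness is
  drawn from this bound.\<close>

lemma moment_F_le:
  "(\<integral>\<^sup>+w. ennreal ((norm (F x w))\<^sup>2) \<partial>M) \<le> ennreal (2 * r * (norm x)\<^sup>2 + 2 * F0_moment)"
proof -
  have "(\<integral>\<^sup>+w. ennreal ((norm (F x w))\<^sup>2) \<partial>M)
      \<le> (\<integral>\<^sup>+w. 2 * ennreal ((norm (F x w - F 0 w))\<^sup>2) + 2 * ennreal ((norm (F 0 w))\<^sup>2) \<partial>M)"
  proof (rule nn_integral_mono)
    fix w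
    have "ennreal ((norm (F x w))\<^sup>2) \<le> ennreal (2 * (norm (F x w - F 0 w))\<^sup>2 + 2 * (norm (F 0 w))\<^sup>2)"
      using norm_add_sq_le[of "F x w - F 0 w" "F 0 w"] by (intro ennreal_leI) simp
    then show "ennreal ((norm (F x w))\<^sup>2) \<le> 2 * ennreal ((norm (F x w - F 0 w))\<^sup>2) + 2 * ennreal ((norm (F 0 w))\<^sup>2)"
      by (simp add: ennreal_mult')
  qed
  also have "\<dots> = 2 * (\<integral>\<^sup>+w. ennreal ((norm (F x w - F 0 w))\<^sup>2) \<partial>M) + 2 * ennreal F0_moment"
    by (simp add: nn_integral_add nn_integral_cmult F0_moment(1))
  also have "\<dots> \<le> 2 * ennreal (r * (norm (x - 0))\<^sup>2) + 2 * ennreal F0_moment"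
    by (intro add_right_mono mult_left_mono contraction) auto
  also have "\<dots> = ennreal (2 * r * (norm x)\<^sup>2 + 2 * F0_moment)"
    using r F0_moment(2) by (simp add: ennreal_mult' ennreal_plus mult.assoc)
  finally show ?thesis .
qed

lemma push_P2:
  assumes "\<pi> \<in> P2" shows "push \<pi> \<in> P2"
  unfolding push_def
proof (rule distr_in_P2I)
  interpret \<pi>: prob_space \<pi> using P2D[OF assms] by simp
  interpret P: pair_prob_space \<pi> M ..
  have [measurable_cong]: "sets \<pi> = sets borel" using P2D[OF assms] by simp
  show "prob_space (\<pi> \<Otimes>\<^sub>M M)" by (rule P.prob_space_axioms)
  show "(\<lambda>(x, w). F x w) \<in> borel_measurable (\<pi> \<Otimes>\<^sub>M M)" by measurable
  have "(\<integral>\<^sup>+p. ennreal ((norm (case p of (x, w) \<Rightarrow> F x w))\<^sup>2) \<partial>(\<pi> \<Otimes>\<^sub>M M))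
      = (\<integral>\<^sup>+x. \<integral>\<^sup>+w. ennreal ((norm (F x w))\<^sup>2) \<partial>M \<partial>\<pi>)"
    by (subst nn_integral_fst[symmetric]) auto
  also have "\<dots> \<le> (\<integral>\<^sup>+x. ennreal (2 * r * (norm x)\<^sup>2 + 2 * F0_moment) \<partial>\<pi>)"
    by (intro nn_integral_mono moment_F_le)
  also have "\<dots> = (\<integral>\<^sup>+x. ennreal (2 * r) * ennreal ((norm x)\<^sup>2) + ennreal (2 * F0_moment) \<partial>\<pi>)"
    using r F0_moment(2) by (simp add: ennreal_mult')
  also have "\<dots> = ennreal (2 * r) * (\<integral>\<^sup>+x. ennreal ((norm x)\<^sup>2) \<partial>\<pi>) + ennreal (2 * F0_moment)"
    by (simp add: nn_integral_add nn_integral_cmult \<pi>.emeasure_space_1)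
  also have "\<dots> < \<infinity>" using P2D(5)[OF assms] by (simp add: ennreal_mult_less_top)
  finally show "(\<integral>\<^sup>+p. ennreal ((norm (case p of (x, w) \<Rightarrow> F x w))\<^sup>2) \<partial>(\<pi> \<Otimes>\<^sub>M M)) < \<infinity>" .
qed

text \<open>Synchronous coupling: a nearly optimal coupling of the inputs is sent through
  \<open>F\<close> with the same noise on both sides, and \<open>contraction\<close> is integrated
  over it.\<close>

lemma push_W2:
  assumes "\<pi> \<in> P2" "\<pi>' \<in> P2"
  shows "(W2 (push \<pi>) (push \<pi>'))\<^sup>2 \<le> r * (W2 \<pi> \<pi>')\<^sup>2"
proof -
  have le: "(W2 (push \<pi>) (push \<pi>'))\<^sup>2 \<le> r * ((W2 \<pi> \<pi>')\<^sup>2 + e)" if e: "e > 0" for e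
  proof -
    obtain \<kappa> where \<kappa>: "\<kappa> \<in> couplings \<pi> \<pi>'"
      "(\<integral>\<^sup>+ p. ennreal ((norm (fst p - snd p))\<^sup>2) \<partial>\<kappa>) \<le> ennreal ((W2 \<pi> \<pi>')\<^sup>2 + e)"
      using W2_approx[OF assms e] by blast
    note c = couplingsD[OF \<kappa>(1)]
    note [measurable] = c(5,6)
    interpret \<kappa>: prob_space \<kappa> by fact
    interpret P: pair_prob_space \<kappa> M ..
    have "push \<pi> = distr (\<kappa> \<Otimes>\<^sub>M M) borel (\<lambda>(p, w). F (fst p) w)"
      using push_distr[OF c(1), of fst] c by simp
    moreover have "push \<pi>' = distr (\<kappa> \<Otimes>\<^sub>M M) borel (\<lambda>(p, w). F (snd p) w)"
      using push_distr[OF c(1), of snd] c by simp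
    moreover have "(W2 (distr (\<kappa> \<Otimes>\<^sub>M M) borel (\<lambda>(p, w). F (fst p) w))
        (distr (\<kappa> \<Otimes>\<^sub>M M) borel (\<lambda>(p, w). F (snd p) w)))\<^sup>2 \<le> r * ((W2 \<pi> \<pi>')\<^sup>2 + e)"
    proof (rule W2_sq_le_distr)
      have "(\<integral>\<^sup>+ q. ennreal ((norm ((case q of (p, w) \<Rightarrow> F (fst p) w) - (case q of (p, w) \<Rightarrow> F (snd p) w)))\<^sup>2) \<partial>(\<kappa> \<Otimes>\<^sub>M M))
        = (\<integral>\<^sup>+p. \<integral>\<^sup>+w. ennreal ((norm (F (fst p) w - F (snd p) w))\<^sup>2) \<partial>M \<partial>\<kappa>)"
        by (subst nn_integral_fst[symmetric]) auto
      also have "\<dots> \<le> (\<integral>\<^sup>+p. ennreal (r * (norm (fst p - snd p))\<^sup>2) \<partial>\<kappa>)"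
        by (intro nn_integral_mono contraction)
      also have "\<dots> = ennreal r * (\<integral>\<^sup>+p. ennreal ((norm (fst p - snd p))\<^sup>2) \<partial>\<kappa>)"
        using r by (simp add: ennreal_mult' nn_integral_cmult)
      also have "\<dots> \<le> ennreal r * ennreal ((W2 \<pi> \<pi>')\<^sup>2 + e)"
        by (intro mult_left_mono \<kappa>) auto
      finally show "(\<integral>\<^sup>+ q. ennreal ((norm ((case q of (p, w) \<Rightarrow> F (fst p) w) - (case q of (p, w) \<Rightarrow> F (snd p) w)))\<^sup>2) \<partial>(\<kappa> \<Otimes>\<^sub>M M))
         \<le> ennreal (r * ((W2 \<pi> \<pi>')\<^sup>2 + e))"
        using r e by (simp add: ennreal_mult)
      show "prob_space (\<kappa> \<Otimes>\<^sub>M M)" by (rule P.prob_space_axioms)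
      show "0 \<le> r * ((W2 \<pi> \<pi>')\<^sup>2 + e)" using r e by (simp add: add_nonneg_pos less_imp_le)
    qed measurable
    ultimately show ?thesis by simp
  qed
  show ?thesis
  proof (rule field_le_epsilon)
    fix e :: real assume "0 < e"
    then show "(W2 (push \<pi>) (push \<pi>'))\<^sup>2 \<le> r * (W2 \<pi> \<pi>')\<^sup>2 + e"
      using le[of "e / r"] r by (simp add: algebra_simps)
  qed
qed

lemma push_fixpoint_unique:
  assumes "\<pi> \<in> P2" "\<pi>' \<in> P2" "push \<pi> = \<pi>" "push \<pi>' = \<pi>'"
  shows "\<pi> = \<pi>'"
proof -
  have "(W2 \<pi> \<pi>')\<^sup>2 \<le> r * (W2 \<pi> \<pi>')\<^sup>2"
    using push_W2[OF assms(1,2)] assms(3,4) by simp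
  then have "(1 - r) * (W2 \<pi> \<pi>')\<^sup>2 \<le> 0" by (simp add: algebra_simps)
  then have "(W2 \<pi> \<pi>')\<^sup>2 \<le> 0" using r by (simp add: mult_le_0_iff)
  then have "W2 \<pi> \<pi>' = 0" by simp
  then show ?thesis using W2_zero_imp_eq assms by blast
qed

section \<open>Backward iteration of independent copies and the fixed point\<close>

abbreviation S :: "(nat \<Rightarrow> 'w) measure" where "S \<equiv> PiM UNIV (\<lambda>_. M)"

text \<open>Iterating the maps from the inside outwards makes the sequence converge pathwise, not only in law.\<close>

primrec backward :: "nat \<Rightarrow> (nat \<Rightarrow> 'w) \<Rightarrow> 'a" where
  "backward 0 w = 0"
| "backward (Suc n) w = F (backward n (\<lambda>i. w (Suc i))) (w 0)"

lemma backward_measurable [measurable]: "backward n \<in> borel_measurable S"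
proof (induction n)
  case 0 show ?case by simp
next
  case (Suc n)
  have [measurable]: "(\<lambda>w i. w (Suc i)) \<in> measurable S S"
    by (rule measurable_abs_UNIV) simp
  note Suc [measurable]
  show ?case unfolding backward.simps by measurable
qed

sublocale S: sequence_space M ..

sublocale MS: pair_prob_space M S ..

text \<open>Splitting off the first coordinate leaves a sequence of the same law. The first
  coordinate is integrated innermost, so that \<open>contraction\<close> applies with the rest of
  the sequence frozen.\<close>

lemma nn_integral_S:
  assumes [measurable]: "f \<in> borel_measurable S"
  shows "(\<integral>\<^sup>+w. f w \<partial>S) = (\<integral>\<^sup>+w. \<integral>\<^sup>+s. f (case_nat s w) \<partial>M \<partial>S)"
proof -
  have "(\<integral>\<^sup>+w. f w \<partial>S) = (\<integral>\<^sup>+w. f w \<partial>distr (M \<Otimes>\<^sub>M S) S (\<lambda>(s, w). case_nat s w))"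
    by (simp add: S.PiM_iter)
  also have "\<dots> = (\<integral>\<^sup>+p. f (case_nat (fst p) (snd p)) \<partial>(M \<Otimes>\<^sub>M S))"
    by (subst nn_integral_distr) (auto simp: case_prod_beta)
  also have "\<dots> = (\<integral>\<^sup>+w. \<integral>\<^sup>+s. f (case_nat s w) \<partial>M \<partial>S)"
    by (subst MS.nn_integral_snd[symmetric]) auto
  finally show ?thesis .
qed

lemma backward_case [simp]: "backward (Suc n) (case_nat s w) = F (backward n w) s"
  by simp

text \<open>Both iterates share their \<open>n\<close> outermost maps; these act on the iterate of
  the remaining \<open>m\<close> maps and on 0, respectively. Each shared map contributes one factor
  \<open>r\<close>.\<close>

lemma backward_diff:
  "(\<integral>\<^sup>+w. ennreal ((norm (backward (n + m) w - backward n w))\<^sup>2) \<partial>S)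
     \<le> ennreal (r ^ n) * (\<integral>\<^sup>+w. ennreal ((norm (backward m w))\<^sup>2) \<partial>S)"
proof (induction n)
  case 0 show ?case by simp
next
  case (Suc n)
  have "(\<integral>\<^sup>+w. ennreal ((norm (backward (Suc n + m) w - backward (Suc n) w))\<^sup>2) \<partial>S)
      = (\<integral>\<^sup>+w. \<integral>\<^sup>+s. ennreal ((norm (F (backward (n + m) w) s - F (backward n w) s))\<^sup>2) \<partial>M \<partial>S)"
    by (subst nn_integral_S) (auto simp del: backward.simps)
  also have "\<dots> \<le> (\<integral>\<^sup>+w. ennreal (r * (norm (backward (n + m) w - backward n w))\<^sup>2) \<partial>S)"
    by (intro nn_integral_mono contraction)
  also have "\<dots> = ennreal r * (\<integral>\<^sup>+w. ennreal ((norm (backward (n + m) w - backward n w))\<^sup>2) \<partial>S)"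
    using r by (simp add: ennreal_mult' nn_integral_cmult)
  also have "\<dots> \<le> ennreal r * (ennreal (r ^ n) * (\<integral>\<^sup>+w. ennreal ((norm (backward m w))\<^sup>2) \<partial>S))"
    by (intro mult_left_mono Suc) auto
  finally show ?case using r by (simp add: ennreal_mult mult.assoc)
qed

text \<open>Splitting \<open>F x\<close> into \<open>F x - F 0\<close> and \<open>F 0\<close> gives
  an affine recursion for the second moments; the weighted inequality keeps its slope below
  1.\<close>

lemma backward_moment_bounded:
  obtains K where "0 \<le> K" "\<And>m. (\<integral>\<^sup>+w. ennreal ((norm (backward m w))\<^sup>2) \<partial>S) \<le> ennreal K"
proof -
  \<comment> \<open>The weight that makes \<open>(1 + e) * r\<close> the midpoint of
    \<open>r\<close> and 1.\<close>
  define e where "e = (1 - r) / (2 * r)"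
  have e: "e > 0" "(1 + e) * r = (1 + r) / 2" using r by (simp_all add: e_def field_simps)
  \<comment> \<open>The fixed point of the affine recursion, hence a bound that the induction
    reproduces.\<close>
  define K where "K = 2 * (1 + 1/e) * F0_moment / (1 - r)"
  have K: "0 \<le> K" "(1 + r) / 2 * K + (1 + 1/e) * F0_moment = K"
    using r e F0_moment(2) by (simp_all add: K_def field_simps)
  have "(\<integral>\<^sup>+w. ennreal ((norm (backward m w))\<^sup>2) \<partial>S) \<le> ennreal K" for m
  proof (induction m)
    case 0 show ?case by simp
  next
    case (Suc m)
    have 1: "(\<integral>\<^sup>+s. ennreal ((norm (F x s))\<^sup>2) \<partial>M) \<le> ennreal ((1 + r) / 2) * ennreal ((norm x)\<^sup>2) + ennreal ((1 + 1/e) * F0_moment)" for x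
    proof -
      have "(\<integral>\<^sup>+s. ennreal ((norm (F x s))\<^sup>2) \<partial>M)
        \<le> (\<integral>\<^sup>+s. ennreal (1 + e) * ennreal ((norm (F x s - F 0 s))\<^sup>2) + ennreal (1 + 1/e) * ennreal ((norm (F 0 s))\<^sup>2) \<partial>M)"
      proof (rule nn_integral_mono)
        fix s
        have "ennreal ((norm (F x s))\<^sup>2) \<le> ennreal ((1+e) * (norm (F x s - F 0 s))\<^sup>2 + (1+1/e) * (norm (F 0 s))\<^sup>2)"
          using norm_add_sq_le_weighted[OF e(1), of "F x s - F 0 s" "F 0 s"] by (intro ennreal_leI) simp
        then show "ennreal ((norm (F x s))\<^sup>2) \<le> ennreal (1 + e) * ennreal ((norm (F x s - F 0 s))\<^sup>2) + ennreal (1 + 1/e) * ennreal ((norm (F 0 s))\<^sup>2)"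
          using e by (subst (asm) ennreal_plus) (auto simp: ennreal_mult simp del: ennreal_plus)
      qed
      also have "\<dots> = ennreal (1 + e) * (\<integral>\<^sup>+s. ennreal ((norm (F x s - F 0 s))\<^sup>2) \<partial>M) + ennreal (1 + 1/e) * ennreal F0_moment"
        by (simp add: nn_integral_add nn_integral_cmult F0_moment(1) del: ennreal_plus)
      also have "\<dots> \<le> ennreal (1 + e) * ennreal (r * (norm (x - 0))\<^sup>2) + ennreal (1 + 1/e) * ennreal F0_moment"
        by (intro add_right_mono mult_left_mono contraction) auto
      also have "\<dots> = ennreal ((1 + e) * r) * ennreal ((norm x)\<^sup>2) + ennreal ((1 + 1/e) * F0_moment)"
        using r e F0_moment(2) by (simp add: ennreal_mult mult.assoc del: ennreal_plus)
      finally show ?thesis by (simp only: e(2))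
    qed
    have "(\<integral>\<^sup>+w. ennreal ((norm (backward (Suc m) w))\<^sup>2) \<partial>S)
      = (\<integral>\<^sup>+w. \<integral>\<^sup>+s. ennreal ((norm (F (backward m w) s))\<^sup>2) \<partial>M \<partial>S)"
      by (subst nn_integral_S) (auto simp del: backward.simps)
    also have "\<dots> \<le> (\<integral>\<^sup>+w. ennreal ((1 + r) / 2) * ennreal ((norm (backward m w))\<^sup>2) + ennreal ((1 + 1/e) * F0_moment) \<partial>S)"
      by (intro nn_integral_mono 1)
    also have "\<dots> = ennreal ((1 + r) / 2) * (\<integral>\<^sup>+w. ennreal ((norm (backward m w))\<^sup>2) \<partial>S) + ennreal ((1 + 1/e) * F0_moment)"
      by (simp add: nn_integral_add nn_integral_cmult S.emeasure_space_1 del: ennreal_plus)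
    also have "\<dots> \<le> ennreal ((1 + r) / 2) * ennreal K + ennreal ((1 + 1/e) * F0_moment)"
      by (intro add_right_mono mult_left_mono Suc) auto
    also have "\<dots> = ennreal ((1 + r) / 2 * K + (1 + 1/e) * F0_moment)"
      using r e K(1) F0_moment(2) by (simp add: ennreal_mult[symmetric] ennreal_plus[symmetric] del: ennreal_plus)
    finally show ?case by (simp only: K(2))
  qed
  then show ?thesis using that K(1) by blast
qed

text \<open>Consecutive iterates have mean square distance of order \<open>r ^ n\<close>, hence mean
  distance of order \<open>sqrt r ^ n\<close>, which is summable. So the sum of the distances has
  finite mean and is finite almost surely.\<close>

lemma backward_convergent: "AE w in S. convergent (\<lambda>n. backward n w)"
proof -
  obtain K where K: "0 \<le> K" "\<And>m. (\<integral>\<^sup>+w. ennreal ((norm (backward m w))\<^sup>2) \<partial>S) \<le> ennreal K"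
    using backward_moment_bounded by blast
  \<comment> \<open>The weight \<open>s ^ n\<close> in \<open>le_square_plus\<close> balances both
    terms, since \<open>r ^ n / s ^ n = s ^ n\<close>.\<close>
  define s where "s = sqrt r"
  have s: "0 < s" "s < 1" "s * s = r" using r by (auto simp: s_def)
  let ?Y = "\<lambda>n w. norm (backward (Suc n) w - backward n w)"
  have bd: "(\<integral>\<^sup>+w. ennreal (?Y n w) \<partial>S) \<le> ennreal ((K/2 + 1/2) * s ^ n)" for n
  proof -
    have sn: "s ^ n > 0" "s^n * s^n = r^n" using s by (simp_all flip: power_mult_distrib)
    have "(\<integral>\<^sup>+w. ennreal (?Y n w) \<partial>S) \<le> (\<integral>\<^sup>+w. ennreal (1 / (2 * s^n)) * ennreal ((?Y n w)\<^sup>2) + ennreal (s^n / 2) \<partial>S)"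
    proof (rule nn_integral_mono)
      fix w
      have "ennreal (?Y n w) \<le> ennreal (1 / (2 * s^n) * (?Y n w)\<^sup>2 + s^n / 2)"
        using le_square_plus[OF sn(1), of "?Y n w"] by (intro ennreal_leI) simp
      then show "ennreal (?Y n w) \<le> ennreal (1 / (2 * s^n)) * ennreal ((?Y n w)\<^sup>2) + ennreal (s^n / 2)"
        using s by (simp add: ennreal_mult[symmetric] ennreal_plus[symmetric] del: ennreal_plus backward.simps)
    qed
    also have "\<dots> = ennreal (1 / (2 * s^n)) * (\<integral>\<^sup>+w. ennreal ((?Y n w)\<^sup>2) \<partial>S) + ennreal (s^n / 2)"
      by (simp add: nn_integral_add nn_integral_cmult S.emeasure_space_1 del: backward.simps)
    also have "\<dots> \<le> ennreal (1 / (2 * s^n)) * (ennreal (r^n) * ennreal K) + ennreal (s^n / 2)"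
      using backward_diff[of n 1] K(2)[of 1]
      by (intro add_right_mono mult_left_mono) (auto intro: order_trans[OF _ mult_left_mono] simp del: backward.simps)
    also have "\<dots> = ennreal (1 / (2 * s^n) * (r^n * K) + s^n / 2)"
      using r s(1,2) K(1) by (simp add: ennreal_mult[symmetric] ennreal_plus[symmetric] del: ennreal_plus)
    also have "1 / (2 * s^n) * (r^n * K) + s^n / 2 = (K/2 + 1/2) * s ^ n"
      using sn by (simp add: field_simps flip: sn(2))
    finally show ?thesis .
  qed
  have "(\<integral>\<^sup>+w. (\<Sum>n. ennreal (?Y n w)) \<partial>S) = (\<Sum>n. \<integral>\<^sup>+w. ennreal (?Y n w) \<partial>S)"
    by (rule nn_integral_suminf) (simp del: backward.simps)
  also have "\<dots> \<le> (\<Sum>n. ennreal ((K/2 + 1/2) * s ^ n))"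
    by (intro suminf_le bd) auto
  also have "\<dots> < \<infinity>"
    using s K(1) by (subst suminf_ennreal2) (auto intro!: summable_mult summable_geometric)
  finally have "AE w in S. (\<Sum>n. ennreal (?Y n w)) \<noteq> \<infinity>"
    by (intro nn_integral_PInf_AE) (auto simp del: backward.simps)
  then show ?thesis
  proof eventually_elim
    case (elim w)
    then have "summable (\<lambda>n. ?Y n w)"
      by (intro summable_suminf_not_top) auto
    then have "summable (\<lambda>n. backward (Suc n) w - backward n w)"
      by (rule summable_norm_cancel)
    then have "convergent (\<lambda>n. \<Sum>k<n. backward (Suc k) w - backward k w)"
      by (simp add: summable_iff_convergent)
    then show ?case by (subst (asm) sum_lessThan_telescope) simp
  qed
qed

text \<open>The limit satisfies \<open>F (Z w) s = Z (case_nat s w)\<close> almost surely. The left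
  side has as law the \<open>push\<close> of the law of \<open>Z\<close>; the right side has the law
  of \<open>Z\<close>, because an i.i.d. sequence with a fresh coordinate put in front is again such
  a sequence.\<close>

theorem push_fixpoint_exists: "\<exists>\<pi>\<in>P2. push \<pi> = \<pi>"
proof -
  obtain K where K: "0 \<le> K" "\<And>m. (\<integral>\<^sup>+w. ennreal ((norm (backward m w))\<^sup>2) \<partial>S) \<le> ennreal K"
    using backward_moment_bounded by blast
  \<comment> \<open>On the null set where the iterates diverge, \<open>lim\<close> takes some
    default value.\<close>
  define Z where "Z w = lim (\<lambda>n. backward n w)" for w
  have [measurable]: "Z \<in> borel_measurable S"
    unfolding Z_def by measurable
  have lim: "AE w in S. (\<lambda>n. backward n w) \<longlonglongrightarrow> Z w"
    using backward_convergent by eventually_elim (simp add: Z_def convergent_LIMSEQ_iff)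
  \<comment> \<open>Fatou's lemma carries the bound of \<open>backward_diff\<close> over to the
    limit in \<open>m\<close>.\<close>
  have Zn: "(\<integral>\<^sup>+w. ennreal ((norm (Z w - backward n w))\<^sup>2) \<partial>S) \<le> ennreal (r ^ n * K)" for n
  proof -
    let ?u = "\<lambda>m w. ennreal ((norm (backward (n + m) w - backward n w))\<^sup>2)"
    have "AE w in S. ennreal ((norm (Z w - backward n w))\<^sup>2) = liminf (\<lambda>m. ?u m w)"
      using lim
    proof eventually_elim
      case (elim w)
      then have "(\<lambda>m. backward (n + m) w) \<longlonglongrightarrow> Z w"
        using LIMSEQ_ignore_initial_segment[of "\<lambda>n. backward n w" "Z w" n] by (simp add: add.commute)
      then have "(\<lambda>m. ?u m w) \<longlonglongrightarrow> ennreal ((norm (Z w - backward n w))\<^sup>2)"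
        by (intro tendsto_intros)
      from lim_imp_Liminf[OF trivial_limit_sequentially this] show ?case by simp
    qed
    then have "(\<integral>\<^sup>+w. ennreal ((norm (Z w - backward n w))\<^sup>2) \<partial>S) = (\<integral>\<^sup>+w. liminf (\<lambda>m. ?u m w) \<partial>S)"
      by (rule nn_integral_cong_AE)
    also have "\<dots> \<le> liminf (\<lambda>m. \<integral>\<^sup>+w. ?u m w \<partial>S)"
      by (rule nn_integral_liminf) simp
    also have "\<dots> \<le> ennreal (r ^ n * K)"
    proof -
      have "(\<integral>\<^sup>+w. ?u m w \<partial>S) \<le> ennreal (r ^ n * K)" for m
        using order_trans[OF backward_diff[of n m] mult_left_mono[OF K(2)[of m]]] r K(1)
        by (simp add: ennreal_mult)
      then show ?thesis by (intro Liminf_le) auto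
    qed
    finally show ?thesis .
  qed
  let ?\<pi> = "distr S borel Z"
  interpret SM: pair_prob_space S M ..
  have \<pi>: "?\<pi> \<in> P2"
    by (rule distr_in_P2I)
       (use Zn[of 0] in \<open>auto intro: S.prob_space_axioms le_less_trans\<close>)
  have 1: "push ?\<pi> = distr (S \<Otimes>\<^sub>M M) borel (\<lambda>(w, s). F (Z w) s)"
    by (rule push_distr) (auto intro: S.prob_space_axioms)
  have "?\<pi> = distr (distr (M \<Otimes>\<^sub>M S) S (\<lambda>(s, w). case_nat s w)) borel Z"
    by (simp add: S.PiM_iter)
  also have "M \<Otimes>\<^sub>M S = distr (S \<Otimes>\<^sub>M M) (M \<Otimes>\<^sub>M S) (\<lambda>(x, y). (y, x))"
    by (rule MS.distr_pair_swap)
  finally have 2: "?\<pi> = distr (S \<Otimes>\<^sub>M M) borel (\<lambda>(w, s). Z (case_nat s w))"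
    by (simp add: distr_distr o_def case_prod_unfold)
  let ?d = "\<lambda>p. ennreal ((norm (F (Z (fst p)) (snd p) - Z (case_nat (snd p) (fst p))))\<^sup>2)"
  \<comment> \<open>Both sides are compared with \<open>F (backward n w) s\<close>, which is
    \<open>backward (Suc n) (case_nat s w)\<close>; the two mean square distances are of order
    \<open>r ^ n\<close>.\<close>
  have le: "(\<integral>\<^sup>+p. ?d p \<partial>(S \<Otimes>\<^sub>M M)) \<le> ennreal (r ^ n * (4 * K))" for n
  proof -
    let ?A = "\<lambda>p. ennreal ((norm (F (Z (fst p)) (snd p) - F (backward n (fst p)) (snd p)))\<^sup>2)"
    let ?B = "\<lambda>p. ennreal ((norm (Z (case_nat (snd p) (fst p)) - backward (Suc n) (case_nat (snd p) (fst p))))\<^sup>2)"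
    have "(\<integral>\<^sup>+p. ?d p \<partial>(S \<Otimes>\<^sub>M M)) \<le> (\<integral>\<^sup>+p. 2 * ?A p + 2 * ?B p \<partial>(S \<Otimes>\<^sub>M M))"
    proof (intro nn_integral_mono)
      fix p :: "(nat \<Rightarrow> 'w) \<times> 'w"
      obtain w s where p: "p = (w, s)" by (cases p)
      have "?d p \<le> ennreal (2 * (norm (F (Z w) s - F (backward n w) s))\<^sup>2
         + 2 * (norm (Z (case_nat s w) - backward (Suc n) (case_nat s w)))\<^sup>2)"
        using norm_diff_sq_le[of "F (Z w) s - F (backward n w) s" "Z (case_nat s w) - backward (Suc n) (case_nat s w)"]
        unfolding p by (intro ennreal_leI) simp
      then show "?d p \<le> 2 * ?A p + 2 * ?B p"
        unfolding p by (simp add: ennreal_mult')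
    qed
    also have "\<dots> = 2 * (\<integral>\<^sup>+p. ?A p \<partial>(S \<Otimes>\<^sub>M M)) + 2 * (\<integral>\<^sup>+p. ?B p \<partial>(S \<Otimes>\<^sub>M M))"
      by (simp add: nn_integral_add nn_integral_cmult)
    also have "(\<integral>\<^sup>+p. ?A p \<partial>(S \<Otimes>\<^sub>M M)) = (\<integral>\<^sup>+w. \<integral>\<^sup>+s. ?A (w, s) \<partial>M \<partial>S)"
      by (subst nn_integral_fst[symmetric]) auto
    also have "(\<integral>\<^sup>+p. ?B p \<partial>(S \<Otimes>\<^sub>M M)) = (\<integral>\<^sup>+w. \<integral>\<^sup>+s. ?B (w, s) \<partial>M \<partial>S)"
      by (subst nn_integral_fst[symmetric]) auto
    also have "\<dots> = (\<integral>\<^sup>+w. ennreal ((norm (Z w - backward (Suc n) w))\<^sup>2) \<partial>S)"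
      by (subst nn_integral_S[of "\<lambda>w. ennreal ((norm (Z w - backward (Suc n) w))\<^sup>2)"]) (auto simp del: backward.simps)
    also have "2 * (\<integral>\<^sup>+w. \<integral>\<^sup>+s. ?A (w, s) \<partial>M \<partial>S) + 2 * \<dots>
       = 2 * (\<integral>\<^sup>+w. \<integral>\<^sup>+s. ennreal ((norm (F (Z w) s - F (backward n w) s))\<^sup>2) \<partial>M \<partial>S)
         + 2 * (\<integral>\<^sup>+w. ennreal ((norm (Z w - backward (Suc n) w))\<^sup>2) \<partial>S)" by simp
    also have "\<dots> \<le> 2 * (\<integral>\<^sup>+w. ennreal (r * (norm (Z w - backward n w))\<^sup>2) \<partial>S) + 2 * ennreal (r ^ Suc n * K)"
      by (intro add_mono mult_left_mono nn_integral_mono contraction Zn) auto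
    also have "\<dots> = 2 * (ennreal r * (\<integral>\<^sup>+w. ennreal ((norm (Z w - backward n w))\<^sup>2) \<partial>S)) + 2 * ennreal (r ^ Suc n * K)"
      using r by (simp add: ennreal_mult' nn_integral_cmult)
    also have "\<dots> \<le> 2 * (ennreal r * ennreal (r ^ n * K)) + 2 * ennreal (r ^ Suc n * K)"
      by (intro add_right_mono mult_left_mono Zn) auto
    also have "\<dots> = ennreal (2 * (r * (r ^ n * K)) + 2 * (r ^ Suc n * K))"
      using r K(1) by (subst ennreal_plus) (auto simp: ennreal_mult simp del: ennreal_plus)
    also have "\<dots> \<le> ennreal (r ^ n * (4 * K))"
    proof (rule ennreal_leI)
      have "r * (r^n * K) \<le> 1 * (r^n * K)"
        using r K(1) by (intro mult_right_mono) auto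
      then show "2 * (r * (r ^ n * K)) + 2 * (r ^ Suc n * K) \<le> r ^ n * (4 * K)" by (simp add: algebra_simps)
    qed
    finally show ?thesis .
  qed
  have "(\<lambda>n. ennreal (r ^ n * (4 * K))) \<longlonglongrightarrow> ennreal (0 * (4 * K))"
    using r by (intro tendsto_intros LIMSEQ_power_zero) auto
  then have "(\<integral>\<^sup>+p. ?d p \<partial>(S \<Otimes>\<^sub>M M)) \<le> 0"
    using le by (intro LIMSEQ_le_const) auto
  then have "(\<integral>\<^sup>+p. ?d p \<partial>(S \<Otimes>\<^sub>M M)) = 0" by simp
  then have "AE p in S \<Otimes>\<^sub>M M. ?d p = 0"
    by (subst (asm) nn_integral_0_iff_AE) auto
  then have "AE p in S \<Otimes>\<^sub>M M. (case p of (w, s) \<Rightarrow> F (Z w) s) = (case p of (w, s) \<Rightarrow> Z (case_nat s w))"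
    by eventually_elim (auto simp: case_prod_beta ennreal_eq_0_iff)
  then have "distr (S \<Otimes>\<^sub>M M) borel (\<lambda>(w, s). F (Z w) s) = distr (S \<Otimes>\<^sub>M M) borel (\<lambda>(w, s). Z (case_nat s w))"
    by (intro distr_cong_AE) auto
  then have "push ?\<pi> = ?\<pi>"
    unfolding 1 using 2 by simp
  then show ?thesis using \<pi> by blast
qed

end

section \<open>Finite kernels and Poisson random measures of finite intensity\<close>

text \<open>The dependence of the integrand on \<open>x\<close> is moved into the measure: one fixed
  function is integrated against the image of \<open>L x\<close> under \<open>y\<close> to
  \<open>(x, y)\<close>.\<close>

lemma integral_measurable_subprob_algebra2:
  fixes f :: "'x \<Rightarrow> 'z \<Rightarrow> 'b::{banach, second_countable_topology}"
  assumes f [measurable]: "(\<lambda>(x, y). f x y) \<in> borel_measurable (M \<Otimes>\<^sub>M N)"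
    and L [measurable]: "L \<in> measurable M (subprob_algebra N)"
  shows "(\<lambda>x. integral\<^sup>L (L x) (f x)) \<in> borel_measurable M"
proof -
  note measurable_distr2 [measurable]
  have "(\<lambda>x. integral\<^sup>L (distr (L x) (M \<Otimes>\<^sub>M N) (\<lambda>y. (x, y))) (\<lambda>(x, y). f x y)) \<in> borel_measurable M"
    by measurable
  moreover have "integral\<^sup>L (distr (L x) (M \<Otimes>\<^sub>M N) (\<lambda>y. (x, y))) (\<lambda>(x, y). f x y) = integral\<^sup>L (L x) (f x)"
    if "x \<in> space M" for x
    using that measurable_space[OF L that] by (subst integral_distr) (auto simp: space_subprob_algebra cong: measurable_cong_sets)
  ultimately show ?thesis by (simp cong: measurable_cong)
qed

text \<open>This serves the jump term of the scheme: its integrand depends on the particle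
  configuration, its measure on the noise, and measurability is required jointly in both.\<close>

lemma finite_kernel_integral_measurable:
  fixes f :: "'x \<Rightarrow> 'z \<Rightarrow> 'b::{banach, second_countable_topology}"
  assumes sets_n: "\<And>w. w \<in> space A \<Longrightarrow> sets (n w) = sets Z"
    and fin: "\<And>w. w \<in> space A \<Longrightarrow> emeasure (n w) (space Z) < \<infinity>"
    and meas: "\<And>C. C \<in> sets Z \<Longrightarrow> (\<lambda>w. emeasure (n w) C) \<in> borel_measurable A"
    and f: "(\<lambda>(x, z). f x z) \<in> borel_measurable (X \<Otimes>\<^sub>M Z)"
  shows "(\<lambda>(x, w). \<integral>z. f x z \<partial>n w) \<in> borel_measurable (X \<Otimes>\<^sub>M A)"
proof (cases "space Z = {}")
  case True
  have "(\<integral>z. f x z \<partial>n w) = 0" if "w \<in> space A" for x w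
  proof -
    have "(\<integral>z. f x z \<partial>n w) = (\<integral>z. 0 \<partial>n w)"
      using sets_eq_imp_space_eq[OF sets_n[OF that]] True by (intro Bochner_Integration.integral_cong) auto
    then show ?thesis by simp
  qed
  then show ?thesis
    by (subst measurable_cong[where g="\<lambda>_. 0"]) (auto simp: space_pair_measure)
next
  case False
  txt \<open>Dividing by \<open>1 + n(Z)\<close> gives a subprobability kernel, for which the library has the result;
    subprobability spaces are nonempty, hence the case distinction.\<close>
  define c where "c w = enn2real (emeasure (n w) (space Z))" for w
  have c: "ennreal (c w) = emeasure (n w) (space Z)" "0 \<le> c w" if "w \<in> space A" for w
    using fin[OF that] by (auto simp: c_def)
  define L where "L w = density (n w) (\<lambda>_. ennreal (1 / (1 + c w)))" for w
  have [measurable]: "c \<in> borel_measurable A"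
    unfolding c_def using meas[of "space Z"] by simp
  have emL: "emeasure (L w) C = ennreal (1 / (1 + c w)) * emeasure (n w) C" if "w \<in> space A" "C \<in> sets Z" for w C
    unfolding L_def using that sets_n by (subst emeasure_density_const) auto
  have sL: "sets (L w) = sets Z" if "w \<in> space A" for w using sets_n[OF that] by (simp add: L_def)
  have L: "L \<in> measurable A (subprob_algebra Z)"
  proof (rule measurable_subprob_algebra)
    fix w assume w: "w \<in> space A"
    show "sets (L w) = sets Z" by (rule sL[OF w])
    show "subprob_space (L w)"
    proof (rule subprob_spaceI)
      show "space (L w) \<noteq> {}" using sets_eq_imp_space_eq[OF sL[OF w]] False by simp
      have "emeasure (L w) (space (L w)) = ennreal (1 / (1 + c w)) * ennreal (c w)"
        using sets_eq_imp_space_eq[OF sL[OF w]] w c(1)[OF w] by (simp add: emL)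
      also have "\<dots> = ennreal (c w / (1 + c w))"
        using c(2)[OF w] by (simp add: ennreal_mult[symmetric])
      also have "\<dots> \<le> 1" using c(2)[OF w] by (simp add: field_simps)
      finally show "emeasure (L w) (space (L w)) \<le> 1" .
    qed
  next
    fix C assume C: "C \<in> sets Z"
    note meas[OF C, measurable]
    have "(\<lambda>w. ennreal (1 / (1 + c w)) * emeasure (n w) C) \<in> borel_measurable A" by measurable
    then show "(\<lambda>w. emeasure (L w) C) \<in> borel_measurable A"
      by (subst measurable_cong[where g="\<lambda>w. ennreal (1 / (1 + c w)) * emeasure (n w) C"]) (auto simp: emL C)
  qed
  have "(\<lambda>p. integral\<^sup>L (L (snd p)) (f (fst p))) \<in> borel_measurable (X \<Otimes>\<^sub>M A)"
  proof (rule integral_measurable_subprob_algebra2[where N=Z])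
    show "(\<lambda>p. L (snd p)) \<in> measurable (X \<Otimes>\<^sub>M A) (subprob_algebra Z)"
      using L by simp
    show "(\<lambda>(p, z). f (fst p) z) \<in> borel_measurable ((X \<Otimes>\<^sub>M A) \<Otimes>\<^sub>M Z)"
      using measurable_compose[OF _ f, of "\<lambda>(p, z). (fst p, z)" "(X \<Otimes>\<^sub>M A) \<Otimes>\<^sub>M Z"] by (simp add: case_prod_unfold)
  qed
  then have m: "(\<lambda>p. (1 + c (snd p)) *\<^sub>R integral\<^sup>L (L (snd p)) (f (fst p))) \<in> borel_measurable (X \<Otimes>\<^sub>M A)"
    by measurable
  show ?thesis
  proof (subst measurable_cong)
    fix p assume "p \<in> space (X \<Otimes>\<^sub>M A)"
    then obtain x w where p: "p = (x, w)" "x \<in> space X" "w \<in> space A" by (auto simp: space_pair_measure)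
    have fx: "f x \<in> borel_measurable (n w)"
      using measurable_compose[OF measurable_Pair1'[OF p(2)] f] sets_n[OF p(3)]
      by (simp add: measurable_cong_sets[OF sets_n[OF p(3)] refl])
    have "integral\<^sup>L (L w) (f x) = (1 / (1 + c w)) *\<^sub>R (\<integral>z. f x z \<partial>n w)"
      unfolding L_def using c(2)[OF p(3)] fx by (subst integral_density) auto
    then show "(case p of (x, w) \<Rightarrow> \<integral>z. f x z \<partial>n w) = (1 + c (snd p)) *\<^sub>R integral\<^sup>L (L (snd p)) (f (fst p))"
      using c(2)[OF p(3)] by (simp add: p)
  qed (rule m)
qed

lemma finite_kernel_integral_measurable_const:
  fixes f :: "'z \<Rightarrow> 'b::{banach, second_countable_topology}"
  assumes "\<And>w. w \<in> space A \<Longrightarrow> sets (n w) = sets Z"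
    and "\<And>w. w \<in> space A \<Longrightarrow> emeasure (n w) (space Z) < \<infinity>"
    and "\<And>C. C \<in> sets Z \<Longrightarrow> (\<lambda>w. emeasure (n w) C) \<in> borel_measurable A"
    and "f \<in> borel_measurable Z"
  shows "(\<lambda>w. \<integral>z. f z \<partial>n w) \<in> borel_measurable A"
proof -
  have "(\<lambda>(x::unit, w). \<integral>z. f z \<partial>n w) \<in> borel_measurable (count_space UNIV \<Otimes>\<^sub>M A)"
    by (rule finite_kernel_integral_measurable[where Z=Z]) (use assms in auto)
  from measurable_compose[OF measurable_Pair1'[of "()"] this]
  show ?thesis by simp
qed

section \<open>Moments of the Poisson distribution\<close>

lemma sums_poisson_mean: "(\<lambda>k. real k * (exp (- l) * l ^ k / fact k)) sums (l::real)"
proof -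
  have "(\<lambda>k. l * exp (- l) * (l ^ k /\<^sub>R fact k)) sums (l * exp (- l) * exp l)"
    by (intro sums_mult exp_converges)
  moreover have "(\<lambda>k. l * exp (- l) * (l ^ k /\<^sub>R fact k)) = (\<lambda>k. real (Suc k) * (exp (- l) * l ^ Suc k / fact (Suc k)))"
  proof
    fix k
    have "(1 + real k) * fact k \<noteq> (0::real)" by (simp add: add_nonneg_eq_0_iff)
    then show "l * exp (- l) * (l ^ k /\<^sub>R fact k) = real (Suc k) * (exp (- l) * l ^ Suc k / fact (Suc k))"
      by (simp add: field_simps)
  qed
  ultimately have "(\<lambda>k. real (Suc k) * (exp (- l) * l ^ Suc k / fact (Suc k))) sums (l * exp (- l) * exp l)" by simp
  then have "(\<lambda>k. real k * (exp (- l) * l ^ k / fact k)) sums (l * exp (- l) * exp l + real 0 * (exp (- l) * l ^ 0 / fact 0))"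
    by (subst (asm) sums_Suc_iff) simp
  then show ?thesis by (simp add: exp_minus field_simps)
qed

text \<open>Cancelling one factor \<open>k\<close> against \<open>fact k\<close> shifts the index by
  one; the remaining factor \<open>k + 1\<close> splits the series into \<open>l\<close> times the
  mean and an exponential series.\<close>

lemma sums_poisson_square: "(\<lambda>k. (real k)\<^sup>2 * (exp (- l) * l ^ k / fact k)) sums (l\<^sup>2 + l::real)"
proof -
  have 1: "(\<lambda>k. l * (real k * (exp (- l) * l ^ k / fact k)) + l * exp (- l) * (l ^ k /\<^sub>R fact k)) sums (l * l + l * exp (- l) * exp l)"
    by (intro sums_add sums_mult exp_converges sums_poisson_mean)
  have "(\<lambda>k. l * (real k * (exp (- l) * l ^ k / fact k)) + l * exp (- l) * (l ^ k /\<^sub>R fact k))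
     = (\<lambda>k. (real (Suc k))\<^sup>2 * (exp (- l) * l ^ Suc k / fact (Suc k)))"
  proof
    fix k
    have nz: "(1 + real k) \<noteq> 0" "fact k \<noteq> (0::real)" by (simp_all add: add_nonneg_eq_0_iff)
    have "(real (Suc k))\<^sup>2 * (exp (- l) * l ^ Suc k / fact (Suc k)) = (1 + real k) * (exp (- l) * l ^ Suc k / fact k)"
    proof -
      have "(real (Suc k))\<^sup>2 * (exp (- l) * l ^ Suc k / fact (Suc k))
        = (1 + real k) * (((1 + real k) * (exp (- l) * l ^ Suc k)) / ((1 + real k) * fact k))"
        by (simp add: power2_eq_square)
      also have "\<dots> = (1 + real k) * ((exp (- l) * l ^ Suc k) / fact k)"
        by (subst mult_divide_mult_cancel_left[OF nz(1)]) (rule refl)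
      finally show ?thesis by simp
    qed
    also have "\<dots> = l * (real k * (exp (- l) * l ^ k / fact k)) + l * exp (- l) * (l ^ k /\<^sub>R fact k)"
      using nz by (simp add: field_simps)
    finally show "l * (real k * (exp (- l) * l ^ k / fact k)) + l * exp (- l) * (l ^ k /\<^sub>R fact k)
       = (real (Suc k))\<^sup>2 * (exp (- l) * l ^ Suc k / fact (Suc k))" by simp
  qed
  with 1 have "(\<lambda>k. (real (Suc k))\<^sup>2 * (exp (- l) * l ^ Suc k / fact (Suc k))) sums (l * l + l * exp (- l) * exp l)" by simp
  then have "(\<lambda>k. (real k)\<^sup>2 * (exp (- l) * l ^ k / fact k)) sums (l * l + l * exp (- l) * exp l + (real 0)\<^sup>2 * (exp (- l) * l ^ 0 / fact 0))"
    by (subst (asm) sums_Suc_iff) simp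
  then show ?thesis by (simp add: exp_minus field_simps power2_eq_square)
qed

lemma (in prob_space) indep_vars_pair:
  assumes "indep_vars N X I" "i \<in> I" "j \<in> I" "i \<noteq> j"
  shows "indep_var (N i) (X i) (N j) (X j)"
proof -
  define E where "E i = sigma_sets (space M) {X i -` A \<inter> space M | A. A \<in> sets (N i)}" for i
  have rv: "random_variable (N i) (X i)" "random_variable (N j) (X j)" and E: "indep_sets E I"
    using assms by (auto simp: indep_vars_def E_def[abs_def])
  have "indep_set (E i) (E j)"
  proof (rule indep_setI)
    show "E i \<subseteq> events" "E j \<subseteq> events" using E assms by (auto simp: indep_sets_def)
    fix a b assume "a \<in> E i" "b \<in> E j"
    then show "prob (a \<inter> b) = prob a * prob b"
      using indep_setsD[OF E, of "{i, j}" "\<lambda>k. if k = i then a else b"] assms by (auto simp: Int_commute)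
  qed
  then show ?thesis using rv by (simp add: indep_var_eq E_def)
qed

text \<open>Stated for an arbitrary space of marks. The instance is the noise of one particle on one
  time window, projected to the marks, with the window length times \<open>\<nu>\<close> as
  intensity.\<close>

locale finite_poisson_measure = prob_space P for P :: "'w measure" +
  fixes n :: "'w \<Rightarrow> 'z measure" and \<Lambda> :: "'z measure"
  assumes finite_intensity: "finite_measure \<Lambda>"
    and sets_n: "\<And>w. w \<in> space P \<Longrightarrow> sets (n w) = sets \<Lambda>"
    and finite_n: "\<And>w. w \<in> space P \<Longrightarrow> emeasure (n w) (space \<Lambda>) < \<infinity>"
    and nat_valued: "\<And>w C. w \<in> space P \<Longrightarrow> C \<in> sets \<Lambda> \<Longrightarrow> emeasure (n w) C \<in> range ennreal_of_enat"
    and n_measurable: "\<And>C. C \<in> sets \<Lambda> \<Longrightarrow> (\<lambda>w. emeasure (n w) C) \<in> borel_measurable P"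
    and poisson: "\<And>C k. C \<in> sets \<Lambda> \<Longrightarrow>
      prob {w \<in> space P. emeasure (n w) C = of_nat k} = exp (- measure \<Lambda> C) * measure \<Lambda> C ^ k / fact k"
    and indep_counts: "\<And>C :: nat \<Rightarrow> 'z set. range C \<subseteq> sets \<Lambda> \<Longrightarrow> disjoint_family C \<Longrightarrow>
      indep_vars (\<lambda>_. borel) (\<lambda>i w. emeasure (n w) (C i)) UNIV"
begin

sublocale \<Lambda>: finite_measure \<Lambda> by (rule finite_intensity)

lemma space_n: "w \<in> space P \<Longrightarrow> space (n w) = space \<Lambda>"
  using sets_eq_imp_space_eq[OF sets_n] .

lemma finite_measure_n: "w \<in> space P \<Longrightarrow> finite_measure (n w)"
  using finite_n[of w] space_n[of w] by (auto intro: finite_measureI)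

lemma count_nat:
  assumes "w \<in> space P" "C \<in> sets \<Lambda>"
  obtains k :: nat where "emeasure (n w) C = of_nat k" "measure (n w) C = real k"
proof -
  interpret finite_measure "n w" by (rule finite_measure_n) fact
  obtain e where e: "emeasure (n w) C = ennreal_of_enat e" using nat_valued[OF assms] by blast
  then obtain k where "e = enat k" using emeasure_finite[of C] by (cases e) auto
  with e that[of k] show thesis by (simp add: measure_def)
qed

lemma count_measurable: "C \<in> sets \<Lambda> \<Longrightarrow> (\<lambda>w. measure (n w) C) \<in> borel_measurable P"
  unfolding measure_def using n_measurable by simp

text \<open>Counts are natural numbers, so the integral splits over the level sets of the count. As
  \<open>h\<close> is arbitrary, powers give the moments and indicators give the law of the
  count.\<close>

lemma nn_integral_count:
  fixes h :: "ennreal \<Rightarrow> ennreal"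
  assumes C: "C \<in> sets \<Lambda>"
  shows "(\<integral>\<^sup>+w. h (emeasure (n w) C) \<partial>P)
    = (\<Sum>k. h (of_nat k) * ennreal (exp (- measure \<Lambda> C) * measure \<Lambda> C ^ k / fact k))"
proof -
  note n_measurable[OF C, measurable]
  let ?E = "\<lambda>k. {w \<in> space P. emeasure (n w) C = of_nat k}"
  have [measurable]: "?E k \<in> sets P" for k by measurable
  have "(\<integral>\<^sup>+w. h (emeasure (n w) C) \<partial>P) = (\<integral>\<^sup>+w. (\<Sum>k. h (of_nat k) * indicator (?E k) w) \<partial>P)"
  proof (rule nn_integral_cong)
    fix w assume w: "w \<in> space P"
    obtain k0 where k0: "emeasure (n w) C = of_nat k0" "measure (n w) C = real k0" using count_nat[OF w C] .
    have "(\<Sum>k. h (of_nat k) * indicator (?E k) w) = (\<Sum>k\<in>{k0}. h (of_nat k) * indicator (?E k) w)"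
      by (rule suminf_finite) (auto simp: k0(1) indicator_def)
    then show "h (emeasure (n w) C) = (\<Sum>k. h (of_nat k) * indicator (?E k) w)"
      using w by (simp add: k0 indicator_def)
  qed
  also have "\<dots> = (\<Sum>k. \<integral>\<^sup>+w. h (of_nat k) * indicator (?E k) w \<partial>P)"
    by (rule nn_integral_suminf) measurable
  also have "\<dots> = (\<Sum>k. h (of_nat k) * ennreal (exp (- measure \<Lambda> C) * measure \<Lambda> C ^ k / fact k))"
    by (intro suminf_cong) (simp add: nn_integral_cmult_indicator emeasure_eq_measure poisson[OF C])
  finally show ?thesis .
qed

lemma count_moments:
  assumes C: "C \<in> sets \<Lambda>"
  shows "integrable P (\<lambda>w. measure (n w) C)" "expectation (\<lambda>w. measure (n w) C) = measure \<Lambda> C"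
    "integrable P (\<lambda>w. (measure (n w) C)\<^sup>2)"
    "expectation (\<lambda>w. (measure (n w) C)\<^sup>2) = (measure \<Lambda> C)\<^sup>2 + measure \<Lambda> C"
    "(\<integral>\<^sup>+w. emeasure (n w) C \<partial>P) = emeasure \<Lambda> C"
proof -
  note count_measurable[OF C, measurable]
  have e: "(\<integral>\<^sup>+w. ennreal (measure (n w) C ^ j) \<partial>P) = ennreal s"
    if "(\<lambda>k. real k ^ j * (exp (- measure \<Lambda> C) * measure \<Lambda> C ^ k / fact k)) sums s" for j s
  proof -
    have "(\<integral>\<^sup>+w. ennreal (measure (n w) C ^ j) \<partial>P) = (\<integral>\<^sup>+w. emeasure (n w) C ^ j \<partial>P)"
      by (intro nn_integral_cong)
        (simp add: finite_measure.emeasure_eq_measure[OF finite_measure_n] ennreal_power)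
    also have "\<dots> = (\<Sum>k. ennreal (real k ^ j * (exp (- measure \<Lambda> C) * measure \<Lambda> C ^ k / fact k)))"
      unfolding nn_integral_count[OF C, of "\<lambda>e. e ^ j"]
      by (simp add: ennreal_of_nat_eq_real_of_nat ennreal_power ennreal_mult[symmetric])
    also have "\<dots> = ennreal s"
      using that by (subst suminf_ennreal2) (auto simp: sums_iff)
    finally show ?thesis .
  qed
  have 1: "(\<integral>\<^sup>+w. ennreal (measure (n w) C) \<partial>P) = ennreal (measure \<Lambda> C)"
    using e[of 1] sums_poisson_mean by simp
  have 2: "(\<integral>\<^sup>+w. ennreal ((measure (n w) C)\<^sup>2) \<partial>P) = ennreal ((measure \<Lambda> C)\<^sup>2 + measure \<Lambda> C)"
    by (rule e[OF sums_poisson_square])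
  show "integrable P (\<lambda>w. measure (n w) C)" "expectation (\<lambda>w. measure (n w) C) = measure \<Lambda> C"
    using 1 by (auto intro!: integrableI_nn_integral_finite integral_eq_nn_integral[THEN trans])
  show "integrable P (\<lambda>w. (measure (n w) C)\<^sup>2)"
    "expectation (\<lambda>w. (measure (n w) C)\<^sup>2) = (measure \<Lambda> C)\<^sup>2 + measure \<Lambda> C"
    using 2 by (auto intro!: integrableI_nn_integral_finite integral_eq_nn_integral[THEN trans] simp del: ennreal_plus)
  have "(\<integral>\<^sup>+w. emeasure (n w) C \<partial>P) = (\<integral>\<^sup>+w. ennreal (measure (n w) C) \<partial>P)"
    by (intro nn_integral_cong finite_measure.emeasure_eq_measure finite_measure_n)
  then show "(\<integral>\<^sup>+w. emeasure (n w) C \<partial>P) = emeasure \<Lambda> C"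
    by (simp add: 1 \<Lambda>.emeasure_eq_measure)
qed

lemma count_variance:
  assumes C: "C \<in> sets \<Lambda>"
  shows "integrable P (\<lambda>w. (measure (n w) C - measure \<Lambda> C) * (measure (n w) C - measure \<Lambda> C))"
    "expectation (\<lambda>w. (measure (n w) C - measure \<Lambda> C) * (measure (n w) C - measure \<Lambda> C)) = measure \<Lambda> C"
proof -
  have e: "(\<lambda>w. (measure (n w) C - measure \<Lambda> C) * (measure (n w) C - measure \<Lambda> C))
     = (\<lambda>w. ((measure (n w) C)\<^sup>2 - 2 * measure \<Lambda> C * measure (n w) C) + (measure \<Lambda> C)\<^sup>2)"
    by (auto simp: power2_eq_square algebra_simps)
  show "integrable P (\<lambda>w. (measure (n w) C - measure \<Lambda> C) * (measure (n w) C - measure \<Lambda> C))"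
    unfolding e using count_moments[OF C] by (intro Bochner_Integration.integrable_add Bochner_Integration.integrable_diff) auto
  show "expectation (\<lambda>w. (measure (n w) C - measure \<Lambda> C) * (measure (n w) C - measure \<Lambda> C)) = measure \<Lambda> C"
    unfolding e using count_moments[OF C] by (simp add: prob_space power2_eq_square)
qed

lemma count_covariance:
  assumes C: "C \<in> sets \<Lambda>" and D: "D \<in> sets \<Lambda>" and CD: "C \<inter> D = {}"
  shows "integrable P (\<lambda>w. (measure (n w) C - measure \<Lambda> C) * (measure (n w) D - measure \<Lambda> D))"
    "expectation (\<lambda>w. (measure (n w) C - measure \<Lambda> C) * (measure (n w) D - measure \<Lambda> D)) = 0"
proof -
  \<comment> \<open>Independence of counts is stated for disjoint sequences, so the pair is padded
    with empty sets.\<close>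
  let ?A = "\<lambda>i::nat. if i = 0 then C else if i = 1 then D else {}"
  have "indep_vars (\<lambda>_. borel) (\<lambda>i w. emeasure (n w) (?A i)) UNIV"
    by (rule indep_counts) (use C D CD in \<open>auto simp: disjoint_family_on_def\<close>)
  then have "indep_var borel (\<lambda>w. emeasure (n w) (?A 0)) borel (\<lambda>w. emeasure (n w) (?A 1))"
    by (rule indep_vars_pair) auto
  then have "indep_var borel ((\<lambda>e. enn2real e - measure \<Lambda> C) \<circ> (\<lambda>w. emeasure (n w) (?A 0)))
      borel ((\<lambda>e. enn2real e - measure \<Lambda> D) \<circ> (\<lambda>w. emeasure (n w) (?A 1)))"
    by (rule indep_var_compose) auto
  then have i: "indep_var borel (\<lambda>w. measure (n w) C - measure \<Lambda> C) borel (\<lambda>w. measure (n w) D - measure \<Lambda> D)"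
    by (simp add: o_def measure_def)
  have ic: "integrable P (\<lambda>w. measure (n w) C - measure \<Lambda> C)" "integrable P (\<lambda>w. measure (n w) D - measure \<Lambda> D)"
    using count_moments(1)[OF C] count_moments(1)[OF D] by auto
  show "integrable P (\<lambda>w. (measure (n w) C - measure \<Lambda> C) * (measure (n w) D - measure \<Lambda> D))"
    by (rule indep_var_integrable[OF i ic])
  show "expectation (\<lambda>w. (measure (n w) C - measure \<Lambda> C) * (measure (n w) D - measure \<Lambda> D)) = 0"
    using count_moments(1,2)[OF C]
    by (subst indep_var_lebesgue_integral[OF i ic]) (simp add: prob_space)
qed

text \<open>Campbell's formula. Measurability in \<open>w\<close> is part of the claim because the
  induction steps integrate the inner integrals over \<open>P\<close>.\<close>

lemma campbell_nn:
  assumes "f \<in> borel_measurable \<Lambda>"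
  shows "(\<lambda>w. \<integral>\<^sup>+z. f z \<partial>n w) \<in> borel_measurable P \<and> (\<integral>\<^sup>+w. \<integral>\<^sup>+z. f z \<partial>n w \<partial>P) = (\<integral>\<^sup>+z. f z \<partial>\<Lambda>)"
  using assms
proof (induction rule: borel_measurable_induct)
  case (cong f g)
  have "(\<integral>\<^sup>+z. g z \<partial>n w) = (\<integral>\<^sup>+z. f z \<partial>n w)" if "w \<in> space P" for w
    using cong(3) space_n[OF that] by (intro nn_integral_cong) auto
  moreover have "(\<integral>\<^sup>+z. g z \<partial>\<Lambda>) = (\<integral>\<^sup>+z. f z \<partial>\<Lambda>)"
    using cong(3) by (intro nn_integral_cong) auto
  ultimately show ?case using cong(4)
    by (auto cong: measurable_cong nn_integral_cong)
next
  case (set C)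
  have "(\<integral>\<^sup>+z. indicator C z \<partial>n w) = emeasure (n w) C" if "w \<in> space P" for w
    using set sets_n[OF that] by simp
  then show ?case using set count_moments(5)[OF set] n_measurable[OF set]
    by (auto cong: measurable_cong nn_integral_cong)
next
  case (mult u c)
  have e: "(\<integral>\<^sup>+z. c * u z \<partial>n w) = c * (\<integral>\<^sup>+z. u z \<partial>n w)" if "w \<in> space P" for w
    using mult(2) by (intro nn_integral_cmult) (simp add: measurable_cong_sets[OF sets_n[OF that] refl])
  have m: "(\<lambda>w. \<integral>\<^sup>+z. u z \<partial>n w) \<in> borel_measurable P" using mult by simp
  have "(\<lambda>w. \<integral>\<^sup>+z. c * u z \<partial>n w) \<in> borel_measurable P"
    by (subst measurable_cong[OF e]) (use m in auto)
  moreover have "(\<integral>\<^sup>+w. \<integral>\<^sup>+z. c * u z \<partial>n w \<partial>P) = c * (\<integral>\<^sup>+w. \<integral>\<^sup>+z. u z \<partial>n w \<partial>P)"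
    by (subst nn_integral_cong[OF e]) (use m in \<open>auto simp: nn_integral_cmult\<close>)
  ultimately show ?case using mult by (simp add: nn_integral_cmult)
next
  case (add u v)
  have e: "(\<integral>\<^sup>+z. v z + u z \<partial>n w) = (\<integral>\<^sup>+z. v z \<partial>n w) + (\<integral>\<^sup>+z. u z \<partial>n w)" if "w \<in> space P" for w
    using add by (intro nn_integral_add) (simp_all add: measurable_cong_sets[OF sets_n[OF that] refl])
  have m: "(\<lambda>w. \<integral>\<^sup>+z. u z \<partial>n w) \<in> borel_measurable P" "(\<lambda>w. \<integral>\<^sup>+z. v z \<partial>n w) \<in> borel_measurable P" using add by simp_all
  have "(\<lambda>w. \<integral>\<^sup>+z. v z + u z \<partial>n w) \<in> borel_measurable P"
    by (subst measurable_cong[OF e]) (use m in auto)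
  moreover have "(\<integral>\<^sup>+w. \<integral>\<^sup>+z. v z + u z \<partial>n w \<partial>P) = (\<integral>\<^sup>+w. \<integral>\<^sup>+z. v z \<partial>n w \<partial>P) + (\<integral>\<^sup>+w. \<integral>\<^sup>+z. u z \<partial>n w \<partial>P)"
    by (subst nn_integral_cong[OF e]) (use m in \<open>auto simp: nn_integral_add\<close>)
  ultimately show ?case using add by (simp add: nn_integral_add)
next
  case (seq U)
  have e: "(\<integral>\<^sup>+z. (SUP i. U i) z \<partial>n w) = (SUP i. \<integral>\<^sup>+z. U i z \<partial>n w)" if "w \<in> space P" for w
    unfolding SUP_apply using seq
    by (intro nn_integral_monotone_convergence_SUP) (simp_all add: measurable_cong_sets[OF sets_n[OF that] refl])
  have m: "(\<lambda>w. \<integral>\<^sup>+z. U i z \<partial>n w) \<in> borel_measurable P" for i using seq by simp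
  have "(\<lambda>w. \<integral>\<^sup>+z. (SUP i. U i) z \<partial>n w) \<in> borel_measurable P"
    by (subst measurable_cong[OF e]) (use m in auto)
  moreover have "(\<integral>\<^sup>+w. \<integral>\<^sup>+z. (SUP i. U i) z \<partial>n w \<partial>P) = (SUP i. \<integral>\<^sup>+w. \<integral>\<^sup>+z. U i z \<partial>n w \<partial>P)"
  proof (subst nn_integral_cong[OF e])
    show "(\<integral>\<^sup>+w. (SUP i. \<integral>\<^sup>+z. U i z \<partial>n w) \<partial>P) = (SUP i. \<integral>\<^sup>+w. \<integral>\<^sup>+z. U i z \<partial>n w \<partial>P)"
      using m \<open>incseq U\<close>
      by (intro nn_integral_monotone_convergence_SUP) (auto simp: incseq_def le_fun_def intro!: nn_integral_mono)
  qed
  moreover have "(\<integral>\<^sup>+z. (SUP i. U i) z \<partial>\<Lambda>) = (SUP i. \<integral>\<^sup>+z. U i z \<partial>\<Lambda>)"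
    unfolding SUP_apply using seq by (intro nn_integral_monotone_convergence_SUP) auto
  ultimately show ?case using seq by simp
qed

text \<open>By Campbell's formula the integral of \<open>norm (f z)\<close> against
  \<open>n w\<close> has finite mean. The second claim provides the dominating function for limits
  under the expectation.\<close>

lemma AE_integrable_n:
  fixes f :: "'z \<Rightarrow> 'b::euclidean_space"
  assumes f: "integrable \<Lambda> f"
  shows "AE w in P. integrable (n w) f" "integrable P (\<lambda>w. \<integral>z. norm (f z) \<partial>n w)"
proof -
  have fm: "f \<in> borel_measurable \<Lambda>" and fi: "(\<integral>\<^sup>+z. norm (f z) \<partial>\<Lambda>) < \<infinity>"
    using f by (auto simp: integrable_iff_bounded)
  have nf: "(\<lambda>z. ennreal (norm (f z))) \<in> borel_measurable \<Lambda>" using fm by simp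
  note c = campbell_nn[OF nf]
  have "(\<integral>\<^sup>+w. \<integral>\<^sup>+z. norm (f z) \<partial>n w \<partial>P) \<noteq> \<infinity>" using c fi by simp
  then have fin: "AE w in P. (\<integral>\<^sup>+z. norm (f z) \<partial>n w) \<noteq> \<infinity>"
    using c by (intro nn_integral_PInf_AE) auto
  have fn: "f \<in> borel_measurable (n w)" if "w \<in> space P" for w
    using fm by (simp add: measurable_cong_sets[OF sets_n[OF that] refl])
  show *: "AE w in P. integrable (n w) f"
    using fin AE_space by eventually_elim (use fn in \<open>auto simp: integrable_iff_bounded top.not_eq_extremum\<close>)
  have e: "(\<integral>z. norm (f z) \<partial>n w) = enn2real (\<integral>\<^sup>+z. norm (f z) \<partial>n w)" if "w \<in> space P" for w
    using fn[OF that] by (intro integral_eq_nn_integral) auto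
  have "(\<lambda>w. \<integral>z. norm (f z) \<partial>n w) \<in> borel_measurable P"
    by (subst measurable_cong[OF e]) (use c in auto)
  moreover have "(\<integral>\<^sup>+w. ennreal (norm (\<integral>z. norm (f z) \<partial>n w)) \<partial>P) = (\<integral>\<^sup>+w. \<integral>\<^sup>+z. norm (f z) \<partial>n w \<partial>P)"
    by (rule nn_integral_cong_AE) (use * in \<open>eventually_elim, simp add: nn_integral_eq_integral\<close>)
  ultimately show "integrable P (\<lambda>w. \<integral>z. norm (f z) \<partial>n w)"
    using c fi by (simp add: integrable_iff_bounded)
qed

lemma AE_integral_n_limit:
  fixes f :: "'z \<Rightarrow> 'b::euclidean_space"
  assumes f: "integrable \<Lambda> f" and sm: "\<And>i. s i \<in> borel_measurable \<Lambda>"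
    and s: "\<And>z. z \<in> space \<Lambda> \<Longrightarrow> (\<lambda>i. s i z) \<longlonglongrightarrow> f z"
      "\<And>i z. z \<in> space \<Lambda> \<Longrightarrow> norm (s i z) \<le> 2 * norm (f z)"
  shows "AE w in P. (\<lambda>i. \<integral>z. s i z \<partial>n w) \<longlonglongrightarrow> (\<integral>z. f z \<partial>n w)"
  using AE_integrable_n(1)[OF f] AE_space
proof eventually_elim
  case (elim w)
  have "s i \<in> borel_measurable (n w)" "f \<in> borel_measurable (n w)" for i
    using f sm by (simp_all add: measurable_cong_sets[OF sets_n[OF elim(2)] refl])
  then show ?case
    by (intro integral_dominated_convergence[where w="\<lambda>z. 2 * norm (f z)"]) (use s elim space_n in auto)
qed

lemma integral_n_measurable:
  fixes f :: "'z \<Rightarrow> 'b::euclidean_space"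
  assumes "f \<in> borel_measurable \<Lambda>"
  shows "(\<lambda>w. \<integral>z. f z \<partial>n w) \<in> borel_measurable P"
  by (rule finite_kernel_integral_measurable_const[where Z=\<Lambda>])
     (use assms sets_n finite_n n_measurable in auto)

lemma integral_n_simple:
  fixes f :: "'z \<Rightarrow> 'b::euclidean_space"
  assumes "simple_function \<Lambda> f"
  shows "w \<in> space P \<Longrightarrow> (\<integral>z. f z \<partial>n w) = (\<Sum>y\<in>f ` space \<Lambda>. measure (n w) {z \<in> space \<Lambda>. f z = y} *\<^sub>R y)"
    "(\<integral>z. f z \<partial>\<Lambda>) = (\<Sum>y\<in>f ` space \<Lambda>. measure \<Lambda> {z \<in> space \<Lambda>. f z = y} *\<^sub>R y)"
    "\<And>y. {z \<in> space \<Lambda>. f z = y} \<in> sets \<Lambda>"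
proof -
  show s: "{z \<in> space \<Lambda>. f z = y} \<in> sets \<Lambda>" for y
    using simple_functionD(2)[OF assms, of "{y}"] by (simp add: vimage_def Int_def conj_commute)
  have "Bochner_Integration.simple_bochner_integrable \<Lambda> f"
    using assms \<Lambda>.emeasure_finite by (simp add: Bochner_Integration.simple_bochner_integrable.simps)
  from simple_bochner_integrable_eq_integral[OF this]
  show "(\<integral>z. f z \<partial>\<Lambda>) = (\<Sum>y\<in>f ` space \<Lambda>. measure \<Lambda> {z \<in> space \<Lambda>. f z = y} *\<^sub>R y)"
    by (simp add: Bochner_Integration.simple_bochner_integral_def)
  assume w: "w \<in> space P"
  interpret n: finite_measure "n w" by (rule finite_measure_n[OF w])
  have "simple_function (n w) f"
    using assms sets_n[OF w] space_n[OF w] by (simp add: simple_function_def)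
  then have "Bochner_Integration.simple_bochner_integrable (n w) f"
    using n.emeasure_finite by (simp add: Bochner_Integration.simple_bochner_integrable.simps)
  from simple_bochner_integrable_eq_integral[OF this]
  show "(\<integral>z. f z \<partial>n w) = (\<Sum>y\<in>f ` space \<Lambda>. measure (n w) {z \<in> space \<Lambda>. f z = y} *\<^sub>R y)"
    by (simp add: Bochner_Integration.simple_bochner_integral_def space_n[OF w])
qed

text \<open>One approximating sequence that works for the intensity and for almost every realization
  at once; the last property dominates the realized integrals by an integrable random
  variable.\<close>

lemma simple_approx:
  fixes f :: "'z \<Rightarrow> 'b::euclidean_space"
  assumes f: "integrable \<Lambda> f"
  obtains s where "\<And>i. simple_function \<Lambda> (s i)" "\<And>z. z \<in> space \<Lambda> \<Longrightarrow> (\<lambda>i. s i z) \<longlonglongrightarrow> f z"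
    "\<And>i z. z \<in> space \<Lambda> \<Longrightarrow> norm (s i z) \<le> 2 * norm (f z)"
    "(\<lambda>i. \<integral>z. s i z \<partial>\<Lambda>) \<longlonglongrightarrow> (\<integral>z. f z \<partial>\<Lambda>)"
    "AE w in P. (\<lambda>i. \<integral>z. s i z \<partial>n w) \<longlonglongrightarrow> (\<integral>z. f z \<partial>n w)"
    "\<And>i. AE w in P. norm (\<integral>z. s i z \<partial>n w) \<le> 2 * (\<integral>z. norm (f z) \<partial>n w)"
proof -
  have fm: "f \<in> borel_measurable \<Lambda>" using f by simp
  obtain s where s: "\<And>i. simple_function \<Lambda> (s i)" "\<And>z. z \<in> space \<Lambda> \<Longrightarrow> (\<lambda>i. s i z) \<longlonglongrightarrow> f z"
    "\<And>i z. z \<in> space \<Lambda> \<Longrightarrow> norm (s i z) \<le> 2 * norm (f z)"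
    using borel_measurable_implies_sequence_metric[OF fm, of 0] by simp metis
  have sm: "s i \<in> borel_measurable \<Lambda>" for i using s(1) by (rule borel_measurable_simple_function)
  have sn: "s i \<in> borel_measurable (n w)" "f \<in> borel_measurable (n w)" if "w \<in> space P" for w i
    using sm fm by (simp_all add: measurable_cong_sets[OF sets_n[OF that] refl])
  have 1: "(\<lambda>i. \<integral>z. s i z \<partial>\<Lambda>) \<longlonglongrightarrow> (\<integral>z. f z \<partial>\<Lambda>)"
    by (rule integral_dominated_convergence[where w="\<lambda>z. 2 * norm (f z)"]) (use s sm fm f in auto)
  have 2: "AE w in P. (\<lambda>i. \<integral>z. s i z \<partial>n w) \<longlonglongrightarrow> (\<integral>z. f z \<partial>n w)"
    by (rule AE_integral_n_limit[OF f sm s(2,3)])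
  have 3: "AE w in P. norm (\<integral>z. s i z \<partial>n w) \<le> 2 * (\<integral>z. norm (f z) \<partial>n w)" for i
    using AE_integrable_n(1)[OF f] AE_space
  proof eventually_elim
    case (elim w)
    have "integrable (n w) (s i)"
      by (rule Bochner_Integration.integrable_bound[of _ "\<lambda>z. 2 * norm (f z)"]) (use elim s sn space_n in auto)
    then have "integrable (n w) (\<lambda>z. norm (s i z))" by simp
    then have "(\<integral>z. norm (s i z) \<partial>n w) \<le> (\<integral>z. 2 * norm (f z) \<partial>n w)"
      using elim s space_n by (intro integral_mono) auto
    then have "(\<integral>z. norm (s i z) \<partial>n w) \<le> 2 * (\<integral>z. norm (f z) \<partial>n w)" by simp
    then show ?case by (rule order_trans[OF integral_norm_bound])
  qed
  show thesis using that[of s] s 1 2 3 by blast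
qed

lemma integral_n_mean:
  fixes f :: "'z \<Rightarrow> 'b::euclidean_space"
  assumes f: "integrable \<Lambda> f"
  shows "integrable P (\<lambda>w. \<integral>z. f z \<partial>n w)" "expectation (\<lambda>w. \<integral>z. f z \<partial>n w) = (\<integral>z. f z \<partial>\<Lambda>)"
proof -
  obtain s where s: "\<And>i. simple_function \<Lambda> (s i)" "\<And>z. z \<in> space \<Lambda> \<Longrightarrow> (\<lambda>i. s i z) \<longlonglongrightarrow> f z"
    "\<And>i z. z \<in> space \<Lambda> \<Longrightarrow> norm (s i z) \<le> 2 * norm (f z)"
    "(\<lambda>i. \<integral>z. s i z \<partial>\<Lambda>) \<longlonglongrightarrow> (\<integral>z. f z \<partial>\<Lambda>)"
    "AE w in P. (\<lambda>i. \<integral>z. s i z \<partial>n w) \<longlonglongrightarrow> (\<integral>z. f z \<partial>n w)"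
    "\<And>i. AE w in P. norm (\<integral>z. s i z \<partial>n w) \<le> 2 * (\<integral>z. norm (f z) \<partial>n w)"
    by (rule simple_approx[OF f]) (rule that)
  have m: "(\<lambda>w. \<integral>z. f z \<partial>n w) \<in> borel_measurable P" "\<And>i. (\<lambda>w. \<integral>z. s i z \<partial>n w) \<in> borel_measurable P"
    using f borel_measurable_simple_function[OF s(1)] by (auto intro!: integral_n_measurable)
  have d: "integrable P (\<lambda>w. 2 * (\<integral>z. norm (f z) \<partial>n w))" using AE_integrable_n(2)[OF f] by simp
  show "integrable P (\<lambda>w. \<integral>z. f z \<partial>n w)"
    by (rule integrable_dominated_convergence[OF m d s(5,6)])
  have "expectation (\<lambda>w. \<integral>z. s i z \<partial>n w) = (\<integral>z. s i z \<partial>\<Lambda>)" for i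
  proof -
    have "expectation (\<lambda>w. \<integral>z. s i z \<partial>n w) = expectation (\<lambda>w. \<Sum>y\<in>s i ` space \<Lambda>. measure (n w) {z \<in> space \<Lambda>. s i z = y} *\<^sub>R y)"
      by (intro Bochner_Integration.integral_cong integral_n_simple s refl)
    also have "\<dots> = (\<Sum>y\<in>s i ` space \<Lambda>. expectation (\<lambda>w. measure (n w) {z \<in> space \<Lambda>. s i z = y} *\<^sub>R y))"
      using integral_n_simple(3)[OF s(1)] by (intro Bochner_Integration.integral_sum) (auto intro!: count_moments integrable_scaleR_left)
    also have "\<dots> = (\<integral>z. s i z \<partial>\<Lambda>)"
      using integral_n_simple(3)[OF s(1)]
      by (simp add: integral_n_simple(2)[OF s(1)] count_moments integral_scaleR_left)
    finally show ?thesis .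
  qed
  then have "(\<lambda>i. \<integral>z. s i z \<partial>\<Lambda>) \<longlonglongrightarrow> expectation (\<lambda>w. \<integral>z. f z \<partial>n w)"
    using integral_dominated_convergence[OF m d s(5,6)] by simp
  then show "expectation (\<lambda>w. \<integral>z. f z \<partial>n w) = (\<integral>z. f z \<partial>\<Lambda>)"
    using s(4) by (rule LIMSEQ_unique)
qed

text \<open>The isometry of the compensated Poisson integral: the counts on the level sets of
  \<open>f\<close> are uncorrelated, with variances given by the intensity, so only the diagonal of
  the expanded square survives.\<close>

lemma compensated_L2_simple:
  fixes f :: "'z \<Rightarrow> 'b::euclidean_space"
  assumes f: "simple_function \<Lambda> f"
  shows "(\<integral>\<^sup>+w. ennreal ((norm ((\<integral>z. f z \<partial>n w) - (\<integral>z. f z \<partial>\<Lambda>)))\<^sup>2) \<partial>P) = (\<integral>\<^sup>+z. ennreal ((norm (f z))\<^sup>2) \<partial>\<Lambda>)"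
proof -
  let ?I = "f ` space \<Lambda>"
  define E where "E y = {z \<in> space \<Lambda>. f z = y}" for y
  define Y where "Y y w = measure (n w) (E y) - measure \<Lambda> (E y)" for y w
  have E: "E y \<in> sets \<Lambda>" for y unfolding E_def by (rule integral_n_simple(3)[OF f])
  have fin: "finite ?I" using f by (rule simple_functionD)
  have cov: "integrable P (\<lambda>w. Y y w * Y y' w)" "expectation (\<lambda>w. Y y w * Y y' w) = (if y = y' then measure \<Lambda> (E y) else 0)" for y y'
  proof -
    have "E y \<inter> E y' = {}" if "y \<noteq> y'" using that by (auto simp: E_def)
    then show "integrable P (\<lambda>w. Y y w * Y y' w)" "expectation (\<lambda>w. Y y w * Y y' w) = (if y = y' then measure \<Lambda> (E y) else 0)"
      using count_variance[OF E[of y]] count_covariance[OF E[of y] E[of y']] unfolding Y_def by auto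
  qed
  have eq: "(norm ((\<integral>z. f z \<partial>n w) - (\<integral>z. f z \<partial>\<Lambda>)))\<^sup>2 = (\<Sum>y\<in>?I. \<Sum>y'\<in>?I. (Y y w * Y y' w) * (y \<bullet> y'))" if "w \<in> space P" for w
  proof -
    have "(\<integral>z. f z \<partial>n w) - (\<integral>z. f z \<partial>\<Lambda>) = (\<Sum>y\<in>?I. Y y w *\<^sub>R y)"
      unfolding integral_n_simple(1)[OF f that] integral_n_simple(2)[OF f] Y_def E_def
      by (simp add: sum_subtractf scaleR_left_diff_distrib)
    then show ?thesis
      by (simp add: power2_norm_eq_inner inner_sum_left inner_sum_right sum_distrib_left ac_simps)
         (simp add: inner_commute)
  qed
  have int: "integrable P (\<lambda>w. \<Sum>y\<in>?I. \<Sum>y'\<in>?I. (Y y w * Y y' w) * (y \<bullet> y'))"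
    using cov by (intro Bochner_Integration.integrable_sum) auto
  have "(\<integral>\<^sup>+w. ennreal ((norm ((\<integral>z. f z \<partial>n w) - (\<integral>z. f z \<partial>\<Lambda>)))\<^sup>2) \<partial>P)
     = (\<integral>\<^sup>+w. ennreal (\<Sum>y\<in>?I. \<Sum>y'\<in>?I. (Y y w * Y y' w) * (y \<bullet> y')) \<partial>P)"
    by (intro nn_integral_cong) (simp add: eq)
  also have "\<dots> = ennreal (expectation (\<lambda>w. \<Sum>y\<in>?I. \<Sum>y'\<in>?I. (Y y w * Y y' w) * (y \<bullet> y')))"
    by (intro nn_integral_eq_integral int AE_I2) (simp add: eq[symmetric])
  also have "expectation (\<lambda>w. \<Sum>y\<in>?I. \<Sum>y'\<in>?I. (Y y w * Y y' w) * (y \<bullet> y'))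
     = (\<Sum>y\<in>?I. \<Sum>y'\<in>?I. expectation (\<lambda>w. Y y w * Y y' w) * (y \<bullet> y'))"
    using cov(1) by (simp add: Bochner_Integration.integral_sum Bochner_Integration.integrable_sum)
  also have "\<dots> = (\<Sum>y\<in>?I. measure \<Lambda> (E y) * (norm y)\<^sup>2)"
    using fin by (simp add: cov(2) if_distrib[of "\<lambda>x. x * _"] sum.delta power2_norm_eq_inner cong: if_cong)
  also have "\<dots> = (\<Sum>y\<in>?I. \<integral>z. indicator (E y) z * (norm y)\<^sup>2 \<partial>\<Lambda>)"
    using E by simp
  also have "\<dots> = (\<integral>z. (\<Sum>y\<in>?I. indicator (E y) z * (norm y)\<^sup>2) \<partial>\<Lambda>)"
    using E by (intro Bochner_Integration.integral_sum[symmetric]) (simp add: \<Lambda>.emeasure_eq_measure)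
  also have "ennreal \<dots> = (\<integral>\<^sup>+z. ennreal (\<Sum>y\<in>?I. indicator (E y) z * (norm y)\<^sup>2) \<partial>\<Lambda>)"
    using E by (intro nn_integral_eq_integral[symmetric] AE_I2 sum_nonneg Bochner_Integration.integrable_sum)
      (auto simp: \<Lambda>.emeasure_eq_measure)
  also have "\<dots> = (\<integral>\<^sup>+z. ennreal ((norm (f z))\<^sup>2) \<partial>\<Lambda>)"
  proof (rule nn_integral_cong)
    fix z assume z: "z \<in> space \<Lambda>"
    have "(\<Sum>y\<in>?I. indicator (E y) z * (norm y)\<^sup>2) = (\<Sum>y\<in>?I. if y = f z then (norm y)\<^sup>2 else 0)"
      using z by (intro sum.cong) (auto simp: E_def indicator_def)
    then show "ennreal (\<Sum>y\<in>?I. indicator (E y) z * (norm y)\<^sup>2) = ennreal ((norm (f z))\<^sup>2)"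
      using fin z by simp
  qed
  finally show ?thesis .
qed

text \<open>The isometry is passed on from simple functions. The left side is treated by Fatou's
  lemma, whence the inequality, the right side by dominated convergence.\<close>

lemma compensated_L2:
  fixes f :: "'z \<Rightarrow> 'b::euclidean_space"
  assumes fm: "f \<in> borel_measurable \<Lambda>" and f2: "integrable \<Lambda> (\<lambda>z. (norm (f z))\<^sup>2)"
  shows "(\<integral>\<^sup>+w. ennreal ((norm ((\<integral>z. f z \<partial>n w) - (\<integral>z. f z \<partial>\<Lambda>)))\<^sup>2) \<partial>P) \<le> (\<integral>\<^sup>+z. ennreal ((norm (f z))\<^sup>2) \<partial>\<Lambda>)"
proof -
  have "integrable \<Lambda> (\<lambda>z. norm (f z))"
    by (rule \<Lambda>.square_integrable_imp_integrable) (use fm f2 in auto)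
  then have f: "integrable \<Lambda> f" using fm by (simp add: integrable_norm_iff)
  obtain s where s: "\<And>i. simple_function \<Lambda> (s i)" "\<And>z. z \<in> space \<Lambda> \<Longrightarrow> (\<lambda>i. s i z) \<longlonglongrightarrow> f z"
    "\<And>i z. z \<in> space \<Lambda> \<Longrightarrow> norm (s i z) \<le> 2 * norm (f z)"
    "(\<lambda>i. \<integral>z. s i z \<partial>\<Lambda>) \<longlonglongrightarrow> (\<integral>z. f z \<partial>\<Lambda>)"
    "AE w in P. (\<lambda>i. \<integral>z. s i z \<partial>n w) \<longlonglongrightarrow> (\<integral>z. f z \<partial>n w)"
    "\<And>i. AE w in P. norm (\<integral>z. s i z \<partial>n w) \<le> 2 * (\<integral>z. norm (f z) \<partial>n w)"
    by (rule simple_approx[OF f]) (rule that)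
  have sm: "s i \<in> borel_measurable \<Lambda>" for i using s(1) by (rule borel_measurable_simple_function)
  have m [measurable]: "(\<lambda>w. \<integral>z. f z \<partial>n w) \<in> borel_measurable P" "\<And>i. (\<lambda>w. \<integral>z. s i z \<partial>n w) \<in> borel_measurable P"
    using fm sm by (auto intro!: integral_n_measurable)
  let ?u = "\<lambda>i w. ennreal ((norm ((\<integral>z. s i z \<partial>n w) - (\<integral>z. s i z \<partial>\<Lambda>)))\<^sup>2)"
  have "AE w in P. ennreal ((norm ((\<integral>z. f z \<partial>n w) - (\<integral>z. f z \<partial>\<Lambda>)))\<^sup>2) = liminf (\<lambda>i. ?u i w)"
    using s(5)
  proof eventually_elim
    case (elim w)
    have "(\<lambda>i. ?u i w) \<longlonglongrightarrow> ennreal ((norm ((\<integral>z. f z \<partial>n w) - (\<integral>z. f z \<partial>\<Lambda>)))\<^sup>2)"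
      by (intro tendsto_intros elim s(4))
    from lim_imp_Liminf[OF trivial_limit_sequentially this] show ?case by simp
  qed
  then have "(\<integral>\<^sup>+w. ennreal ((norm ((\<integral>z. f z \<partial>n w) - (\<integral>z. f z \<partial>\<Lambda>)))\<^sup>2) \<partial>P) = (\<integral>\<^sup>+w. liminf (\<lambda>i. ?u i w) \<partial>P)"
    by (rule nn_integral_cong_AE)
  also have "\<dots> \<le> liminf (\<lambda>i. \<integral>\<^sup>+w. ?u i w \<partial>P)"
    by (rule nn_integral_liminf) simp
  also have "(\<lambda>i. \<integral>\<^sup>+w. ?u i w \<partial>P) = (\<lambda>i. \<integral>\<^sup>+z. ennreal ((norm (s i z))\<^sup>2) \<partial>\<Lambda>)"
    by (simp add: compensated_L2_simple s)
  also have "liminf \<dots> = (\<integral>\<^sup>+z. ennreal ((norm (f z))\<^sup>2) \<partial>\<Lambda>)"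
  proof (rule lim_imp_Liminf)
    show "(\<lambda>i. \<integral>\<^sup>+z. ennreal ((norm (s i z))\<^sup>2) \<partial>\<Lambda>) \<longlonglongrightarrow> (\<integral>\<^sup>+z. ennreal ((norm (f z))\<^sup>2) \<partial>\<Lambda>)"
    proof (rule nn_integral_dominated_convergence[where w="\<lambda>z. ennreal (4 * (norm (f z))\<^sup>2)"])
      show "AE z in \<Lambda>. ennreal ((norm (s j z))\<^sup>2) \<le> ennreal (4 * (norm (f z))\<^sup>2)" for j
      proof (intro AE_I2 ennreal_leI)
        fix z assume "z \<in> space \<Lambda>"
        then have "(norm (s j z))\<^sup>2 \<le> (2 * norm (f z))\<^sup>2" by (intro power_mono s) auto
        then show "(norm (s j z))\<^sup>2 \<le> 4 * (norm (f z))\<^sup>2" by (simp add: power_mult_distrib)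
      qed
      have "integrable \<Lambda> (\<lambda>z. 4 * (norm (f z))\<^sup>2)" using f2 by simp
      then show "(\<integral>\<^sup>+z. ennreal (4 * (norm (f z))\<^sup>2) \<partial>\<Lambda>) < \<infinity>"
        by (simp add: nn_integral_eq_integral)
      show "AE z in \<Lambda>. (\<lambda>i. ennreal ((norm (s i z))\<^sup>2)) \<longlonglongrightarrow> ennreal ((norm (f z))\<^sup>2)"
        by (intro AE_I2 tendsto_intros s)
    qed (use fm sm in auto)
  qed simp
  finally show ?thesis .
qed

section \<open>The law of a Poisson integral is determined by the intensity\<close>

lemma joint_counts_law:
  fixes C :: "nat \<Rightarrow> 'z set"
  assumes "range C \<subseteq> sets \<Lambda>" "disjoint_family C" "I \<noteq> {}"
  shows "distr P (PiM I (\<lambda>_. borel)) (\<lambda>w. \<lambda>i\<in>I. emeasure (n w) (C i))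
     = PiM I (\<lambda>i. distr P borel (\<lambda>w. emeasure (n w) (C i)))"
proof -
  have "indep_vars (\<lambda>_. borel) (\<lambda>i w. emeasure (n w) (C i)) I"
    using indep_counts[OF assms(1,2)] by (rule indep_vars_subset) simp
  then show ?thesis
    using assms n_measurable by (subst (asm) indep_vars_iff_distr_eq_PiM') auto
qed

end

text \<open>For a simple integrand the integral is a fixed function of finitely many independent
  Poisson counts, whose joint law depends on \<open>\<Lambda>\<close> only; an integrable
  \<open>f\<close> follows by an almost sure limit. This is what makes the jump parts on different
  windows equal in law.\<close>

lemma poisson_integral_law:
  fixes f :: "'z \<Rightarrow> 'b::euclidean_space"
  assumes "finite_poisson_measure P n \<Lambda>" "finite_poisson_measure P' n' \<Lambda>" and f: "integrable \<Lambda> f"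
  shows "distr P borel (\<lambda>w. \<integral>z. f z \<partial>n w) = distr P' borel (\<lambda>w. \<integral>z. f z \<partial>n' w)"
proof -
  interpret n: finite_poisson_measure P n \<Lambda> by fact
  interpret n': finite_poisson_measure P' n' \<Lambda> by fact
  have count: "distr P borel (\<lambda>w. emeasure (n w) C) = distr P' borel (\<lambda>w. emeasure (n' w) C)" if C: "C \<in> sets \<Lambda>" for C
  proof (rule measure_eqI)
    fix B :: "ennreal set" assume "B \<in> sets (distr P borel (\<lambda>w. emeasure (n w) C))"
    then have B: "B \<in> sets borel" by simp
    have "emeasure (distr P borel (\<lambda>w. emeasure (n w) C)) B = (\<integral>\<^sup>+w. indicator B (emeasure (n w) C) \<partial>P)"
      "emeasure (distr P' borel (\<lambda>w. emeasure (n' w) C)) B = (\<integral>\<^sup>+w. indicator B (emeasure (n' w) C) \<partial>P')"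
      using B n.n_measurable[OF C] n'.n_measurable[OF C] nn_integral_distr[of _ _ borel "indicator B"]
      by (simp_all flip: nn_integral_indicator)
    then show "emeasure (distr P borel (\<lambda>w. emeasure (n w) C)) B = emeasure (distr P' borel (\<lambda>w. emeasure (n' w) C)) B"
      by (simp add: n.nn_integral_count[OF C] n'.nn_integral_count[OF C])
  qed simp
  have simple: "distr P borel (\<lambda>w. \<integral>z. s z \<partial>n w) = distr P' borel (\<lambda>w. \<integral>z. s z \<partial>n' w)"
    if s: "simple_function \<Lambda> s" for s :: "'z \<Rightarrow> 'b"
  proof -
    have fin: "finite (s ` space \<Lambda>)" using s by (rule simple_functionD)
    then obtain ys where ys: "set ys = s ` space \<Lambda>" "distinct ys" using finite_distinct_list by blast
    define C where "C i = (if i < length ys then {z \<in> space \<Lambda>. s z = ys ! i} else {})" for i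
    have C: "range C \<subseteq> sets \<Lambda>" using n.integral_n_simple(3)[OF s] by (auto simp: C_def)
    have disj: "disjoint_family C"
      using ys(2) by (auto simp: disjoint_family_on_def C_def nth_eq_iff_index_eq)
    \<comment> \<open>One index more than there are values, carrying the empty set, so that the
      index set is nonempty even if \<open>s\<close> takes no value at all.\<close>
    let ?I = "{..length ys}"
    define h where "h v = (\<Sum>i<length ys. enn2real (v i) *\<^sub>R ys ! i)" for v :: "nat \<Rightarrow> ennreal"
    have h: "h \<in> borel_measurable (PiM ?I (\<lambda>_. borel))"
      unfolding h_def by (intro borel_measurable_sum borel_measurable_scaleR borel_measurable_enn2real) (auto intro!: measurable_component_singleton)
    have sum_eq: "(\<Sum>y\<in>s ` space \<Lambda>. g y) = (\<Sum>i<length ys. g (ys ! i))" for g :: "'b \<Rightarrow> 'b"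
      using ys sum_list_distinct_conv_sum_set[of ys g] by (simp add: sum_list_sum_nth atLeast0LessThan)
    have e: "(\<integral>z. s z \<partial>n w) = h (\<lambda>i\<in>?I. emeasure (n w) (C i))" if "w \<in> space P" for w
      unfolding n.integral_n_simple(1)[OF s that] sum_eq h_def by (intro sum.cong) (auto simp: C_def measure_def)
    have e': "(\<integral>z. s z \<partial>n' w) = h (\<lambda>i\<in>?I. emeasure (n' w) (C i))" if "w \<in> space P'" for w
      unfolding n'.integral_n_simple(1)[OF s that] sum_eq h_def by (intro sum.cong) (auto simp: C_def measure_def)
    have m: "(\<lambda>w. \<lambda>i\<in>?I. emeasure (n w) (C i)) \<in> measurable P (PiM ?I (\<lambda>_. borel))"
      "(\<lambda>w. \<lambda>i\<in>?I. emeasure (n' w) (C i)) \<in> measurable P' (PiM ?I (\<lambda>_. borel))"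
      using C by (auto intro!: measurable_restrict n.n_measurable n'.n_measurable)
    have "distr P borel (\<lambda>w. \<integral>z. s z \<partial>n w) = distr (distr P (PiM ?I (\<lambda>_. borel)) (\<lambda>w. \<lambda>i\<in>?I. emeasure (n w) (C i))) borel h"
      using m h by (subst distr_distr) (auto intro!: distr_cong simp: e)
    also have "distr P (PiM ?I (\<lambda>_. borel)) (\<lambda>w. \<lambda>i\<in>?I. emeasure (n w) (C i))
       = distr P' (PiM ?I (\<lambda>_. borel)) (\<lambda>w. \<lambda>i\<in>?I. emeasure (n' w) (C i))"
      using C count by (subst n.joint_counts_law[OF C disj] n'.joint_counts_law[OF C disj], simp)+ (auto intro!: PiM_cong)
    also have "distr \<dots> borel h = distr P' borel (\<lambda>w. \<integral>z. s z \<partial>n' w)"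
      using m h by (subst distr_distr) (auto intro!: distr_cong simp: e')
    finally show ?thesis .
  qed
  obtain s where s: "\<And>i. simple_function \<Lambda> (s i)" "\<And>z. z \<in> space \<Lambda> \<Longrightarrow> (\<lambda>i. s i z) \<longlonglongrightarrow> f z"
    "\<And>i z. z \<in> space \<Lambda> \<Longrightarrow> norm (s i z) \<le> 2 * norm (f z)"
    using borel_measurable_implies_sequence_metric[of f \<Lambda> 0] f by simp metis
  have sm: "s i \<in> borel_measurable \<Lambda>" for i using s(1) by (rule borel_measurable_simple_function)
  note lim = n.AE_integral_n_limit[OF f sm s(2,3)] n'.AE_integral_n_limit[OF f sm s(2,3)]
  show ?thesis
    by (rule distr_limit_eq[where X="\<lambda>i w. \<integral>z. s i z \<partial>n w" and Y="\<lambda>i w. \<integral>z. s i z \<partial>n' w"])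
       (use f sm s lim assms simple in \<open>auto intro!: n.integral_n_measurable n'.integral_n_measurable
          intro: n.prob_space_axioms n'.prob_space_axioms\<close>)
qed

section \<open>Empirical measures and product laws\<close>

lemma measurable_vec_nth [measurable (raw)]:
  fixes f :: "'w \<Rightarrow> ('a::euclidean_space)^'n"
  assumes "f \<in> borel_measurable M"
  shows "(\<lambda>x. f x $ i) \<in> borel_measurable M"
  using assms by (rule measurable_compose) (intro borel_measurable_continuous_onI continuous_intros)

lemma measurable_vec_lambda [measurable (raw)]:
  fixes f :: "'n::finite \<Rightarrow> 'w \<Rightarrow> 'a::euclidean_space"
  assumes "\<And>i. f i \<in> borel_measurable M"
  shows "(\<lambda>x. \<chi> i. f i x) \<in> borel_measurable M"
  using assms by (subst borel_measurable_euclidean_space) (auto simp: Basis_vec_def inner_axis)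

lemma power2_norm_vec: "(norm (x :: ('a::real_normed_vector)^'n))\<^sup>2 = (\<Sum>i\<in>UNIV. (norm (x $ i))\<^sup>2)"
  by (simp add: norm_vec_def L2_set_def sum_nonneg)

lemma nn_integral_uniform_count:
  fixes f :: "'n::finite \<Rightarrow> real"
  assumes "\<And>j. 0 \<le> f j"
  shows "(\<integral>\<^sup>+j. ennreal (f j) \<partial>uniform_count_measure UNIV) = ennreal ((\<Sum>j\<in>UNIV. f j) / CARD('n))"
  unfolding uniform_count_measure_def using assms
  by (subst nn_integral_point_measure_finite) (auto simp: ennreal_mult[symmetric] sum_divide_distrib)

lemma prob_space_uniform_UNIV: "prob_space (uniform_count_measure (UNIV :: 'n::finite set))"
  by (rule prob_space_uniform_count_measure) auto

lemma nth_measurable_uniform: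
  fixes x :: "real^'d^'n"
  shows "(\<lambda>j. x $ j) \<in> borel_measurable (uniform_count_measure (UNIV :: 'n set))"
  by (simp add: measurable_def space_uniform_count_measure)

lemma empirical_P2: "empirical_measure (x :: real^'d^'n) \<in> P2"
  unfolding empirical_measure_def
  by (rule distr_in_P2I[OF prob_space_uniform_UNIV nth_measurable_uniform])
     (simp add: nn_integral_uniform_count)

text \<open>Couple the two empirical measures by drawing the same index in both. The factor
  \<open>1 / CARD('n)\<close> makes the sum of this bound over all particles independent of their
  number.\<close>

lemma empirical_W2:
  fixes x y :: "real^'d^'n"
  shows "(W2 (empirical_measure x) (empirical_measure y))\<^sup>2 \<le> (norm (x - y))\<^sup>2 / CARD('n)"
  unfolding empirical_measure_def
  by (rule W2_sq_le_distr[OF prob_space_uniform_UNIV nth_measurable_uniform nth_measurable_uniform])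
     (simp_all add: nn_integral_uniform_count power2_norm_vec[of "x - y"] sum_nonneg)

text \<open>By \<open>empirical_W2\<close> the map is 1-Lipschitz from configurations to
  \<open>P2\<close> with \<open>W2\<close>, so preimages of \<open>W2_open\<close> sets are
  open.\<close>

lemma empirical_measurable [measurable]:
  "(empirical_measure :: real^'d^'n \<Rightarrow> _) \<in> measurable borel P2_borel"
  unfolding P2_borel_def
proof (rule measurable_sigma_sets[where \<Omega>=P2 and A="{U. W2_open U}"])
  show "sets (sigma P2 {U. W2_open U}) = sigma_sets P2 {U. W2_open U}"
    by (intro sets_measure_of) (auto simp: W2_open_def)
  show "{U. W2_open U} \<subseteq> Pow P2" by (auto simp: W2_open_def)
  show "(empirical_measure :: real^'d^'n \<Rightarrow> _) \<in> space borel \<rightarrow> P2" by (auto intro: empirical_P2)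
  fix U :: "(real^'d) measure set" assume "U \<in> {U. W2_open U}"
  then have U: "W2_open U" by simp
  have "open ((empirical_measure :: real^'d^'n \<Rightarrow> _) -` U)"
  proof (rule openI)
    fix x :: "real^'d^'n" assume "x \<in> empirical_measure -` U"
    then obtain e where e: "e > 0" "\<And>\<nu>. \<nu> \<in> P2 \<Longrightarrow> W2 (empirical_measure x) \<nu> < e \<Longrightarrow> \<nu> \<in> U"
      using U by (auto simp: W2_open_def)
    have "empirical_measure y \<in> U" if "dist x y < e" for y :: "real^'d^'n"
    proof (rule e(2)[OF empirical_P2])
      have "(W2 (empirical_measure x) (empirical_measure y))\<^sup>2 \<le> (norm (x - y))\<^sup>2 / CARD('n)"
        by (rule empirical_W2)
      also have "\<dots> \<le> (norm (x - y))\<^sup>2 / 1"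
        by (intro divide_left_mono) (auto simp: Suc_le_eq)
      finally have "(W2 (empirical_measure x) (empirical_measure y))\<^sup>2 \<le> (norm (x - y))\<^sup>2" by simp
      then have "W2 (empirical_measure x) (empirical_measure y) \<le> norm (x - y)"
        by (rule power2_le_imp_le) simp
      then show "W2 (empirical_measure x) (empirical_measure y) < e"
        using that by (simp add: dist_norm)
    qed
    then show "\<exists>e>0. ball x e \<subseteq> empirical_measure -` U"
      using e(1) by (intro exI[of _ e]) auto
  qed
  then show "(empirical_measure :: real^'d^'n \<Rightarrow> _) -` U \<inter> space borel \<in> sets borel" by (simp add: borel_open)
qed

lemma iid_law_P2:
  fixes \<mu> :: "(real^'d) measure"
  assumes "\<mu> \<in> P2"
  shows "(iid_law \<mu> :: (real^'d^'n) measure) \<in> P2"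
proof -
  let ?P = "\<Pi>\<^sub>M j\<in>(UNIV :: 'n set). \<mu>"
  interpret \<mu>: prob_space \<mu> using P2D[OF assms] by simp
  interpret P: product_prob_space "\<lambda>_. \<mu>" "UNIV :: 'n set" ..
  have [measurable_cong]: "sets \<mu> = sets borel" using P2D[OF assms] by simp
  have m: "(\<lambda>f. f j) \<in> borel_measurable ?P" for j by measurable
  show ?thesis
    unfolding iid_law_def
  proof (rule distr_in_P2I)
    show "prob_space ?P" by (rule P.prob_space_axioms)
    show "(\<lambda>f. \<chi> j. f j) \<in> borel_measurable ?P" using m by (rule measurable_vec_lambda)
    have "(\<integral>\<^sup>+f. ennreal ((norm (\<chi> j. f j :: real^'d^'n))\<^sup>2) \<partial>?P) = (\<Sum>j\<in>UNIV. \<integral>\<^sup>+f. ennreal ((norm (f j))\<^sup>2) \<partial>?P)"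
    proof -
      have "ennreal ((norm (\<chi> j. f j :: real^'d^'n))\<^sup>2) = (\<Sum>j\<in>UNIV. ennreal ((norm (f j))\<^sup>2))" for f :: "'n \<Rightarrow> real^'d"
        by (subst power2_norm_vec) simp
      then show ?thesis using m by (subst nn_integral_sum[symmetric]) auto
    qed
    also have "\<dots> = (\<Sum>j\<in>(UNIV::'n set). \<integral>\<^sup>+x. ennreal ((norm x)\<^sup>2) \<partial>\<mu>)"
    proof (rule sum.cong[OF refl])
      fix j :: 'n
      have "(\<integral>\<^sup>+x. ennreal ((norm x)\<^sup>2) \<partial>\<mu>) = (\<integral>\<^sup>+x. ennreal ((norm x)\<^sup>2) \<partial>distr ?P \<mu> (\<lambda>f. f j))"
        by (subst distr_PiM_component) (auto intro: \<mu>.prob_space_axioms)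
      also have "\<dots> = (\<integral>\<^sup>+f. ennreal ((norm (f j))\<^sup>2) \<partial>?P)"
        by (subst nn_integral_distr) auto
      finally show "(\<integral>\<^sup>+f. ennreal ((norm (f j))\<^sup>2) \<partial>?P) = (\<integral>\<^sup>+x. ennreal ((norm x)\<^sup>2) \<partial>\<mu>)" by simp
    qed
    also have "\<dots> < \<infinity>" using P2D(5)[OF assms] by (simp add: ennreal_mult_less_top ennreal_of_nat_eq_real_of_nat)
    finally show "(\<integral>\<^sup>+f. ennreal ((norm (\<chi> j. f j :: real^'d^'n))\<^sup>2) \<partial>?P) < \<infinity>" .
  qed
qed

section \<open>Dissipativity of the tamed drift\<close>

text \<open>Here \<open>a = |x|\<^sup>q\<close>, \<open>c = |y|\<^sup>q\<close> and \<open>h\<close> is the square root of the step size. As \<open>h \<le> 1/2\<close>, the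
  dissipative terms exceed \<open>K D\<close>, with \<open>D\<close> the product of the taming denominators, by a multiple
  of \<open>a + c + h a c\<close>; this excess absorbs the growth terms that are not small compared with \<open>D\<^sup>2\<close>.\<close>

lemma tamed_scalar_bound:
  fixes a c h K L0 L1 L2 L3 L4 l :: real
  assumes ac: "0 \<le> a" "0 \<le> c" and h: "0 < h" "h \<le> 1/2"
    and L: "0 < L0" "0 < L4" and K: "0 < l" "l \<le> K / 2" "K \<le> L1" "K \<le> 2 * L3"
    and hL2: "2 * h * L2 \<le> L1" and hl: "h * (8 * (3 * L0 + 4 * L4)) \<le> l"
  shows "2 * (- L1 * (1 + a + c) + h * (L2 * (1 + a + c) - L3 * a * c)) / ((1 + h * a) * (1 + h * c))
     + 4 * h\<^sup>2 * (L0 * (1 + a\<^sup>2 + c\<^sup>2) + h\<^sup>2 * L4 * (1 + a\<^sup>2 + c\<^sup>2 + a\<^sup>2 * c\<^sup>2)) / ((1 + h * a) * (1 + h * c))\<^sup>2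
     \<le> l - K"
proof -
  define D where "D = (1 + h * a) * (1 + h * c)"
  have D: "D = 1 + h * a + h * c + h * h * (a * c)" by (simp add: D_def algebra_simps)
  have hpos: "0 \<le> h" using h by simp
  have nn: "0 \<le> h * a" "0 \<le> h * c" "0 \<le> a * c" "0 \<le> h * h * (a * c)" "0 \<le> h * (a * c)"
    using ac h by simp_all
  have D1: "1 \<le> D" "h * a \<le> D" "h * c \<le> D" "h * h * (a * c) \<le> D"
    using nn by (auto simp: D)
  have D0: "0 < D" using D1 by simp
  have Kpos: "0 < K" using K by simp
  have i1: "2 * h * L2 * (1 + a + c) \<le> L1 * (1 + a + c)"
    using ac hL2 by (intro mult_right_mono) auto
  have i2: "K * (1 + a + c) \<le> L1 * (1 + a + c)" using ac K by (intro mult_right_mono) auto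
  have i3: "K * (h * (a * c)) \<le> 2 * L3 * (h * (a * c))" using nn K by (intro mult_right_mono) auto
  define W where "W = a + c + h * (a * c)"
  have W0: "0 \<le> W" using ac nn by (simp add: W_def)
  \<comment> \<open>Each term of \<open>D - 1\<close> carries one factor \<open>h\<close> more than
    its counterpart in \<open>W\<close>, so \<open>h \<le> 1/2\<close> gives
    \<open>D - 1 \<le> W / 2\<close>.\<close>
  have e1: "h * a \<le> 1/2 * a" "h * c \<le> 1/2 * c" "h * h * (a * c) \<le> 1/2 * (h * (a * c))"
    using mult_right_mono[OF h(2) ac(1)] mult_right_mono[OF h(2) ac(2)] mult_right_mono[OF h(2) nn(5)] by (simp_all add: mult.assoc)
  have "h * a + h * c + h * h * (a * c) \<le> 1/2 * a + 1/2 * c + 1/2 * (h * (a * c))"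
    by (intro add_mono e1)
  also have "\<dots> = W / 2" by (simp add: W_def)
  finally have DW: "D + W / 2 \<le> 1 + W" unfolding D by linarith
  have "K * (D + W / 2) \<le> K * (1 + W)" using DW Kpos by (intro mult_left_mono) auto
  then have A: "2 * (- L1 * (1 + a + c) + h * (L2 * (1 + a + c) - L3 * a * c)) \<le> - K * D - K * W / 2"
    using i1 i2 i3 by (simp add: W_def algebra_simps)
  have hL: "4 * h * (L0 + L4) \<le> l" "4 * h * L4 \<le> l"
    using hl mult_nonneg_nonneg[OF hpos, of L0] mult_nonneg_nonneg[OF hpos, of L4] L by (simp_all add: algebra_simps)
  have hh1: "h * h \<le> h" using h mult_left_mono[of h 1 h] by simp
  then have hh: "h * h \<le> 1" using h by linarith
  define p where "p = 4 * h * (L0 + L4)"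
  have p: "0 \<le> p" "p \<le> l" "p \<le> K / 2" using hL L h K by (auto simp: p_def)
  have q: "4 * h * (L0 + h\<^sup>2 * L4) \<le> p"
  proof -
    have "h\<^sup>2 * L4 \<le> 1 * L4" using hh L by (intro mult_right_mono) (auto simp: power2_eq_square)
    then show ?thesis using hpos unfolding p_def by (intro mult_left_mono) auto
  qed
  \<comment> \<open>Each quadratic term is written as a factor bounded by \<open>D\<close>, namely
    \<open>h * a\<close>, \<open>h * c\<close> or \<open>h * h * (a * c)\<close>, times a term of
    \<open>W\<close>. The constant 1 has no such factor; its share \<open>p * h\<close> is charged
    to \<open>l * D\<^sup>2\<close>.\<close>
  have "4 * h\<^sup>2 * (L0 * (1 + a\<^sup>2 + c\<^sup>2) + h\<^sup>2 * L4 * (1 + a\<^sup>2 + c\<^sup>2 + a\<^sup>2 * c\<^sup>2))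
     = 4 * h * (L0 + h\<^sup>2 * L4) * (h + (h * a) * a + (h * c) * c) + 4 * h * L4 * ((h * h * (a * c)) * (h * (a * c)))"
    by (simp add: power2_eq_square algebra_simps)
  also have "\<dots> \<le> p * (h + (h * a) * a + (h * c) * c) + 4 * h * L4 * ((h * h * (a * c)) * (h * (a * c)))"
    using q nn ac h by (intro add_right_mono mult_right_mono) auto
  also have "\<dots> \<le> p * (h + D * a + D * c) + 4 * h * L4 * (D * (h * (a * c)))"
    using p D1 nn ac L hpos by (intro add_mono mult_left_mono mult_right_mono) auto
  also have "\<dots> \<le> p * h + K / 2 * (D * a + D * c) + K / 2 * (D * (h * (a * c)))"
  proof -
    have "p * (D * a + D * c) \<le> K / 2 * (D * a + D * c)" using p D0 ac by (intro mult_right_mono) auto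
    moreover have "4 * h * L4 * (D * (h * (a * c))) \<le> K / 2 * (D * (h * (a * c)))"
      using hL K D0 nn by (intro mult_right_mono) auto
    ultimately show ?thesis by (simp add: algebra_simps)
  qed
  also have "p * h \<le> l * D\<^sup>2"
  proof -
    have "p * h \<le> l * 1" using p h K by (intro mult_mono) auto
    also have "\<dots> \<le> l * D\<^sup>2" using D1(1) K by (intro mult_left_mono) (auto simp: one_le_power)
    finally show ?thesis .
  qed
  finally have B: "4 * h\<^sup>2 * (L0 * (1 + a\<^sup>2 + c\<^sup>2) + h\<^sup>2 * L4 * (1 + a\<^sup>2 + c\<^sup>2 + a\<^sup>2 * c\<^sup>2)) \<le> l * D\<^sup>2 + K / 2 * W * D"
    by (simp add: W_def algebra_simps)
  have "2 * (- L1 * (1 + a + c) + h * (L2 * (1 + a + c) - L3 * a * c)) / D \<le> (- K * D - K * W / 2) / D"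
    using A D0 by (intro divide_right_mono) auto
  moreover have "4 * h\<^sup>2 * (L0 * (1 + a\<^sup>2 + c\<^sup>2) + h\<^sup>2 * L4 * (1 + a\<^sup>2 + c\<^sup>2 + a\<^sup>2 * c\<^sup>2)) / D\<^sup>2 \<le> (l * D\<^sup>2 + K / 2 * W * D) / D\<^sup>2"
    using B by (intro divide_right_mono) auto
  moreover have "(- K * D - K * W / 2) / D + (l * D\<^sup>2 + K / 2 * W * D) / D\<^sup>2 = l - K"
    using D0 by (simp add: field_simps power2_eq_square)
  ultimately show ?thesis unfolding D_def[symmetric] by linarith
qed

text \<open>Over the common denominator \<open>(1 + h * a) * (1 + h * c)\<close> the numerator
  becomes \<open>(b - b') + h *\<^sub>R (c *\<^sub>R b - a *\<^sub>R b')\<close>; its second part is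
  what the cross conditions on \<open>b1\<close> control. As \<open>h\<^sup>2\<close> is the step
  size, the term with \<open>2 * h\<^sup>2\<close> accounts for the squared drift increment per unit
  of time, with a factor 2 from separating off \<open>b2\<close>.\<close>

lemma tamed_drift_dissipative:
  fixes x y b b' :: "'a::euclidean_space" and a c h K L0 L1 L2 L3 L4 l :: real
  assumes ac: "0 \<le> a" "0 \<le> c" and h: "0 < h" "h \<le> 1/2"
    and L: "0 < L0" "0 < L4" and K: "0 < l" "l \<le> K / 2" "K \<le> L1" "K \<le> 2 * L3"
    and hL2: "2 * h * L2 \<le> L1" and hl: "h * (8 * (3 * L0 + 4 * L4)) \<le> l"
    and b0: "(norm (b - b'))\<^sup>2 \<le> L0 * (1 + a\<^sup>2 + c\<^sup>2) * (norm (x - y))\<^sup>2"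
    and b1: "(x - y) \<bullet> (b - b') \<le> - L1 * (1 + a + c) * (norm (x - y))\<^sup>2"
    and b2: "(x - y) \<bullet> (c *\<^sub>R b - a *\<^sub>R b') \<le> (L2 * (1 + a + c) - L3 * a * c) * (norm (x - y))\<^sup>2"
    and b3: "(norm (c *\<^sub>R b - a *\<^sub>R b'))\<^sup>2 \<le> L4 * (1 + a\<^sup>2 + c\<^sup>2 + a\<^sup>2 * c\<^sup>2) * (norm (x - y))\<^sup>2"
  shows "2 * ((x - y) \<bullet> (b /\<^sub>R (1 + h * a) - b' /\<^sub>R (1 + h * c)))
     + 2 * h\<^sup>2 * (norm (b /\<^sub>R (1 + h * a) - b' /\<^sub>R (1 + h * c)))\<^sup>2 \<le> (l - K) * (norm (x - y))\<^sup>2"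
proof -
  define A C D n where "A = 1 + h * a" and "C = 1 + h * c" and "D = A * C" and "n = (norm (x - y))\<^sup>2"
  have pos: "A > 0" "C > 0" "D > 0" using ac h by (simp_all add: A_def C_def D_def add_pos_nonneg)
  have n0: "0 \<le> n" by (simp add: n_def)
  define v where "v = b /\<^sub>R A - b' /\<^sub>R C"
  have v: "v = ((b - b') + h *\<^sub>R (c *\<^sub>R b - a *\<^sub>R b')) /\<^sub>R D"
  proof -
    have "D *\<^sub>R v = C *\<^sub>R b - A *\<^sub>R b'"
      using pos by (simp add: v_def D_def algebra_simps)
    also have "\<dots> = (b - b') + h *\<^sub>R (c *\<^sub>R b - a *\<^sub>R b')" by (simp add: A_def C_def algebra_simps)
    finally have "D *\<^sub>R v = (b - b') + h *\<^sub>R (c *\<^sub>R b - a *\<^sub>R b')" .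
    moreover have "v = (D *\<^sub>R v) /\<^sub>R D" using pos by simp
    ultimately show ?thesis by simp
  qed
  have "(x - y) \<bullet> v = ((x - y) \<bullet> (b - b') + h * ((x - y) \<bullet> (c *\<^sub>R b - a *\<^sub>R b'))) / D"
    unfolding v by (simp add: inner_add_right divide_inverse_commute)
  also have "\<dots> \<le> ((- L1 * (1 + a + c)) * n + h * ((L2 * (1 + a + c) - L3 * a * c) * n)) / D"
    using b1 b2 h pos unfolding n_def by (intro divide_right_mono add_mono mult_left_mono) auto
  finally have 1: "(x - y) \<bullet> v \<le> (- L1 * (1 + a + c) + h * (L2 * (1 + a + c) - L3 * a * c)) / D * n"
    by (simp add: algebra_simps add_divide_distrib diff_divide_distrib)
  have "(norm v)\<^sup>2 = (norm ((b - b') + h *\<^sub>R (c *\<^sub>R b - a *\<^sub>R b')))\<^sup>2 / D\<^sup>2"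
    unfolding v using pos by (simp add: power_mult_distrib power_inverse divide_inverse_commute)
  also have "\<dots> \<le> (2 * (norm (b - b'))\<^sup>2 + 2 * (norm (h *\<^sub>R (c *\<^sub>R b - a *\<^sub>R b')))\<^sup>2) / D\<^sup>2"
    by (intro divide_right_mono norm_add_sq_le) auto
  also have "\<dots> = (2 * (norm (b - b'))\<^sup>2 + 2 * (h\<^sup>2 * (norm (c *\<^sub>R b - a *\<^sub>R b'))\<^sup>2)) / D\<^sup>2"
    by (simp add: power_mult_distrib)
  also have "\<dots> \<le> (2 * (L0 * (1 + a\<^sup>2 + c\<^sup>2) * n) + 2 * (h\<^sup>2 * (L4 * (1 + a\<^sup>2 + c\<^sup>2 + a\<^sup>2 * c\<^sup>2) * n))) / D\<^sup>2"
    using b0 b3 unfolding n_def by (intro divide_right_mono add_mono mult_left_mono) auto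
  finally have 2: "(norm v)\<^sup>2 \<le> 2 * (L0 * (1 + a\<^sup>2 + c\<^sup>2) + h\<^sup>2 * L4 * (1 + a\<^sup>2 + c\<^sup>2 + a\<^sup>2 * c\<^sup>2)) / D\<^sup>2 * n"
    by (simp add: algebra_simps add_divide_distrib)
  have "2 * ((x - y) \<bullet> v) + 2 * h\<^sup>2 * (norm v)\<^sup>2
      \<le> 2 * ((- L1 * (1 + a + c) + h * (L2 * (1 + a + c) - L3 * a * c)) / D * n)
       + 2 * h\<^sup>2 * (2 * (L0 * (1 + a\<^sup>2 + c\<^sup>2) + h\<^sup>2 * L4 * (1 + a\<^sup>2 + c\<^sup>2 + a\<^sup>2 * c\<^sup>2)) / D\<^sup>2 * n)"
    using 1 2 h by (intro add_mono mult_left_mono) auto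
  also have "\<dots> = (2 * (- L1 * (1 + a + c) + h * (L2 * (1 + a + c) - L3 * a * c)) / D
       + 4 * h\<^sup>2 * (L0 * (1 + a\<^sup>2 + c\<^sup>2) + h\<^sup>2 * L4 * (1 + a\<^sup>2 + c\<^sup>2 + a\<^sup>2 * c\<^sup>2)) / D\<^sup>2) * n"
    by (simp only: ring_distribs times_divide_eq_left times_divide_eq_right) (simp add: ac_simps)
  also have "\<dots> \<le> (l - K) * n"
    unfolding D_def A_def C_def
    by (intro mult_right_mono tamed_scalar_bound n0) (use assms in auto)
  finally show ?thesis unfolding v_def A_def C_def n_def .
qed

section \<open>Noise on the windows of the time grid\<close>

text \<open>The integrands of the scheme do not depend on time within a window, so only the marks of
  the jumps matter: restrict \<open>m\<close> to the times in \<open>A\<close> and project to the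
  marks.\<close>

definition window :: "'z measure \<Rightarrow> real set \<Rightarrow> (real \<times> 'z) measure \<Rightarrow> 'z measure" where
  "window \<nu> A m = distr (density m (indicator (A \<times> space \<nu>))) \<nu> snd"

lemma sets_window [simp]: "sets (window \<nu> A m) = sets \<nu>"
  by (simp add: window_def)

lemma space_window [simp]: "space (window \<nu> A m) = space \<nu>"
  by (simp add: window_def)

lemma space_intensity [simp]: "space (intensity \<nu>) = {0..} \<times> space \<nu>"
  by (simp add: intensity_def space_pair_measure)

lemma Times_in_sets_intensity:
  assumes "A \<in> sets borel" "A \<subseteq> {0..}" "C \<in> sets \<nu>"
  shows "A \<times> C \<in> sets (intensity \<nu>)"
  unfolding intensity_def using assms
  by (intro pair_measureI) (auto simp: sets_restrict_space_iff)

lemma snd_measurable_intensity: "snd \<in> measurable (intensity \<nu>) \<nu>"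
  by (simp add: intensity_def)

lemma emeasure_window:
  assumes m: "sets m = sets (intensity \<nu>)" and A: "A \<in> sets borel" "A \<subseteq> {0..}" and C: "C \<in> sets \<nu>"
  shows "emeasure (window \<nu> A m) C = emeasure m (A \<times> C)"
proof -
  have sm: "space m = {0..} \<times> space \<nu>" using sets_eq_imp_space_eq[OF m] by simp
  have snd: "snd \<in> measurable m \<nu>" using snd_measurable_intensity by (simp add: measurable_cong_sets[OF m refl])
  have AC: "A \<times> C \<in> sets m" "A \<times> space \<nu> \<in> sets m" using Times_in_sets_intensity A C m by auto
  have pre: "snd -` C \<inter> space m \<in> sets m" using snd C by (rule measurable_sets)
  have "emeasure (window \<nu> A m) C = emeasure (density m (indicator (A \<times> space \<nu>))) (snd -` C \<inter> space m)"
    unfolding window_def using snd C by (subst emeasure_distr) auto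
  also have "\<dots> = (\<integral>\<^sup>+p. indicator (A \<times> space \<nu>) p * indicator (snd -` C \<inter> space m) p \<partial>m)"
    using pre AC by (subst emeasure_density) auto
  also have "\<dots> = (\<integral>\<^sup>+p. indicator (A \<times> C) p \<partial>m)"
    using sets.sets_into_space[OF C] sm by (intro nn_integral_cong) (auto simp: indicator_def)
  also have "\<dots> = emeasure m (A \<times> C)" using AC by simp
  finally show ?thesis .
qed

lemma integral_window:
  fixes f :: "'z \<Rightarrow> 'b::euclidean_space"
  assumes m: "sets m = sets (intensity \<nu>)" and A: "A \<in> sets borel" "A \<subseteq> {0..}" and f: "f \<in> borel_measurable \<nu>"
  shows "(LINT p:A \<times> space \<nu>|m. f (snd p)) = (\<integral>z. f z \<partial>window \<nu> A m)"
proof -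
  have snd: "snd \<in> measurable m \<nu>" using snd_measurable_intensity by (simp add: measurable_cong_sets[OF m refl])
  have AC: "A \<times> space \<nu> \<in> sets m" using Times_in_sets_intensity A m by auto
  have e: "(indicator (A \<times> space \<nu>) :: _ \<Rightarrow> ennreal) = (\<lambda>p. ennreal (indicator (A \<times> space \<nu>) p))"
    by (auto simp: indicator_def)
  have "(\<integral>z. f z \<partial>window \<nu> A m) = (\<integral>p. f (snd p) \<partial>density m (indicator (A \<times> space \<nu>)))"
    unfolding window_def using snd f by (subst integral_distr) auto
  also have "\<dots> = (\<integral>p. indicator (A \<times> space \<nu>) p *\<^sub>R f (snd p) \<partial>m)"
    unfolding e using snd f AC by (subst integral_density) auto
  finally show ?thesis by (simp add: set_lebesgue_integral_def)
qed

lemma emeasure_intensity_Times: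
  assumes "finite_measure \<nu>" and A: "A \<in> sets borel" "A \<subseteq> {0..}" and C: "C \<in> sets \<nu>"
  shows "emeasure (intensity \<nu>) (A \<times> C) = emeasure lborel A * emeasure \<nu> C"
proof -
  interpret \<nu>: finite_measure \<nu> by fact
  have "A \<in> sets (restrict_space lborel {0..})" using A by (auto simp: sets_restrict_space_iff)
  then show ?thesis
    unfolding intensity_def using A C
    by (simp add: \<nu>.emeasure_pair_measure_Times emeasure_restrict_space)
qed

text \<open>Independence between sources \<open>s\<close> and independence over times
  \<open>k\<close> within each source combine. Given finitely many events, intersect those of one
  source first: the intersection lies in the sigma-algebra of that source, so the sources factorize,
  and each factor then splits over time.\<close>

lemma (in prob_space) indep_sets_grouped:
  fixes E :: "'k \<times> 's::finite \<Rightarrow> 'a set set"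
  assumes F: "indep_sets F UNIV" "\<And>s. sigma_algebra (space M) (F s)"
    and E: "\<And>k s. E (k, s) \<subseteq> F s" "\<And>s. indep_sets (\<lambda>k. E (k, s)) UNIV"
  shows "indep_sets E UNIV"
proof (rule indep_setsI)
  show "E e \<subseteq> events" for e
    using E(2)[of "snd e"] by (cases e) (auto simp: indep_sets_def)
  fix A J assume J: "J \<noteq> {}" "finite J" "\<forall>e\<in>J. A e \<in> E e"
  define K where "K s = {k. (k, s) \<in> J}" for s
  have K: "finite (K s)" for s
    unfolding K_def using finite_imageI[OF J(2), of fst] by (rule rev_finite_subset) force
  \<comment> \<open>Intersecting with \<open>space M\<close> covers the sources without an event in
    \<open>J\<close>, where the empty intersection would be \<open>UNIV\<close>.\<close>
  define G where "G s = space M \<inter> (\<Inter>k\<in>K s. A (k, s))" for s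
  have AF: "A (k, s) \<in> F s" if "k \<in> K s" for k s using that J(3) E(1) by (auto simp: K_def)
  have As: "A e \<subseteq> space M" if "e \<in> J" for e
    using that J(3) AF[of "fst e" "snd e"] sigma_algebra.axioms(1)[OF F(2)[of "snd e"]]
    by (cases e) (auto simp: K_def algebra_def ring_of_sets_def semiring_of_sets_def subset_class_def)
  have GF: "G s \<in> F s" for s
  proof (cases "K s = {}")
    case True
    then show ?thesis using sigma_algebra.axioms(1)[OF F(2)[of s]] by (simp add: G_def algebra.top)
  next
    case False
    interpret sigma_algebra "space M" "F s" by (rule F)
    have "(\<Inter>k\<in>K s. A (k, s)) \<in> F s" using False K AF by (intro finite_INT) auto
    then show ?thesis unfolding G_def by (intro Int) auto
  qed
  have prG: "prob (G s) = (\<Prod>k\<in>K s. prob (A (k, s)))" for s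
  proof (cases "K s = {}")
    case True then show ?thesis by (simp add: G_def prob_space)
  next
    case False
    have "G s = (\<Inter>k\<in>K s. A (k, s))" using False As by (auto simp: G_def K_def)
    then show ?thesis
      using indep_setsD[OF E(2)[of s], of "K s" "\<lambda>k. A (k, s)"] False K J(3) by (auto simp: K_def)
  qed
  have "(\<Inter>e\<in>J. A e) = (\<Inter>s\<in>UNIV. G s)"
  proof -
    obtain e where "e \<in> J" using J(1) by auto
    then have "(\<Inter>e\<in>J. A e) \<subseteq> space M" using As[of e] by blast
    then show ?thesis by (auto simp: G_def K_def)
  qed
  then have "prob (\<Inter>e\<in>J. A e) = (\<Prod>s\<in>UNIV. prob (G s))"
    using indep_setsD[OF F(1), of UNIV G] GF by simp
  also have "\<dots> = (\<Prod>(s, k)\<in>Sigma UNIV K. prob (A (k, s)))"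
    unfolding prG using K by (simp add: prod.Sigma)
  also have "\<dots> = (\<Prod>e\<in>J. prob (A e))"
    by (rule prod.reindex_bij_witness[of _ "\<lambda>(k, s). (s, k)" "\<lambda>(s, k). (k, s)"]) (auto simp: K_def)
  finally show "prob (\<Inter>e\<in>J. A e) = (\<Prod>e\<in>J. prob (A e))" .
qed

locale particle_noise_steps =
  fixes M :: "'w measure" and \<nu> :: "'z measure"
    and B :: "'n::finite \<Rightarrow> real \<Rightarrow> 'w \<Rightarrow> real^'m" and N :: "'n \<Rightarrow> 'w \<Rightarrow> (real \<times> 'z) measure" and \<Delta> :: real
  assumes finite_nu: "finite_measure \<nu>" and noise: "particle_noise M \<nu> B N" and Delta_pos: "0 < \<Delta>"
begin

sublocale prob_space M using noise by (simp add: particle_noise_def)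

sublocale \<nu>: finite_measure \<nu> by (rule finite_nu)

lemma brownian: "std_brownian_motion M (B i)" and poisson_N: "poisson_random_measure M \<nu> (N i)"
  and indep_noise: "indep_sets (case_sum (\<lambda>i. process_sigma M (B i)) (\<lambda>i. random_measure_sigma M \<nu> (N i))) UNIV"
  using noise by (auto simp: particle_noise_def)

text \<open>Half-open as in the scheme, which makes different windows disjoint.\<close>

definition win :: "nat \<Rightarrow> real set" where
  "win k = {real k * \<Delta> <.. real (Suc k) * \<Delta>}"

definition dB :: "'n \<Rightarrow> nat \<Rightarrow> 'w \<Rightarrow> real^'m" where
  "dB i k w = B i (real (Suc k) * \<Delta>) w - B i (real k * \<Delta>) w"

definition jump :: "'n \<Rightarrow> nat \<Rightarrow> 'w \<Rightarrow> 'z measure" where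
  "jump i k w = window \<nu> (win k) (N i w)"

text \<open>Window 0 stands for all of them, as the windows have equal length; see
  \<open>window_intensity\<close>.\<close>

definition Lam :: "'z measure" where
  "Lam = window \<nu> (win 0) (intensity \<nu>)"

lemma win_borel: "win k \<in> sets borel" by (simp add: win_def)

lemma win_nonneg: "win k \<subseteq> {0..}"
proof
  fix x assume "x \<in> win k"
  moreover have "0 \<le> real k * \<Delta>" using Delta_pos by simp
  ultimately show "x \<in> {0..}" unfolding win_def by simp
qed

lemma win_disjoint:
  assumes "j \<noteq> k" shows "win j \<inter> win k = {}"
proof -
  have "win j \<inter> win k = {}" if "j < k" for j k
  proof -
    have "real (Suc j) * \<Delta> \<le> real k * \<Delta>" using that Delta_pos by (intro mult_right_mono) auto
    then show ?thesis by (auto simp: win_def)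
  qed
  from this[of j k] this[of k j] show ?thesis using assms by (auto simp: neq_iff)
qed

lemma win_length: "emeasure lborel (win k) = ennreal \<Delta>"
  using Delta_pos by (simp add: win_def algebra_simps)

lemma sets_N: "w \<in> space M \<Longrightarrow> sets (N i w) = sets (intensity \<nu>)"
  using poisson_N[of i] by (auto simp: poisson_random_measure_def)

lemma sets_jump [simp]: "sets (jump i k w) = sets \<nu>" and space_jump [simp]: "space (jump i k w) = space \<nu>"
  by (simp_all add: jump_def)

lemma sets_Lam [simp]: "sets Lam = sets \<nu>" and space_Lam [simp]: "space Lam = space \<nu>"
  by (simp_all add: Lam_def)

lemma win_Times: "C \<in> sets \<nu> \<Longrightarrow> win k \<times> C \<in> sets (intensity \<nu>)"
  by (rule Times_in_sets_intensity[OF win_borel win_nonneg])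

lemma emeasure_jump: "w \<in> space M \<Longrightarrow> C \<in> sets \<nu> \<Longrightarrow> emeasure (jump i k w) C = emeasure (N i w) (win k \<times> C)"
  unfolding jump_def by (rule emeasure_window[OF sets_N win_borel win_nonneg])

lemma emeasure_intensity_win: "C \<in> sets \<nu> \<Longrightarrow> emeasure (intensity \<nu>) (win k \<times> C) = ennreal \<Delta> * emeasure \<nu> C"
  by (simp add: emeasure_intensity_Times[OF finite_nu win_borel win_nonneg] win_length)

lemma window_intensity: "window \<nu> (win k) (intensity \<nu>) = Lam"
  unfolding Lam_def
  by (rule measure_eqI) (auto simp: emeasure_window[OF refl win_borel win_nonneg] emeasure_intensity_win)

lemma emeasure_Lam: "C \<in> sets \<nu> \<Longrightarrow> emeasure Lam C = ennreal \<Delta> * emeasure \<nu> C"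
  unfolding Lam_def by (simp add: emeasure_window[OF refl win_borel win_nonneg] emeasure_intensity_win)

lemma Lam_eq_scale: "Lam = scale_measure (ennreal \<Delta>) \<nu>"
  by (rule measure_eqI) (auto simp: emeasure_Lam)

lemma nn_integral_Lam: "f \<in> borel_measurable \<nu> \<Longrightarrow> (\<integral>\<^sup>+z. f z \<partial>Lam) = ennreal \<Delta> * (\<integral>\<^sup>+z. f z \<partial>\<nu>)"
  unfolding Lam_eq_scale by (rule nn_integral_scale_measure)

lemma measurable_Lam: "measurable Lam X = measurable \<nu> X"
  by (rule measurable_cong_sets) auto

lemma compensated_integral_eq:
  fixes f :: "'z \<Rightarrow> real^'d"
  assumes "f \<in> borel_measurable \<nu>" "w \<in> space M"
  shows "compensated_integral \<nu> (N i w) ({real k * \<Delta> <.. real (Suc k) * \<Delta>} \<times> space \<nu>) (\<lambda>(s, z). f z)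
    = (\<integral>z. f z \<partial>jump i k w) - (\<integral>z. f z \<partial>Lam)"
  unfolding compensated_integral_def win_def[symmetric] jump_def window_intensity[of k, symmetric]
  using assms by (simp add: integral_window[OF _ win_borel win_nonneg, symmetric] sets_N case_prod_unfold)

lemma N_measurable: "C \<in> sets (intensity \<nu>) \<Longrightarrow> (\<lambda>w. emeasure (N i w) C) \<in> borel_measurable M"
  using poisson_N[of i] by (auto simp: poisson_random_measure_def)

lemma finite_jump: 
  assumes w: "w \<in> space M" shows "emeasure (jump i k w) (space \<nu>) < \<infinity>"
proof -
  let ?t = "real (Suc k) * \<Delta>"
  have "emeasure (jump i k w) (space \<nu>) = emeasure (N i w) (win k \<times> space \<nu>)"
    using w by (simp add: emeasure_jump)
  also have "\<dots> \<le> emeasure (N i w) ({0..?t} \<times> space \<nu>)"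
  proof (rule emeasure_mono)
    show "win k \<times> space \<nu> \<subseteq> {0..?t} \<times> space \<nu>" using win_nonneg[of k] by (auto simp: win_def)
    show "{0..?t} \<times> space \<nu> \<in> sets (N i w)"
      using Times_in_sets_intensity[of "{0..?t}" "space \<nu>" \<nu>] w by (auto simp: sets_N)
  qed
  also have "\<dots> < \<infinity>"
    using poisson_N[of i, unfolded poisson_random_measure_def, THEN conjunct1] w Delta_pos by simp
  finally show ?thesis .
qed

text \<open>The count of \<open>jump i k\<close> on \<open>C\<close> is the count of
  \<open>N i\<close> on \<open>win k \<times> C\<close>, so the Poisson properties are
  inherited.\<close>

lemma finite_poisson_jump: "finite_poisson_measure M (jump i k) Lam"
proof -
  have P: "emeasure (N i w) C \<in> range ennreal_of_enat" if "w \<in> space M" "C \<in> sets (intensity \<nu>)" for w C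
  proof -
    have "\<forall>C\<in>sets (intensity \<nu>). emeasure (N i w) C \<in> range ennreal_of_enat"
      using poisson_N[of i, unfolded poisson_random_measure_def, THEN conjunct1] that(1) by blast
    then show ?thesis using that(2) by (rule bspec)
  qed
  have P2: "measure M {w \<in> space M. emeasure (N i w) A = of_nat j} = exp (- measure (intensity \<nu>) A) * measure (intensity \<nu>) A ^ j / fact j"
    if "A \<in> sets (intensity \<nu>)" "emeasure (intensity \<nu>) A < \<infinity>" for A j
    using poisson_N[of i, unfolded poisson_random_measure_def, THEN conjunct2, THEN conjunct2, THEN conjunct1] that by simp
  have P3: "indep_vars (\<lambda>_. borel) (\<lambda>j w. emeasure (N i w) (A j)) UNIV"
    if "range A \<subseteq> sets (intensity \<nu>)" "disjoint_family A" for A :: "nat \<Rightarrow> _"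
    using poisson_N[of i, unfolded poisson_random_measure_def, THEN conjunct2, THEN conjunct2, THEN conjunct2] that by simp
  show ?thesis
  proof (intro finite_poisson_measure.intro finite_poisson_measure_axioms.intro prob_space_axioms)
    show "finite_measure Lam"
      using \<nu>.emeasure_finite[of "space \<nu>"]
      by (intro finite_measureI) (simp add: emeasure_Lam ennreal_mult_eq_top_iff)
    show "sets (jump i k w) = sets Lam" for w by simp
    show "emeasure (jump i k w) (space Lam) < \<infinity>" if "w \<in> space M" for w
      using finite_jump[OF that] by simp
    show "emeasure (jump i k w) C \<in> range ennreal_of_enat" if "w \<in> space M" "C \<in> sets Lam" for w C
      using P that win_Times by (simp add: emeasure_jump)
    show "(\<lambda>w. emeasure (jump i k w) C) \<in> borel_measurable M" if "C \<in> sets Lam" for C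
      using that N_measurable[OF win_Times] by (simp add: emeasure_jump cong: measurable_cong)
    show "prob {w \<in> space M. emeasure (jump i k w) C = of_nat j} = exp (- measure Lam C) * measure Lam C ^ j / fact j"
      if C: "C \<in> sets Lam" for C j
    proof -
      have e: "emeasure (intensity \<nu>) (win k \<times> C) = emeasure Lam C"
        using C by (simp add: emeasure_Lam emeasure_intensity_win)
      have "{w \<in> space M. emeasure (jump i k w) C = of_nat j} = {w \<in> space M. emeasure (N i w) (win k \<times> C) = of_nat j}"
        using C by (auto simp: emeasure_jump)
      moreover have "emeasure (intensity \<nu>) (win k \<times> C) < \<infinity>"
        using C \<nu>.emeasure_finite[of C] by (simp add: emeasure_intensity_win ennreal_mult_eq_top_iff less_top[symmetric])
      ultimately show ?thesis
        using P2[OF win_Times, of C k j] C e by (simp add: measure_def)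
    qed
    show "indep_vars (\<lambda>_. borel) (\<lambda>j w. emeasure (jump i k w) (C j)) UNIV"
      if C: "range C \<subseteq> sets Lam" "disjoint_family C" for C :: "nat \<Rightarrow> _"
    proof -
      have C1: "C j \<in> sets \<nu>" for j using C(1) by auto
      have v: "(\<lambda>w. emeasure (jump i k w) (C j)) -` X \<inter> space M = (\<lambda>w. emeasure (N i w) (win k \<times> C j)) -` X \<inter> space M" for j X
        using C1 by (auto simp: emeasure_jump)
      have m: "(\<lambda>w. emeasure (jump i k w) (C j)) \<in> borel_measurable M" for j
        using C1 N_measurable[OF win_Times] by (simp add: emeasure_jump cong: measurable_cong)
      have "indep_vars (\<lambda>_. borel) (\<lambda>j w. emeasure (N i w) (win k \<times> C j)) UNIV"
        using C C1 by (intro P3) (auto simp: win_Times disjoint_family_on_def)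
      then show ?thesis
        using C1 v m unfolding indep_vars_def2 by simp
    qed
  qed
qed

end

section \<open>Independence of the noise on different windows\<close>

context particle_noise_steps begin

text \<open>Preimages under one increment already form a sigma-algebra. Events on single counts are
  not stable under intersection, hence the generated sigma-algebra in the Poisson case.\<close>

fun noise_events :: "nat \<times> ('n + 'n) \<Rightarrow> 'w set set" where
  "noise_events (k, Inl i) = {dB i k -` A \<inter> space M | A. A \<in> sets borel}"
| "noise_events (k, Inr i) = sigma_sets (space M)
     {(\<lambda>w. emeasure (N i w) (win k \<times> C)) -` A \<inter> space M | C A. C \<in> sets \<nu> \<and> A \<in> sets borel}"

abbreviation brownian_algebra :: "'n \<Rightarrow> 'w measure" where
  "brownian_algebra i \<equiv> sigma (space M) {B i t -` A \<inter> space M | t A. 0 \<le> t \<and> A \<in> sets borel}"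

abbreviation poisson_algebra :: "'n \<Rightarrow> 'w measure" where
  "poisson_algebra i \<equiv> sigma (space M)
     {(\<lambda>\<omega>. emeasure (N i \<omega>) C) -` A \<inter> space M | C A. C \<in> sets (intensity \<nu>) \<and> A \<in> sets borel}"

lemma sets_brownian_algebra: "sets (brownian_algebra i) = process_sigma M (B i)"
  unfolding process_sigma_def by (rule sets_measure_of) auto

lemma sets_poisson_algebra: "sets (poisson_algebra i) = random_measure_sigma M \<nu> (N i)"
  unfolding random_measure_sigma_def by (rule sets_measure_of) auto

lemma space_noise_algebras [simp]: "space (brownian_algebra i) = space M" "space (poisson_algebra i) = space M"
  by (auto intro!: space_measure_of)

lemma B_measurable: "0 \<le> t \<Longrightarrow> B i t \<in> borel_measurable (brownian_algebra i)"
  by (rule measurableI) (auto simp: sets_brownian_algebra process_sigma_def intro!: sigma_sets.Basic)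

lemma dB_measurable: "dB i k \<in> borel_measurable (brownian_algebra i)"
  unfolding dB_def[abs_def] using Delta_pos by (intro borel_measurable_diff B_measurable) auto

lemma N_measurable_algebra: "C \<in> sets (intensity \<nu>) \<Longrightarrow> (\<lambda>w. emeasure (N i w) C) \<in> borel_measurable (poisson_algebra i)"
  by (rule measurableI) (auto simp: sets_poisson_algebra random_measure_sigma_def intro!: sigma_sets.Basic)

lemma N_emeasure_union:
  assumes "w \<in> space M" "finite I" "\<And>c. c \<in> I \<Longrightarrow> C c \<in> sets \<nu>" "disjoint_family_on C I"
  shows "emeasure (N i w) (win k \<times> (\<Union>c\<in>I. C c)) = (\<Sum>c\<in>I. emeasure (N i w) (win k \<times> C c))"
proof -
  have "(\<Sum>c\<in>I. emeasure (N i w) (win k \<times> C c)) = emeasure (N i w) (\<Union>c\<in>I. win k \<times> C c)"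
    using assms by (intro sum_emeasure) (auto simp: sets_N win_Times disjoint_family_on_def)
  moreover have "win k \<times> (\<Union>c\<in>I. C c) = (\<Union>c\<in>I. win k \<times> C c)" by auto
  ultimately show ?thesis by simp
qed

lemma indep_dB: "indep_sets (\<lambda>k. noise_events (k, Inl i)) UNIV"
proof -
  have "mono (\<lambda>k. real k * \<Delta>)" using Delta_pos by (auto simp: mono_def intro: mult_right_mono)
  then have "indep_vars (\<lambda>_. borel) (\<lambda>k \<omega>. B i (real (Suc k) * \<Delta>) \<omega> - B i (real k * \<Delta>) \<omega>) UNIV"
    using brownian[of i, unfolded std_brownian_motion_def, THEN conjunct2, THEN conjunct2, THEN conjunct2, THEN conjunct1,
      rule_format, of "\<lambda>k. real k * \<Delta>"] by simp
  then show ?thesis unfolding indep_vars_def2 dB_def[abs_def, symmetric] by (simp add: dB_def[abs_def])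
qed

text \<open>Count events on finitely many sets are events on the counts of the atoms of the algebra they generate.\<close>

definition count_events :: "'n \<Rightarrow> nat \<Rightarrow> 'w set set" where
  "count_events i k = {{w \<in> space M. \<forall>C\<in>D. emeasure (N i w) (win k \<times> C) \<in> A C} | D A.
     finite D \<and> D \<subseteq> sets \<nu> \<and> (\<forall>C. A C \<in> sets borel)}"

lemma count_events_Int_stable: "Int_stable (count_events i k)"
proof (rule Int_stableI)
  fix a b assume "a \<in> count_events i k" "b \<in> count_events i k"
  then obtain D A D' A' where
    a: "a = {w \<in> space M. \<forall>C\<in>D. emeasure (N i w) (win k \<times> C) \<in> A C}" "finite D" "D \<subseteq> sets \<nu>" "\<And>C. A C \<in> sets borel" and
    b: "b = {w \<in> space M. \<forall>C\<in>D'. emeasure (N i w) (win k \<times> C) \<in> A' C}" "finite D'" "D' \<subseteq> sets \<nu>" "\<And>C. A' C \<in> sets borel"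
    by (auto simp: count_events_def)
  let ?A = "\<lambda>C. (if C \<in> D then A C else UNIV) \<inter> (if C \<in> D' then A' C else UNIV)"
  have "a \<inter> b = {w \<in> space M. \<forall>C\<in>D \<union> D'. emeasure (N i w) (win k \<times> C) \<in> ?A C}"
    using a(1) b(1) by auto
  moreover have "?A C \<in> sets borel" for C using a(4) b(4) by auto
  ultimately show "a \<inter> b \<in> count_events i k"
    unfolding count_events_def using a(2,3) b(2,3)
    by (intro CollectI exI[of _ "D \<union> D'"] exI[of _ ?A]) auto
qed

text \<open>Sets used in one window may overlap, whereas independence of counts is given for
  disjoint sets. All occurring sets are therefore cut into the atoms they generate. The counts on
  the products of a window and an atom are independent, they are grouped by window, and each count
  of interest is a sum over atoms in its own window.\<close>

lemma indep_count_events: "indep_sets (count_events i) UNIV"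
proof (rule indep_setsI)
  show "count_events i k \<subseteq> events" for k
  proof
    fix a assume "a \<in> count_events i k"
    then obtain D A where a: "a = {w \<in> space M. \<forall>C\<in>D. emeasure (N i w) (win k \<times> C) \<in> A C}" "finite D" "D \<subseteq> sets \<nu>" "\<And>C. A C \<in> sets borel"
      by (auto simp: count_events_def)
    show "a \<in> events" unfolding a(1)
    proof (rule sets.sets_Collect_finite_All[OF _ a(2)])
      fix C assume "C \<in> D"
      then have "(\<lambda>w. emeasure (N i w) (win k \<times> C)) \<in> borel_measurable M" using a(3) by (intro N_measurable win_Times) auto
      from measurable_sets[OF this a(4)[of C]] show "{w \<in> space M. emeasure (N i w) (win k \<times> C) \<in> A C} \<in> events"
        by (simp add: vimage_def Int_def conj_commute)
    qed
  qed
  fix E J assume J: "J \<noteq> {}" "J \<subseteq> UNIV" "finite J" "\<forall>j\<in>J. E j \<in> count_events i j"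
  have "\<forall>j\<in>J. \<exists>p. E j = {w \<in> space M. \<forall>C\<in>fst p. emeasure (N i w) (win j \<times> C) \<in> snd p C}
      \<and> finite (fst p) \<and> fst p \<subseteq> sets \<nu> \<and> (\<forall>C. snd p C \<in> sets borel)"
  proof
    fix j assume "j \<in> J"
    then have "E j \<in> count_events i j" using J(4) by blast
    then obtain D A where "E j = {w \<in> space M. \<forall>C\<in>D. emeasure (N i w) (win j \<times> C) \<in> A C}"
      "finite D" "D \<subseteq> sets \<nu>" "\<forall>C. A C \<in> sets borel" unfolding count_events_def by blast
    then show "\<exists>p. E j = {w \<in> space M. \<forall>C\<in>fst p. emeasure (N i w) (win j \<times> C) \<in> snd p C}
      \<and> finite (fst p) \<and> fst p \<subseteq> sets \<nu> \<and> (\<forall>C. snd p C \<in> sets borel)"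
      by (intro exI[of _ "(D, A)"]) simp
  qed
  from bchoice[OF this] obtain p where p: "\<forall>j\<in>J. E j = {w \<in> space M. \<forall>C\<in>fst (p j). emeasure (N i w) (win j \<times> C) \<in> snd (p j) C}
      \<and> finite (fst (p j)) \<and> fst (p j) \<subseteq> sets \<nu> \<and> (\<forall>C. snd (p j) C \<in> sets borel)" ..
  define D A where "D j = fst (p j)" and "A j = snd (p j)" for j
  have DA: "\<And>j. j \<in> J \<Longrightarrow> E j = {w \<in> space M. \<forall>C\<in>D j. emeasure (N i w) (win j \<times> C) \<in> A j C}"
    "\<And>j. j \<in> J \<Longrightarrow> finite (D j)" "\<And>j. j \<in> J \<Longrightarrow> D j \<subseteq> sets \<nu>" "\<And>j C. j \<in> J \<Longrightarrow> A j C \<in> sets borel"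
    unfolding D_def A_def using p by simp_all
  define DD where "DD = (\<Union>j\<in>J. D j)"
  have DD: "finite DD" "DD \<subseteq> sets \<nu>"
    unfolding DD_def using DA(2) J(3) by (simp, use DA(3) in blast)
  \<comment> \<open>\<open>T\<close> records which sets of \<open>DD\<close> contain the point, so
    different \<open>T \<subseteq> DD\<close> give disjoint atoms.\<close>
  define atom where "atom T = {z \<in> space \<nu>. \<forall>C\<in>DD. z \<in> C \<longleftrightarrow> C \<in> T}" for T
  have atom: "atom T \<in> sets \<nu>" for T
    unfolding atom_def
  proof (rule sets.sets_Collect_finite_All[OF _ DD(1)])
    fix C assume C: "C \<in> DD"
    then have "C \<in> sets \<nu>" "C \<subseteq> space \<nu>" using DD(2) sets.sets_into_space[of C \<nu>] by auto
    moreover have "{z \<in> space \<nu>. z \<in> C \<longleftrightarrow> C \<in> T} = (if C \<in> T then C else space \<nu> - C)"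
      using \<open>C \<subseteq> space \<nu>\<close> by auto
    ultimately show "{z \<in> space \<nu>. z \<in> C \<longleftrightarrow> C \<in> T} \<in> sets \<nu>" by auto
  qed
  obtain Ts where Ts: "set Ts = Pow DD" "distinct Ts" using finite_distinct_list[of "Pow DD"] DD(1) by auto
  \<comment> \<open>Independence of counts is stated for sequences, so the pairs of a window and an
    atom are numbered by \<open>prod_encode\<close>; surplus numbers receive the empty set.\<close>
  define S where "S m = (case prod_decode m of (j, c) \<Rightarrow> if c < length Ts then win j \<times> atom (Ts ! c) else {})" for m
  have S: "S m \<in> sets (intensity \<nu>)" for m
    by (auto simp: S_def win_Times atom split: prod.split)
  have "disjoint_family S"
  proof (unfold disjoint_family_on_def, intro ballI impI)
    fix m m' :: nat assume ne: "m \<noteq> m'"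
    obtain j c j' c' where d: "prod_decode m = (j, c)" "prod_decode m' = (j', c')" by (cases "prod_decode m"; cases "prod_decode m'") auto
    then have "(j, c) \<noteq> (j', c')" using ne by (metis prod_decode_inverse)
    show "S m \<inter> S m' = {}"
    proof (cases "j = j' \<and> c < length Ts \<and> c' < length Ts")
      case True
      then have "c \<noteq> c'" using \<open>(j, c) \<noteq> (j', c')\<close> by auto
      then have "Ts ! c \<noteq> Ts ! c'" using True Ts(2) by (simp add: nth_eq_iff_index_eq)
      moreover have "Ts ! c \<subseteq> DD" "Ts ! c' \<subseteq> DD" using Ts(1) True nth_mem by blast+
      ultimately have "atom (Ts ! c) \<inter> atom (Ts ! c') = {}" by (auto simp: atom_def)
      then show ?thesis using d True by (auto simp: S_def)
    next
      case False
      then show ?thesis using d win_disjoint[of j j'] by (auto simp: S_def)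
    qed
  qed
  then have ind: "indep_vars (\<lambda>_. borel) (\<lambda>m w. emeasure (N i w) (S m)) UNIV"
    using S poisson_N[of i, unfolded poisson_random_measure_def, THEN conjunct2, THEN conjunct2, THEN conjunct2] by auto
  \<comment> \<open>The numbers that belong to window \<open>j\<close>; these blocks are disjoint,
    so grouping by them preserves independence.\<close>
  define K where "K j = (\<lambda>c. prod_encode (j, c)) ` {..<length Ts}" for j :: nat
  have "indep_vars (\<lambda>j. PiM (K j) (\<lambda>_. borel)) (\<lambda>j w. restrict (\<lambda>m. emeasure (N i w) (S m)) (K j)) J"
    by (rule indep_vars_restrict[OF ind]) (auto simp: K_def disjoint_family_on_def)
  then have ind_sets: "indep_sets (\<lambda>j. {(\<lambda>w. restrict (\<lambda>m. emeasure (N i w) (S m)) (K j)) -` X \<inter> space M | X. X \<in> sets (PiM (K j) (\<lambda>_. borel))}) J"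
    unfolding indep_vars_def2 by simp
  have "E j \<in> {(\<lambda>w. restrict (\<lambda>m. emeasure (N i w) (S m)) (K j)) -` X \<inter> space M | X. X \<in> sets (PiM (K j) (\<lambda>_. borel))}" if j: "j \<in> J" for j
  proof -
    \<comment> \<open>The indices of the atoms that make up \<open>C\<close>.\<close>
    define I where "I C = {c. c < length Ts \<and> C \<in> Ts ! c}" for C
    define h where "h C v = (\<Sum>c\<in>I C. v (prod_encode (j, c)))" for C and v :: "nat \<Rightarrow> ennreal"
    have hm: "h C \<in> borel_measurable (PiM (K j) (\<lambda>_. borel))" for C
      unfolding h_def by (intro borel_measurable_sum measurable_component_singleton) (auto simp: K_def I_def)
    let ?X = "{v \<in> space (PiM (K j) (\<lambda>_. borel)). \<forall>C\<in>D j. h C v \<in> A j C}"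
    have X: "?X \<in> sets (PiM (K j) (\<lambda>_. borel))"
    proof (rule sets.sets_Collect_finite_All[OF _ DA(2)[OF j]])
      fix C
      from measurable_sets[OF hm DA(4)[OF j], of C C]
      show "{v \<in> space (PiM (K j) (\<lambda>_. borel)). h C v \<in> A j C} \<in> sets (PiM (K j) (\<lambda>_. borel))"
        by (simp add: vimage_def Int_def conj_commute)
    qed
    have hC: "h C (restrict (\<lambda>m. emeasure (N i w) (S m)) (K j)) = emeasure (N i w) (win j \<times> C)" if C: "C \<in> D j" and w: "w \<in> space M" for C w
    proof -
      have CD: "C \<in> DD" using C j by (auto simp: DD_def)
      then have Cs: "C \<subseteq> space \<nu>" using DD(2) sets.sets_into_space[of C \<nu>] by auto
      have "C = (\<Union>c\<in>I C. atom (Ts ! c))"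
      proof
        show "C \<subseteq> (\<Union>c\<in>I C. atom (Ts ! c))"
        proof
          fix z assume z: "z \<in> C"
          have "{C\<in>DD. z \<in> C} \<in> set Ts" using Ts(1) by auto
          then obtain c where c: "c < length Ts" "Ts ! c = {C\<in>DD. z \<in> C}" by (metis in_set_conv_nth)
          have "z \<in> atom (Ts ! c)" unfolding c(2) atom_def using z Cs by auto
          moreover have "c \<in> I C" using c z CD by (simp add: I_def)
          ultimately show "z \<in> (\<Union>c\<in>I C. atom (Ts ! c))" by blast
        qed
        show "(\<Union>c\<in>I C. atom (Ts ! c)) \<subseteq> C" using CD by (auto simp: I_def atom_def)
      qed
      moreover have "emeasure (N i w) (win j \<times> (\<Union>c\<in>I C. atom (Ts ! c))) = (\<Sum>c\<in>I C. emeasure (N i w) (win j \<times> atom (Ts ! c)))"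
      proof (rule N_emeasure_union[OF w _ atom])
        show "finite (I C)" by (simp add: I_def)
        show "disjoint_family_on (\<lambda>c. atom (Ts ! c)) (I C)"
        proof (unfold disjoint_family_on_def, intro ballI impI)
          fix c c' assume cc: "c \<in> I C" "c' \<in> I C" "c \<noteq> c'"
          then have "Ts ! c \<noteq> Ts ! c'" "Ts ! c \<subseteq> DD" "Ts ! c' \<subseteq> DD"
            using Ts by (auto simp: I_def nth_eq_iff_index_eq dest!: nth_mem)
          then show "atom (Ts ! c) \<inter> atom (Ts ! c') = {}" by (auto simp: atom_def)
        qed
      qed
      ultimately have "emeasure (N i w) (win j \<times> C) = (\<Sum>c\<in>I C. emeasure (N i w) (win j \<times> atom (Ts ! c)))" by simp
      moreover have "h C (restrict (\<lambda>m. emeasure (N i w) (S m)) (K j)) = (\<Sum>c\<in>I C. emeasure (N i w) (win j \<times> atom (Ts ! c)))"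
        unfolding h_def by (rule sum.cong) (auto simp: I_def K_def S_def)
      ultimately show ?thesis by simp
    qed
    have "E j = (\<lambda>w. restrict (\<lambda>m. emeasure (N i w) (S m)) (K j)) -` ?X \<inter> space M"
      unfolding DA(1)[OF j] by (auto simp: hC space_PiM)
    then show ?thesis using X by blast
  qed
  then show "prob (\<Inter>j\<in>J. E j) = (\<Prod>j\<in>J. prob (E j))"
    using indep_setsD[OF ind_sets, of J E] J by simp
qed

text \<open>\<open>count_events\<close> supplies an intersection-stable generator, so independence
  extends to the generated sigma-algebras.\<close>

lemma indep_counts_windows: "indep_sets (\<lambda>k. noise_events (k, Inr i)) UNIV"
proof (rule indep_sets_mono_sets)
  show "indep_sets (\<lambda>k. sigma_sets (space M) (count_events i k)) UNIV"
    by (rule indep_sets_sigma[OF indep_count_events count_events_Int_stable])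
  fix k
  have "{(\<lambda>w. emeasure (N i w) (win k \<times> C)) -` A \<inter> space M | C A. C \<in> sets \<nu> \<and> A \<in> sets borel} \<subseteq> count_events i k"
  proof safe
    fix C :: "'z set" and A :: "ennreal set" assume "C \<in> sets \<nu>" "A \<in> sets borel"
    then show "(\<lambda>w. emeasure (N i w) (win k \<times> C)) -` A \<inter> space M \<in> count_events i k"
      unfolding count_events_def by (intro CollectI exI[of _ "{C}"] exI[of _ "\<lambda>_. A"]) auto
  qed
  then show "noise_events (k, Inr i) \<subseteq> sigma_sets (space M) (count_events i k)"
    by (auto intro: subsetD[OF sigma_sets_mono'])
qed

lemma indep_noise_events: "indep_sets noise_events UNIV"
proof (rule indep_sets_grouped[OF indep_noise])
  fix s :: "'n + 'n"
  show "sigma_algebra (space M) (case s of Inl i \<Rightarrow> process_sigma M (B i) | Inr i \<Rightarrow> random_measure_sigma M \<nu> (N i))"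
    by (auto simp: process_sigma_def random_measure_sigma_def split: sum.split intro!: sigma_algebra_sigma_sets)
  show "noise_events (k, s) \<subseteq> (case s of Inl i \<Rightarrow> process_sigma M (B i) | Inr i \<Rightarrow> random_measure_sigma M \<nu> (N i))" for k
  proof (cases s)
    case (Inl i)
    then show ?thesis using measurable_sets[OF dB_measurable[of i k]] by (auto simp: sets_brownian_algebra)
  next
    case (Inr i)
    have "sigma_sets (space M) {(\<lambda>w. emeasure (N i w) (win k \<times> C)) -` A \<inter> space M | C A. C \<in> sets \<nu> \<and> A \<in> sets borel}
      \<subseteq> random_measure_sigma M \<nu> (N i)"
      unfolding random_measure_sigma_def by (rule sigma_sets_mono') (use win_Times in blast)
    then show ?thesis using Inr by simp
  qed
  show "indep_sets (\<lambda>k. noise_events (k, s)) UNIV"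
    by (cases s) (use indep_dB indep_counts_windows in auto)
qed

lemma noise_events_Int_stable: "Int_stable (noise_events e)"
proof (cases e rule: noise_events.cases)
  case (1 k i)
  show ?thesis unfolding 1 noise_events.simps
  proof (rule Int_stableI)
    fix a b assume "a \<in> {dB i k -` A \<inter> space M | A. A \<in> sets borel}" "b \<in> {dB i k -` A \<inter> space M | A. A \<in> sets borel}"
    then obtain A A' where "a = dB i k -` A \<inter> space M" "A \<in> sets borel" "b = dB i k -` A' \<inter> space M" "A' \<in> sets borel" by auto
    then show "a \<inter> b \<in> {dB i k -` A \<inter> space M | A. A \<in> sets borel}"
      by (intro CollectI exI[of _ "A \<inter> A'"]) auto
  qed
next
  case (2 k i)
  interpret sigma_algebra "space M" "noise_events e"
    unfolding 2 noise_events.simps by (rule sigma_algebra_sigma_sets) auto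
  show ?thesis by (auto simp: Int_stable_def)
qed

text \<open>The information carried by the windows in \<open>J\<close>, over all particles. It is a
  measure space for the sake of its sigma-algebra; probabilities are taken in
  \<open>M\<close>.\<close>

definition noise_algebra :: "nat set \<Rightarrow> 'w measure" where
  "noise_algebra J = sigma (space M) (\<Union>e\<in>J \<times> UNIV. noise_events e)"

lemma noise_events_subset: "noise_events e \<subseteq> events"
  using indep_noise_events unfolding indep_sets_def by blast

lemma sets_noise_algebra: "sets (noise_algebra J) = sigma_sets (space M) (\<Union>e\<in>J \<times> UNIV. noise_events e)"
  unfolding noise_algebra_def using noise_events_subset sets.sets_into_space by (intro sets_measure_of) blast

lemma space_noise_algebra [simp]: "space (noise_algebra J) = space M"
  unfolding noise_algebra_def using noise_events_subset sets.sets_into_space by (intro space_measure_of) blast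

lemma noise_algebra_subset: "sets (noise_algebra J) \<subseteq> events"
  unfolding sets_noise_algebra using noise_events_subset by (intro sets.sigma_sets_subset) auto

lemma id_measurable_noise_algebra: "(\<lambda>w. w) \<in> measurable M (noise_algebra J)"
  using noise_algebra_subset[of J] by (intro measurableI) (auto simp: Int_absorb2 dest: sets.sets_into_space)

lemma dB_measurable_noise_algebra: "k \<in> J \<Longrightarrow> dB i k \<in> borel_measurable (noise_algebra J)"
proof (rule measurableI)
  fix A :: "(real^'m) set" assume "k \<in> J" "A \<in> sets borel"
  then have "dB i k -` A \<inter> space M \<in> noise_events (k, Inl i)" "(k, Inl i) \<in> J \<times> UNIV" by auto
  then have "dB i k -` A \<inter> space M \<in> (\<Union>e\<in>J \<times> UNIV. noise_events e)" by (rule UN_I[rotated])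
  then show "dB i k -` A \<inter> space (noise_algebra J) \<in> sets (noise_algebra J)"
    by (simp add: sets_noise_algebra sigma_sets.Basic)
qed simp

lemma jump_measurable_noise_algebra:
  assumes "k \<in> J" "C \<in> sets \<nu>"
  shows "(\<lambda>w. emeasure (jump i k w) C) \<in> borel_measurable (noise_algebra J)"
proof -
  have "(\<lambda>w. emeasure (N i w) (win k \<times> C)) \<in> borel_measurable (noise_algebra J)"
  proof (rule measurableI)
    fix A :: "ennreal set" assume "A \<in> sets borel"
    then have "(\<lambda>w. emeasure (N i w) (win k \<times> C)) -` A \<inter> space M \<in> noise_events (k, Inr i)" "(k, Inr i) \<in> J \<times> UNIV"
      using assms by (auto intro!: sigma_sets.Basic)
    then have "(\<lambda>w. emeasure (N i w) (win k \<times> C)) -` A \<inter> space M \<in> (\<Union>e\<in>J \<times> UNIV. noise_events e)"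
      by (rule UN_I[rotated])
    then show "(\<lambda>w. emeasure (N i w) (win k \<times> C)) -` A \<inter> space (noise_algebra J) \<in> sets (noise_algebra J)"
      by (simp add: sets_noise_algebra sigma_sets.Basic)
  qed simp
  then show ?thesis using assms
    by (subst measurable_cong[where g="\<lambda>w. emeasure (N i w) (win k \<times> C)"]) (auto simp: emeasure_jump)
qed

text \<open>The identity maps stand for the whole noise of the past and of the present, so that
  independence takes the form of a product law.\<close>

lemma indep_past_present:
  "indep_var (noise_algebra {..<k}) (\<lambda>w. w) (noise_algebra {k}) (\<lambda>w. w)"
proof -
  let ?I = "\<lambda>b. if b then {..<k} \<times> UNIV else {k} \<times> (UNIV :: ('n + 'n) set)"
  have "indep_sets (\<lambda>b. sigma_sets (space M) (\<Union>e\<in>?I b. noise_events e)) UNIV"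
    by (rule indep_sets_collect_sigma)
       (auto simp: disjoint_family_on_def noise_events_Int_stable intro: indep_sets_mono_index[OF _ indep_noise_events])
  moreover have "(\<lambda>b. sigma_sets (space M) (\<Union>e\<in>?I b. noise_events e)) = case_bool (sets (noise_algebra {..<k})) (sets (noise_algebra {k}))"
    by (auto simp: fun_eq_iff sets_noise_algebra split: bool.split)
  ultimately have i: "indep_set (sets (noise_algebra {..<k})) (sets (noise_algebra {k}))"
    by (simp add: indep_set_def)
  have s: "sigma_sets (space M) {(\<lambda>w. w) -` A \<inter> space M | A. A \<in> sets (noise_algebra J)} = sets (noise_algebra J)" for J
  proof -
    have "{(\<lambda>w. w) -` A \<inter> space M | A. A \<in> sets (noise_algebra J)} = sets (noise_algebra J)"
      using sets.sets_into_space[of _ "noise_algebra J"] by (auto simp: Int_absorb2)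
    then show ?thesis using sets.sigma_sets_eq[of "noise_algebra J"] by simp
  qed
  show ?thesis
    unfolding indep_var_eq s using i by (simp add: id_measurable_noise_algebra)
qed

text \<open>Freezing lemma: by independence, \<open>(w, w)\<close> has the product law on past and
  present, so the past argument can be held fixed while the present is integrated out.\<close>

lemma freeze_present:
  fixes h :: "'w \<Rightarrow> 'w \<Rightarrow> ennreal"
  assumes h: "(\<lambda>(w, w'). h w w') \<in> borel_measurable (noise_algebra {..<k} \<Otimes>\<^sub>M noise_algebra {k})"
  shows "(\<integral>\<^sup>+w. h w w \<partial>M) = (\<integral>\<^sup>+w. \<integral>\<^sup>+w'. h w w' \<partial>M \<partial>M)"
proof -
  let ?P = "distr M (noise_algebra {..<k}) (\<lambda>w. w)" and ?Q = "distr M (noise_algebra {k}) (\<lambda>w. w)"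
  note m = id_measurable_noise_algebra
  interpret P: prob_space ?P by (rule prob_space_distr[OF m])
  interpret Q: prob_space ?Q by (rule prob_space_distr[OF m])
  have hm: "(\<lambda>(w, w'). h w w') \<in> borel_measurable (?P \<Otimes>\<^sub>M ?Q)"
    using h by (simp cong: measurable_cong_sets sets_pair_measure_cong)
  have "?P \<Otimes>\<^sub>M ?Q = distr M (noise_algebra {..<k} \<Otimes>\<^sub>M noise_algebra {k}) (\<lambda>w. (w, w))"
    using indep_past_present[of k] unfolding indep_var_distribution_eq by simp
  then have "(\<integral>\<^sup>+p. (case p of (w, w') \<Rightarrow> h w w') \<partial>(?P \<Otimes>\<^sub>M ?Q)) = (\<integral>\<^sup>+w. h w w \<partial>M)"
    using h m by (simp add: nn_integral_distr)
  moreover have "(\<integral>\<^sup>+p. (case p of (w, w') \<Rightarrow> h w w') \<partial>(?P \<Otimes>\<^sub>M ?Q)) = (\<integral>\<^sup>+w. \<integral>\<^sup>+w'. h w w' \<partial>?Q \<partial>?P)"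
    using Q.nn_integral_fst[OF hm] by simp
  moreover have "\<dots> = (\<integral>\<^sup>+w. \<integral>\<^sup>+w'. h w w' \<partial>?Q \<partial>M)"
    using Q.borel_measurable_nn_integral[OF hm] by (intro nn_integral_distr m) (simp cong: measurable_cong_sets)
  moreover have "\<dots> = (\<integral>\<^sup>+w. \<integral>\<^sup>+w'. h w w' \<partial>M \<partial>M)"
  proof (rule nn_integral_cong)
    fix w assume "w \<in> space M"
    then have "h w \<in> borel_measurable (noise_algebra {k})"
      using measurable_compose[OF measurable_Pair1'[of w "noise_algebra {..<k}" "noise_algebra {k}"] h] by simp
    then show "(\<integral>\<^sup>+w'. h w w' \<partial>?Q) = (\<integral>\<^sup>+w'. h w w' \<partial>M)" by (intro nn_integral_distr m) simp
  qed
  ultimately show ?thesis by simp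
qed

end

section \<open>Law and moments of one Euler step\<close>

context particle_noise_steps begin

text \<open>All noise of one window as a single family over \<open>'n + 'n\<close>, so that one
  statement of independence covers every particle and both kinds of noise.\<close>

definition noise_part :: "('n \<Rightarrow> real^'m \<Rightarrow> 'b) \<Rightarrow> ('n \<Rightarrow> 'z \<Rightarrow> 'b) \<Rightarrow> nat \<Rightarrow> 'n + 'n \<Rightarrow> 'w \<Rightarrow> 'b::euclidean_space" where
  "noise_part u f k e w = (case e of Inl i \<Rightarrow> u i (dB i k w) | Inr i \<Rightarrow> \<integral>z. f i z \<partial>jump i k w)"

lemma noise_part_measurable_algebra:
  assumes u: "\<And>i. u i \<in> borel_measurable borel" and f: "\<And>i. f i \<in> borel_measurable \<nu>"
  shows "noise_part u f k (Inl i) \<in> borel_measurable (brownian_algebra i)"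
    "noise_part u f k (Inr i) \<in> borel_measurable (poisson_algebra i)"
proof -
  show "noise_part u f k (Inl i) \<in> borel_measurable (brownian_algebra i)"
    using measurable_compose[OF dB_measurable[of i k] u[of i]] by (simp add: noise_part_def[abs_def])
  have "(\<lambda>w. emeasure (jump i k w) C) \<in> borel_measurable (poisson_algebra i)" if "C \<in> sets \<nu>" for C
    using N_measurable_algebra[OF win_Times[OF that], of i k] that
    by (subst measurable_cong[where g="\<lambda>w. emeasure (N i w) (win k \<times> C)"]) (auto simp: emeasure_jump)
  then have "(\<lambda>w. \<integral>z. f i z \<partial>jump i k w) \<in> borel_measurable (poisson_algebra i)"
    by (intro finite_kernel_integral_measurable_const[where Z=\<nu>]) (auto simp: f finite_jump[simplified])
  then show "noise_part u f k (Inr i) \<in> borel_measurable (poisson_algebra i)"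
    by (simp add: noise_part_def[abs_def])
qed

lemma noise_part_indep:
  assumes u: "\<And>i. u i \<in> borel_measurable borel" and f: "\<And>i. f i \<in> borel_measurable \<nu>"
  shows "indep_vars (\<lambda>_. borel) (noise_part u f k) UNIV"
proof -
  let ?F = "case_sum (\<lambda>i. process_sigma M (B i)) (\<lambda>i. random_measure_sigma M \<nu> (N i))"
  have sub: "noise_part u f k e -` A \<inter> space M \<in> ?F e" if "A \<in> sets borel" for e A
    using measurable_sets[OF noise_part_measurable_algebra(1)[OF assms] that]
      measurable_sets[OF noise_part_measurable_algebra(2)[OF assms] that]
    by (cases e) (simp_all add: sets_brownian_algebra sets_poisson_algebra)
  have ev: "?F e \<subseteq> events" for e using indep_noise unfolding indep_sets_def by blast
  have "random_variable borel (noise_part u f k e)" for e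
    using sub[of _ e] ev[of e] by (intro measurableI) auto
  moreover have "indep_sets (\<lambda>e. {noise_part u f k e -` A \<inter> space M | A. A \<in> sets borel}) UNIV"
    by (rule indep_sets_mono_sets[OF indep_noise]) (use sub in blast)
  ultimately show ?thesis unfolding indep_vars_def2 by simp
qed

lemma dB_component:
  shows "indep_vars (\<lambda>_. borel) (\<lambda>j w. dB i k w $ j) UNIV"
    "distributed M lborel (\<lambda>w. dB i k w $ j) (normal_density 0 (sqrt \<Delta>))"
proof -
  have t: "0 \<le> real k * \<Delta>" "real k * \<Delta> < real (Suc k) * \<Delta>" "real (Suc k) * \<Delta> - real k * \<Delta> = \<Delta>"
    using Delta_pos by (simp_all add: algebra_simps)
  note b = brownian[of i, unfolded std_brownian_motion_def, THEN conjunct2, THEN conjunct2, THEN conjunct2, THEN conjunct2,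
      rule_format, of "real k * \<Delta>" "real (Suc k) * \<Delta>", OF conjI[OF t(1,2)]]
  show "indep_vars (\<lambda>_. borel) (\<lambda>j w. dB i k w $ j) UNIV"
    using b[THEN conjunct1] by (simp add: dB_def)
  show "distributed M lborel (\<lambda>w. dB i k w $ j) (normal_density 0 (sqrt \<Delta>))"
    using b[THEN conjunct2, rule_format, of j] unfolding t(3) by (simp add: dB_def)
qed

lemma dB_measurable_M [measurable]: "dB i k \<in> borel_measurable M"
proof -
  have "(\<lambda>w. dB i k w $ j) \<in> borel_measurable M" for j
    using distributed_measurable[OF dB_component(2)] by simp
  then have "(\<lambda>w. \<chi> j. dB i k w $ j) \<in> borel_measurable M" by (rule measurable_vec_lambda)
  then show ?thesis by simp
qed

lemma dB_law: "distr M borel (dB i k) = distr M borel (dB i 0)"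
proof -
  have "distr M borel (dB i k) = distr (PiM UNIV (\<lambda>_. density lborel (normal_density 0 (sqrt \<Delta>)))) borel (\<lambda>v. \<chi> j. v j)" for k
  proof -
    have comp: "(\<lambda>w. dB i k w $ j) \<in> borel_measurable M" for j by measurable
    have "distr M borel (\<lambda>w. dB i k w $ j) = density lborel (normal_density 0 (sqrt \<Delta>))" for j
      using distributed_distr_eq_density[OF dB_component(2)[of i k j]] by (simp add: distr_cong[of M M lborel borel])
    then have joint: "distr M (PiM UNIV (\<lambda>_. borel)) (\<lambda>w j. dB i k w $ j) = PiM UNIV (\<lambda>_. density lborel (normal_density 0 (sqrt \<Delta>)))"
      using dB_component(1)[of i k] comp by (subst (asm) indep_vars_iff_distr_eq_PiM) (simp_all add: restrict_UNIV)
    have "dB i k = (\<lambda>v. \<chi> j. v j) \<circ> (\<lambda>w j. dB i k w $ j)" by (simp add: fun_eq_iff)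
    then have "distr M borel (dB i k) = distr (distr M (PiM UNIV (\<lambda>_. borel)) (\<lambda>w j. dB i k w $ j)) borel (\<lambda>v. \<chi> j. v j)"
      using comp by (subst distr_distr) (auto intro!: measurable_vec_lambda measurable_abs_UNIV)
    then show ?thesis by (simp only: joint)
  qed
  from this[of k] this[of 0] show ?thesis by simp
qed

text \<open>Independent families with equal marginals have equal joint laws; \<open>dB_law\<close>
  and \<open>poisson_integral_law\<close> supply the marginals.\<close>

lemma noise_part_law:
  assumes u: "\<And>i. u i \<in> borel_measurable borel" and f: "\<And>i. integrable Lam (f i)"
  shows "distr M (PiM UNIV (\<lambda>_. borel)) (\<lambda>w e. noise_part u f k e w)
    = distr M (PiM UNIV (\<lambda>_. borel)) (\<lambda>w e. noise_part u f 0 e w)"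
proof -
  have fm: "f i \<in> borel_measurable \<nu>" for i
    using borel_measurable_integrable[OF f[of i]] by (simp add: measurable_Lam)
  have rv: "random_variable borel (noise_part u f k e)" for k e
    using noise_part_indep[OF u fm] by (simp add: indep_vars_def)
  have joint: "distr M (PiM UNIV (\<lambda>_. borel)) (\<lambda>w e. noise_part u f k e w) = PiM UNIV (\<lambda>e. distr M borel (noise_part u f k e))" for k
    using noise_part_indep[where u=u and f=f and k=k, OF u fm] rv by (subst (asm) indep_vars_iff_distr_eq_PiM) (simp_all add: restrict_UNIV)
  have "distr M borel (noise_part u f k e) = distr M borel (noise_part u f 0 e)" for e
  proof (cases e)
    case (Inl i)
    have "distr M borel (noise_part u f k e) = distr (distr M borel (dB i k)) borel (u i)" for k
      using u by (subst distr_distr) (auto simp: Inl noise_part_def[abs_def] o_def)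
    then show ?thesis by (simp only: dB_law[of i k])
  next
    case (Inr i)
    show ?thesis
      using poisson_integral_law[OF finite_poisson_jump[of i k] finite_poisson_jump[of i 0] f[of i]]
      by (simp add: Inr noise_part_def[abs_def])
  qed
  then show ?thesis by (simp add: joint)
qed

lemma step_law:
  fixes a :: "'n \<Rightarrow> real^'d" and G :: "'n \<Rightarrow> real^'m^'d" and f :: "'n \<Rightarrow> 'z \<Rightarrow> real^'d"
  assumes f: "\<And>i. integrable Lam (f i)"
  shows "distr M borel (\<lambda>w. \<chi> i. a i + G i *v dB i k w + ((\<integral>z. f i z \<partial>jump i k w) - (\<integral>z. f i z \<partial>Lam)))
    = distr M borel (\<lambda>w. \<chi> i. a i + G i *v dB i 0 w + ((\<integral>z. f i z \<partial>jump i 0 w) - (\<integral>z. f i z \<partial>Lam)))"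
proof -
  let ?u = "\<lambda>i v. G i *v v"
  have u: "?u i \<in> borel_measurable borel" for i
    by (intro borel_measurable_continuous_onI continuous_intros)
  have fm: "f i \<in> borel_measurable \<nu>" for i
    using borel_measurable_integrable[OF f[of i]] by (simp add: measurable_Lam)
  define h :: "('n + 'n \<Rightarrow> real^'d) \<Rightarrow> real^'d^'n" where
    "h v = (\<chi> i. a i + v (Inl i) + (v (Inr i) - (\<integral>z. f i z \<partial>Lam)))" for v
  have h: "h \<in> borel_measurable (PiM UNIV (\<lambda>_. borel))"
    unfolding h_def by (intro measurable_vec_lambda borel_measurable_add borel_measurable_diff) auto
  have rv: "random_variable borel (noise_part ?u f k e)" for k e
    using noise_part_indep[OF u fm] by (simp add: indep_vars_def)
  have "distr M borel (\<lambda>w. \<chi> i. a i + G i *v dB i k w + ((\<integral>z. f i z \<partial>jump i k w) - (\<integral>z. f i z \<partial>Lam)))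
    = distr (distr M (PiM UNIV (\<lambda>_. borel)) (\<lambda>w e. noise_part ?u f k e w)) borel h" for k
    unfolding distr_distr[OF h measurable_abs_UNIV[OF rv]] by (simp add: h_def noise_part_def o_def)
  then show ?thesis by (simp only: noise_part_law[where u="?u" and f=f and k=k, OF u f])
qed

section \<open>Second moments of one step\<close>

lemma dB_moments:
  shows "integrable M (\<lambda>w. dB i k w $ j)" "expectation (\<lambda>w. dB i k w $ j) = 0"
    "integrable M (\<lambda>w. dB i k w $ j * dB i k w $ l)"
    "expectation (\<lambda>w. dB i k w $ j * dB i k w $ l) = (if j = l then \<Delta> else 0)"
proof -
  have s: "0 < sqrt \<Delta>" using Delta_pos by simp
  note D = dB_component(2)[of i k]
  have 1: "integrable M (\<lambda>w. dB i k w $ j)" for j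
    using distributed_integrable[OF D[of j], of "\<lambda>x. x"] integrable_normal_moment[OF s, of 0 1] by simp
  have 2: "expectation (\<lambda>w. dB i k w $ j) = 0" for j
    using distributed_integral[OF D[of j], of "\<lambda>x. x"] integral_normal_moment_odd[OF s, of 0 0] by simp
  have 3: "integrable M (\<lambda>w. dB i k w $ j * dB i k w $ j)" for j
    using distributed_integrable[OF D[of j], of "\<lambda>x. x * x"] integrable_normal_moment[OF s, of 0 2] by (simp add: power2_eq_square)
  have 4: "expectation (\<lambda>w. dB i k w $ j * dB i k w $ j) = \<Delta>" for j
    using distributed_integral[OF D[of j], of "\<lambda>x. x * x"] integral_normal_moment_even[OF s, of 0 1] Delta_pos
    by (simp add: power2_eq_square fact_numeral)
  have 5: "integrable M (\<lambda>w. dB i k w $ j * dB i k w $ l)" "expectation (\<lambda>w. dB i k w $ j * dB i k w $ l) = 0" if "j \<noteq> l" for j l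
  proof -
    have iv: "indep_var borel (\<lambda>w. dB i k w $ j) borel (\<lambda>w. dB i k w $ l)"
      by (rule indep_vars_pair[OF dB_component(1)]) (use that in auto)
    show "integrable M (\<lambda>w. dB i k w $ j * dB i k w $ l)" by (rule indep_var_integrable[OF iv 1 1])
    show "expectation (\<lambda>w. dB i k w $ j * dB i k w $ l) = 0"
      by (subst indep_var_lebesgue_integral[OF iv 1 1]) (simp add: 2)
  qed
  show "integrable M (\<lambda>w. dB i k w $ j)" "expectation (\<lambda>w. dB i k w $ j) = 0"
    "integrable M (\<lambda>w. dB i k w $ j * dB i k w $ l)"
    "expectation (\<lambda>w. dB i k w $ j * dB i k w $ l) = (if j = l then \<Delta> else 0)"
    by (cases "j = l"; simp add: 1 2 3 4 5)+
qed

text \<open>The covariance of the increment is \<open>\<Delta>\<close> times the identity, so row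
  \<open>r\<close> of \<open>G\<close> contributes its squared norm; summed over the rows this is
  the squared Frobenius norm.\<close>

lemma diffusion_moments:
  fixes G :: "real^'m^'d"
  shows "integrable M (\<lambda>w. (G *v dB i k w) $ r)" "expectation (\<lambda>w. (G *v dB i k w) $ r) = 0"
    "integrable M (\<lambda>w. ((G *v dB i k w) $ r)\<^sup>2)"
    "expectation (\<lambda>w. ((G *v dB i k w) $ r)\<^sup>2) = \<Delta> * (norm (G $ r))\<^sup>2"
proof -
  have e: "(G *v v) $ r = (\<Sum>j\<in>UNIV. G $ r $ j * v $ j)" for v by (simp add: matrix_vector_mult_def)
  show "integrable M (\<lambda>w. (G *v dB i k w) $ r)" "expectation (\<lambda>w. (G *v dB i k w) $ r) = 0"
    using dB_moments(1,2)[of i k] by (simp_all add: e)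
  have e2: "((G *v v) $ r)\<^sup>2 = (\<Sum>j\<in>UNIV. \<Sum>l\<in>UNIV. (G $ r $ j * G $ r $ l) * (v $ j * v $ l))" for v
    by (simp add: e power2_eq_square sum_product ac_simps)
  show "integrable M (\<lambda>w. ((G *v dB i k w) $ r)\<^sup>2)"
    unfolding e2 by (intro Bochner_Integration.integrable_sum integrable_mult_right dB_moments)
  have "expectation (\<lambda>w. ((G *v dB i k w) $ r)\<^sup>2) = (\<Sum>j\<in>UNIV. \<Sum>l\<in>UNIV. (G $ r $ j * G $ r $ l) * expectation (\<lambda>w. dB i k w $ j * dB i k w $ l))"
    unfolding e2 using dB_moments(3)[of i k]
    by (subst Bochner_Integration.integral_sum)
      (auto intro!: sum.cong Bochner_Integration.integral_sum[THEN trans] Bochner_Integration.integrable_sum integrable_mult_right)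
  also have "\<dots> = (\<Sum>j\<in>UNIV. G $ r $ j * G $ r $ j * \<Delta>)"
    by (simp add: dB_moments(4) if_distrib[of "\<lambda>x. _ * x"] cong: if_cong)
  also have "\<dots> = \<Delta> * (norm (G $ r))\<^sup>2"
    unfolding power2_norm_vec[of "G $ r"] by (simp add: power2_eq_square sum_distrib_left ac_simps)
  finally show "expectation (\<lambda>w. ((G *v dB i k w) $ r)\<^sup>2) = \<Delta> * (norm (G $ r))\<^sup>2" .
qed

lemma integral_Lam:
  fixes f :: "'z \<Rightarrow> real"
  assumes "f \<in> borel_measurable \<nu>" "\<And>z. 0 \<le> f z" "integrable \<nu> f"
  shows "integrable Lam f" "(\<integral>\<^sup>+z. ennreal (f z) \<partial>Lam) = ennreal (\<Delta> * (\<integral>z. f z \<partial>\<nu>))"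
proof -
  show e: "(\<integral>\<^sup>+z. ennreal (f z) \<partial>Lam) = ennreal (\<Delta> * (\<integral>z. f z \<partial>\<nu>))"
    using assms Delta_pos by (simp add: nn_integral_Lam nn_integral_eq_integral ennreal_mult)
  show "integrable Lam f"
    by (rule integrableI_nn_integral_finite[OF _ _ e]) (use assms Delta_pos in \<open>auto simp: measurable_Lam\<close>)
qed

lemma particle_second_moment:
  fixes a :: "real^'d" and G :: "real^'m^'d" and f :: "'z \<Rightarrow> real^'d"
  assumes f: "f \<in> borel_measurable \<nu>" "integrable \<nu> (\<lambda>z. (norm (f z))\<^sup>2)"
  shows "(\<integral>\<^sup>+w. ennreal ((norm (a + G *v dB i k w + ((\<integral>z. f z \<partial>jump i k w) - (\<integral>z. f z \<partial>Lam))))\<^sup>2) \<partial>M)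
    \<le> ennreal ((norm a)\<^sup>2 + \<Delta> * (norm G)\<^sup>2 + \<Delta> * (\<integral>z. (norm (f z))\<^sup>2 \<partial>\<nu>))"
proof -
  interpret J: finite_poisson_measure M "jump i k" Lam by (rule finite_poisson_jump)
  define X where "X w = G *v dB i k w" for w
  define Y where "Y w = (\<integral>z. f z \<partial>jump i k w) - (\<integral>z. f z \<partial>Lam)" for w
  have fm: "f \<in> borel_measurable Lam" using f by (simp add: measurable_Lam)
  have f2: "integrable Lam (\<lambda>z. (norm (f z))\<^sup>2)" "(\<integral>\<^sup>+z. ennreal ((norm (f z))\<^sup>2) \<partial>Lam) = ennreal (\<Delta> * (\<integral>z. (norm (f z))\<^sup>2 \<partial>\<nu>))"
    by (rule integral_Lam; use f in simp)+
  have "integrable Lam (\<lambda>z. norm (f z))"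
    by (rule J.\<Lambda>.square_integrable_imp_integrable) (use fm f2 in auto)
  then have fi: "integrable Lam f" using fm by (simp add: integrable_norm_iff)
  note mean = J.integral_n_mean[OF fi]
  have Yint: "integrable M Y" "expectation Y = 0"
    using mean by (simp_all add: Y_def[abs_def] prob_space)
  \<comment> \<open>The square is expanded coordinate by coordinate, since the product rule for
    independent variables concerns scalars.\<close>
  have comp: "x $ r = x \<bullet> axis r 1" for x :: "real^'d" and r by (simp add: inner_axis)
  have Yr: "integrable M (\<lambda>w. Y w $ r)" "expectation (\<lambda>w. Y w $ r) = 0" for r
    unfolding comp using Yint by simp_all
  have Y2: "(\<integral>\<^sup>+w. ennreal ((norm (Y w))\<^sup>2) \<partial>M) \<le> ennreal (\<Delta> * (\<integral>z. (norm (f z))\<^sup>2 \<partial>\<nu>))"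
    using J.compensated_L2[OF fm f2(1)] unfolding f2(2) Y_def .
  have Ym [measurable]: "Y \<in> borel_measurable M" using Yint by simp
  have Y2i: "integrable M (\<lambda>w. (norm (Y w))\<^sup>2)"
    using Y2 by (auto simp: integrable_iff_bounded intro: le_less_trans)
  have c0: "0 \<le> \<Delta> * (\<integral>z. (norm (f z))\<^sup>2 \<partial>\<nu>)" using Delta_pos by simp
  have Y2e: "expectation (\<lambda>w. (norm (Y w))\<^sup>2) \<le> \<Delta> * (\<integral>z. (norm (f z))\<^sup>2 \<partial>\<nu>)"
    using Y2 c0 by (simp add: nn_integral_eq_integral[OF Y2i])
  have Yr2: "integrable M (\<lambda>w. (Y w $ r)\<^sup>2)" for r
  proof (rule Bochner_Integration.integrable_bound[OF Y2i])
    show "AE w in M. norm ((Y w $ r)\<^sup>2) \<le> norm ((norm (Y w))\<^sup>2)"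
    proof (rule AE_I2)
      fix w
      have "\<bar>Y w $ r\<bar>\<^sup>2 \<le> (norm (Y w))\<^sup>2"
        by (intro power_mono component_le_norm_cart) simp
      then show "norm ((Y w $ r)\<^sup>2) \<le> norm ((norm (Y w))\<^sup>2)" by simp
    qed
  qed measurable
  txt \<open>The diffusion and the jump part are independent and centred, so no cross term costs a factor 2.\<close>
  have iv: "indep_var borel (\<lambda>w. X w $ r) borel (\<lambda>w. Y w $ r)" for r
  proof -
    let ?np = "noise_part (\<lambda>_ v. G *v v) (\<lambda>_. f) k"
    have u: "(\<lambda>v. G *v v) \<in> borel_measurable borel"
      by (intro borel_measurable_continuous_onI continuous_intros)
    have "indep_var borel (?np (Inl i)) borel (?np (Inr i))"
      by (rule indep_vars_pair[OF noise_part_indep[OF u f(1)]]) auto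
    then have "indep_var borel ((\<lambda>v. v $ r) \<circ> ?np (Inl i)) borel ((\<lambda>v. v $ r - (\<integral>z. f z \<partial>Lam) $ r) \<circ> ?np (Inr i))"
      by (rule indep_var_compose) auto
    then show ?thesis by (simp add: noise_part_def o_def X_def Y_def)
  qed
  have Xr: "integrable M (\<lambda>w. X w $ r)" "expectation (\<lambda>w. X w $ r) = 0"
    "integrable M (\<lambda>w. (X w $ r)\<^sup>2)" "expectation (\<lambda>w. (X w $ r)\<^sup>2) = \<Delta> * (norm (G $ r))\<^sup>2" for r
    unfolding X_def by (rule diffusion_moments)+
  have XY: "integrable M (\<lambda>w. X w $ r * Y w $ r)" "expectation (\<lambda>w. X w $ r * Y w $ r) = 0" for r
    by (rule indep_var_integrable[OF iv Xr(1) Yr(1)])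
       (simp add: indep_var_lebesgue_integral[OF iv Xr(1) Yr(1)] Xr(2))
  have eq: "((a + X w + Y w) $ r)\<^sup>2 = (a $ r)\<^sup>2 + (X w $ r)\<^sup>2 + (Y w $ r)\<^sup>2 + 2 * a $ r * X w $ r + 2 * a $ r * Y w $ r + 2 * (X w $ r * Y w $ r)" for w r
    by (simp add: power2_eq_square algebra_simps)
  have int: "integrable M (\<lambda>w. ((a + X w + Y w) $ r)\<^sup>2)" for r
    unfolding eq using Xr Yr Yr2 XY
    by (intro Bochner_Integration.integrable_add integrable_mult_right) auto
  have ex: "expectation (\<lambda>w. ((a + X w + Y w) $ r)\<^sup>2) = (a $ r)\<^sup>2 + \<Delta> * (norm (G $ r))\<^sup>2 + expectation (\<lambda>w. (Y w $ r)\<^sup>2)" for r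
    unfolding eq using Xr[of r] Yr[of r] Yr2[of r] XY[of r]
    by (simp add: prob_space)
  have n: "(norm v)\<^sup>2 = (\<Sum>r\<in>UNIV. (v $ r)\<^sup>2)" for v :: "real^'d"
    by (simp add: power2_norm_vec)
  have "expectation (\<lambda>w. (norm (a + X w + Y w))\<^sup>2) = (\<Sum>r\<in>UNIV. (a $ r)\<^sup>2 + \<Delta> * (norm (G $ r))\<^sup>2 + expectation (\<lambda>w. (Y w $ r)\<^sup>2))"
    unfolding n using int by (subst Bochner_Integration.integral_sum) (simp_all only: ex)
  also have "\<dots> = (norm a)\<^sup>2 + \<Delta> * (norm G)\<^sup>2 + expectation (\<lambda>w. (norm (Y w))\<^sup>2)"
    unfolding n[of a] n[of "Y _"] power2_norm_vec[of G] using Yr2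
    by (simp add: sum.distrib sum_distrib_left)
  also have "\<dots> \<le> (norm a)\<^sup>2 + \<Delta> * (norm G)\<^sup>2 + \<Delta> * (\<integral>z. (norm (f z))\<^sup>2 \<partial>\<nu>)"
    using Y2e by simp
  finally have le: "expectation (\<lambda>w. (norm (a + X w + Y w))\<^sup>2) \<le> (norm a)\<^sup>2 + \<Delta> * (norm G)\<^sup>2 + \<Delta> * (\<integral>z. (norm (f z))\<^sup>2 \<partial>\<nu>)" .
  have "integrable M (\<lambda>w. (norm (a + X w + Y w))\<^sup>2)"
    unfolding n by (intro Bochner_Integration.integrable_sum int)
  then have "(\<integral>\<^sup>+w. ennreal ((norm (a + X w + Y w))\<^sup>2) \<partial>M) = ennreal (expectation (\<lambda>w. (norm (a + X w + Y w))\<^sup>2))"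
    by (intro nn_integral_eq_integral) auto
  then show ?thesis using le unfolding X_def Y_def by (simp add: ennreal_leI)
qed

lemma step_second_moment:
  fixes a :: "'n \<Rightarrow> real^'d" and G :: "'n \<Rightarrow> real^'m^'d" and f :: "'n \<Rightarrow> 'z \<Rightarrow> real^'d"
  assumes f: "\<And>i. f i \<in> borel_measurable \<nu>" "\<And>i. integrable \<nu> (\<lambda>z. (norm (f i z))\<^sup>2)"
  shows "(\<integral>\<^sup>+w. ennreal ((norm (\<chi> i. a i + G i *v dB i k w + ((\<integral>z. f i z \<partial>jump i k w) - (\<integral>z. f i z \<partial>Lam))))\<^sup>2) \<partial>M)
    \<le> ennreal (\<Sum>i\<in>UNIV. (norm (a i))\<^sup>2 + \<Delta> * (norm (G i))\<^sup>2 + \<Delta> * (\<integral>z. (norm (f i z))\<^sup>2 \<partial>\<nu>))"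
proof -
  let ?p = "\<lambda>i w. a i + G i *v dB i k w + ((\<integral>z. f i z \<partial>jump i k w) - (\<integral>z. f i z \<partial>Lam))"
  have Jm: "(\<lambda>w. \<integral>z. f i z \<partial>jump i k w) \<in> borel_measurable M" for i
    by (rule finite_poisson_measure.integral_n_measurable[OF finite_poisson_jump]) (simp add: measurable_Lam f)
  have Gm: "(\<lambda>w. G i *v dB i k w) \<in> borel_measurable M" for i
    by (rule measurable_compose[OF dB_measurable_M]) (intro borel_measurable_continuous_onI continuous_intros)
  have pm: "?p i \<in> borel_measurable M" for i using Jm Gm by (intro borel_measurable_add borel_measurable_diff) auto
  have "ennreal ((norm (\<chi> i. ?p i w))\<^sup>2) = (\<Sum>i\<in>UNIV. ennreal ((norm (?p i w))\<^sup>2))" for w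
    by (subst power2_norm_vec) simp
  then have "(\<integral>\<^sup>+w. ennreal ((norm (\<chi> i. ?p i w))\<^sup>2) \<partial>M) = (\<integral>\<^sup>+w. (\<Sum>i\<in>UNIV. ennreal ((norm (?p i w))\<^sup>2)) \<partial>M)"
    by (simp only:)
  also have "\<dots> = (\<Sum>i\<in>UNIV. \<integral>\<^sup>+w. ennreal ((norm (?p i w))\<^sup>2) \<partial>M)"
    using pm by (intro nn_integral_sum) simp
  also have "\<dots> \<le> (\<Sum>i\<in>UNIV. ennreal ((norm (a i))\<^sup>2 + \<Delta> * (norm (G i))\<^sup>2 + \<Delta> * (\<integral>z. (norm (f i z))\<^sup>2 \<partial>\<nu>)))"
    by (intro sum_mono particle_second_moment f)
  also have "\<dots> = ennreal (\<Sum>i\<in>UNIV. (norm (a i))\<^sup>2 + \<Delta> * (norm (G i))\<^sup>2 + \<Delta> * (\<integral>z. (norm (f i z))\<^sup>2 \<partial>\<nu>))"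
    using Delta_pos by (intro sum_ennreal) simp
  finally show ?thesis .
qed

end

section \<open>The tamed Euler scheme as an iterated random map\<close>

text \<open>\<open>step_contraction\<close> bounds the very expression that
  \<open>step_second_moment\<close> yields for the difference of two steps. It separates the
  probabilistic part from the estimates of the coefficients, which are left to the final
  proof.\<close>

locale tamed_euler_scheme = particle_noise_steps M \<nu> B N \<Delta>
  for M :: "'w measure" and \<nu> :: "'z measure"
    and B :: "'n::finite \<Rightarrow> real \<Rightarrow> 'w \<Rightarrow> real^'m" and N :: "'n \<Rightarrow> 'w \<Rightarrow> (real \<times> 'z) measure" and \<Delta> :: real +
  fixes q r :: real and b1 :: "real^'d \<Rightarrow> real^'d"
    and b2 :: "real^'d \<Rightarrow> (real^'d) measure \<Rightarrow> real^'d"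
    and g :: "real^'d \<Rightarrow> (real^'d) measure \<Rightarrow> real^'m^'d"
    and \<gamma> :: "real^'d \<Rightarrow> (real^'d) measure \<Rightarrow> 'z \<Rightarrow> real^'d"
  assumes b1_measurable: "b1 \<in> borel_measurable borel"
    and b2_measurable: "(\<lambda>(x, \<mu>). b2 x \<mu>) \<in> borel_measurable (borel \<Otimes>\<^sub>M P2_borel)"
    and g_measurable: "(\<lambda>(x, \<mu>). g x \<mu>) \<in> borel_measurable (borel \<Otimes>\<^sub>M P2_borel)"
    and gamma_measurable: "(\<lambda>(x, \<mu>, z). \<gamma> x \<mu> z) \<in> borel_measurable (borel \<Otimes>\<^sub>M (P2_borel \<Otimes>\<^sub>M \<nu>))"
    and gamma_square_integrable: "\<And>x \<mu>. \<mu> \<in> P2 \<Longrightarrow> integrable \<nu> (\<lambda>z. (norm (\<gamma> x \<mu> z))\<^sup>2)"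
    and r: "0 < r" "r < 1"
    and step_contraction: "\<And>x y :: real^'d^'n.
      (\<Sum>i\<in>UNIV.
         (norm (x $ i + \<Delta> *\<^sub>R tamed_drift \<Delta> q b1 b2 (x $ i) (empirical_measure x)
              - (y $ i + \<Delta> *\<^sub>R tamed_drift \<Delta> q b1 b2 (y $ i) (empirical_measure y))))\<^sup>2
       + \<Delta> * (norm (g (x $ i) (empirical_measure x) - g (y $ i) (empirical_measure y)))\<^sup>2
       + \<Delta> * (\<integral>z. (norm (\<gamma> (x $ i) (empirical_measure x) z - \<gamma> (y $ i) (empirical_measure y) z))\<^sup>2 \<partial>\<nu>))
      \<le> r * (norm (x - y))\<^sup>2"
begin

definition drift_part :: "real^'d^'n \<Rightarrow> 'n \<Rightarrow> real^'d" where
  "drift_part x i = x $ i + \<Delta> *\<^sub>R tamed_drift \<Delta> q b1 b2 (x $ i) (empirical_measure x)"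

definition diffusion :: "real^'d^'n \<Rightarrow> 'n \<Rightarrow> real^'m^'d" where
  "diffusion x i = g (x $ i) (empirical_measure x)"

definition jump_size :: "real^'d^'n \<Rightarrow> 'n \<Rightarrow> 'z \<Rightarrow> real^'d" where
  "jump_size x i z = \<gamma> (x $ i) (empirical_measure x) z"

definition step :: "nat \<Rightarrow> real^'d^'n \<Rightarrow> 'w \<Rightarrow> real^'d^'n" where
  "step k x w = (\<chi> i. drift_part x i + diffusion x i *v dB i k w
     + ((\<integral>z. jump_size x i z \<partial>jump i k w) - (\<integral>z. jump_size x i z \<partial>Lam)))"

abbreviation euler :: "nat \<Rightarrow> real^'d^'n \<Rightarrow> 'w \<Rightarrow> real^'d^'n" where
  "euler k x w \<equiv> tamed_euler \<Delta> q b1 b2 g \<gamma> \<nu> B N x w k"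

abbreviation law :: "nat \<Rightarrow> (real^'d^'n) measure \<Rightarrow> (real^'d^'n) measure" where
  "law \<equiv> scheme_law \<Delta> q b1 b2 g \<gamma> \<nu> M B N"

lemma pair_measurable: "(\<lambda>x :: real^'d^'n. (x $ i, empirical_measure x)) \<in> measurable borel (borel \<Otimes>\<^sub>M P2_borel)"
  by measurable

lemma drift_part_measurable: "(\<lambda>x. drift_part x i) \<in> borel_measurable borel"
proof -
  note b1_measurable [measurable]
  have [measurable]: "(\<lambda>x :: real^'d^'n. b2 (x $ i) (empirical_measure x)) \<in> borel_measurable borel"
    using measurable_compose[OF pair_measurable b2_measurable] by simp
  show ?thesis unfolding drift_part_def tamed_drift_def by measurable
qed

lemma diffusion_measurable: "(\<lambda>x. diffusion x i) \<in> borel_measurable borel"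
  unfolding diffusion_def using measurable_compose[OF pair_measurable g_measurable] by simp

lemma jump_size_measurable: "(\<lambda>(x, z). jump_size x i z) \<in> borel_measurable (borel \<Otimes>\<^sub>M \<nu>)"
proof -
  have "(\<lambda>p :: (real^'d^'n) \<times> 'z. (fst p $ i, empirical_measure (fst p), snd p)) \<in> measurable (borel \<Otimes>\<^sub>M \<nu>) (borel \<Otimes>\<^sub>M (P2_borel \<Otimes>\<^sub>M \<nu>))"
    by measurable
  from measurable_compose[OF this gamma_measurable] show ?thesis
    by (simp add: jump_size_def case_prod_unfold)
qed

lemma jump_size_measurable_z: "jump_size x i \<in> borel_measurable \<nu>"
  using measurable_compose[OF measurable_Pair1'[of x borel \<nu>] jump_size_measurable[of i]] by simp

lemma jump_size_square: "integrable \<nu> (\<lambda>z. (norm (jump_size x i z))\<^sup>2)"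
  unfolding jump_size_def by (rule gamma_square_integrable[OF empirical_P2])

lemma jump_size_integrable: "integrable Lam (jump_size x i)"
proof -
  interpret J: finite_poisson_measure M "jump i 0" Lam by (rule finite_poisson_jump)
  have m: "jump_size x i \<in> borel_measurable Lam" using jump_size_measurable_z by (simp add: measurable_Lam)
  have "integrable Lam (\<lambda>z. (norm (jump_size x i z))\<^sup>2)"
    by (rule integral_Lam) (use jump_size_measurable_z jump_size_square in auto)
  then have "integrable Lam (\<lambda>z. norm (jump_size x i z))"
    by (rule J.\<Lambda>.square_integrable_imp_integrable[rotated]) (use m in simp)
  then show ?thesis using m by (simp add: integrable_norm_iff)
qed

lemma euler_Suc:
  assumes w: "w \<in> space M"
  shows "euler (Suc k) x w = step k (euler k x w) w"
proof -
  let ?X = "euler k x w"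
  have c: "compensated_integral \<nu> (N i w) ({real k * \<Delta> <.. real (Suc k) * \<Delta>} \<times> space \<nu>) (\<lambda>(s, z). \<gamma> (?X $ i) (empirical_measure ?X) z)
    = (\<integral>z. jump_size ?X i z \<partial>jump i k w) - (\<integral>z. jump_size ?X i z \<partial>Lam)" for i
    using compensated_integral_eq[OF jump_size_measurable_z[of ?X i] w, of i k] unfolding jump_size_def .
  show ?thesis
    by (simp only: tamed_euler.simps Let_def c step_def drift_part_def diffusion_def dB_def)
qed

text \<open>Stated for a sigma-algebra \<open>A\<close> on the same space, to be used both with all
  of \<open>M\<close> and with the noise of selected windows.\<close>

lemma step_measurable:
  assumes sp: "space A = space M" and d: "\<And>i. dB i k \<in> borel_measurable A"
    and j: "\<And>i C. C \<in> sets \<nu> \<Longrightarrow> (\<lambda>w. emeasure (jump i k w) C) \<in> borel_measurable A"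
  shows "(\<lambda>(x, w). step k x w) \<in> borel_measurable (borel \<Otimes>\<^sub>M A)"
proof -
  have 1: "(\<lambda>p. drift_part (fst p) i) \<in> borel_measurable (borel \<Otimes>\<^sub>M A)" for i
    by (rule measurable_compose[OF measurable_fst drift_part_measurable])
  have 2 [measurable]: "(\<lambda>p. diffusion (fst p) i) \<in> borel_measurable (borel \<Otimes>\<^sub>M A)" "(\<lambda>p. dB i k (snd p)) \<in> borel_measurable (borel \<Otimes>\<^sub>M A)" for i
    by (rule measurable_compose[OF measurable_fst diffusion_measurable], rule measurable_compose[OF measurable_snd d])
  have 3: "(\<lambda>p. diffusion (fst p) i *v dB i k (snd p)) \<in> borel_measurable (borel \<Otimes>\<^sub>M A)" for i
    unfolding matrix_vector_mult_def by (intro measurable_vec_lambda) measurable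
  have 4: "(\<lambda>(x, w). \<integral>z. jump_size x i z \<partial>jump i k w) \<in> borel_measurable (borel \<Otimes>\<^sub>M A)" for i
    by (rule finite_kernel_integral_measurable[where Z=\<nu>])
       (use sp j jump_size_measurable finite_jump in auto)
  have 5: "(\<lambda>p. \<integral>z. jump_size (fst p) i z \<partial>Lam) \<in> borel_measurable (borel \<Otimes>\<^sub>M A)" for i
  proof -
    interpret J: finite_poisson_measure M "jump i 0" Lam by (rule finite_poisson_jump)
    have "(\<lambda>(x, z). jump_size x i z) \<in> borel_measurable (borel \<Otimes>\<^sub>M Lam)"
      using jump_size_measurable[of i] by (simp cong: measurable_cong_sets sets_pair_measure_cong)
    then have "(\<lambda>x. \<integral>z. jump_size x i z \<partial>Lam) \<in> borel_measurable borel"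
      by (rule J.\<Lambda>.borel_measurable_lebesgue_integral)
    then show ?thesis by (rule measurable_compose[OF measurable_fst])
  qed
  show ?thesis
    unfolding step_def case_prod_unfold using 1 3 4 5
    by (intro measurable_vec_lambda borel_measurable_add borel_measurable_diff) (auto simp: case_prod_unfold)
qed

lemma step_measurable_M: "(\<lambda>(x, w). step k x w) \<in> borel_measurable (borel \<Otimes>\<^sub>M M)"
  by (rule step_measurable) (auto simp: finite_poisson_measure.n_measurable[OF finite_poisson_jump])

lemma step_measurable_noise: "k \<in> J \<Longrightarrow> (\<lambda>(x, w). step k x w) \<in> borel_measurable (borel \<Otimes>\<^sub>M noise_algebra J)"
  by (rule step_measurable) (auto intro: dB_measurable_noise_algebra jump_measurable_noise_algebra)

text \<open>The configuration after \<open>k\<close> steps is determined by the noise before window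
  \<open>k\<close>. Admitting any larger \<open>J\<close> lets the induction treat the earlier
  configuration and the new step under one sigma-algebra.\<close>

lemma euler_measurable:
  "{..<k} \<subseteq> J \<Longrightarrow> (\<lambda>(x, w). euler k x w) \<in> borel_measurable (borel \<Otimes>\<^sub>M noise_algebra J)"
proof (induction k)
  case 0
  show ?case by simp
next
  case (Suc k)
  then have "{..<k} \<subseteq> J" by auto
  then have IH: "(\<lambda>(x, w). euler k x w) \<in> borel_measurable (borel \<Otimes>\<^sub>M noise_algebra J)" by (rule Suc.IH)
  have "(\<lambda>p. (euler k (fst p) (snd p), snd p)) \<in> measurable (borel \<Otimes>\<^sub>M noise_algebra J) (borel \<Otimes>\<^sub>M noise_algebra J)"
    using IH by (intro measurable_Pair measurable_snd) (simp add: case_prod_unfold)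
  from measurable_compose[OF this step_measurable_noise[of k J]]
  have "(\<lambda>p. step k (euler k (fst p) (snd p)) (snd p)) \<in> borel_measurable (borel \<Otimes>\<^sub>M noise_algebra J)"
    using Suc by auto
  then show ?case
    by (subst measurable_cong[where g="\<lambda>p. step k (euler k (fst p) (snd p)) (snd p)"])
      (auto simp: space_pair_measure euler_Suc simp del: tamed_euler.simps)
qed

lemma noise_algebra_pair_measurable:
  assumes "f \<in> measurable (X \<Otimes>\<^sub>M noise_algebra J) Y"
  shows "f \<in> measurable (X \<Otimes>\<^sub>M M) Y"
proof -
  have "(\<lambda>p. (fst p, snd p)) \<in> measurable (X \<Otimes>\<^sub>M M) (X \<Otimes>\<^sub>M noise_algebra J)"
    by (intro measurable_Pair measurable_fst measurable_compose[OF measurable_snd id_measurable_noise_algebra])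
  from measurable_compose[OF this assms] show ?thesis by simp
qed

lemma euler_measurable_M: "(\<lambda>(x, w). euler k x w) \<in> borel_measurable (borel \<Otimes>\<^sub>M M)"
  by (rule noise_algebra_pair_measurable[OF euler_measurable[OF order_refl]])

text \<open>With the same noise, the difference of two steps is again a step, whose coefficients are
  the differences. The identity is claimed almost surely, because splitting the jump integrals
  requires integrability against the realized measure.\<close>

lemma step_contracts:
  "(\<integral>\<^sup>+w. ennreal ((norm (step 0 x w - step 0 y w))\<^sup>2) \<partial>M) \<le> ennreal (r * (norm (x - y))\<^sup>2)"
proof -
  let ?f = "\<lambda>i z. jump_size x i z - jump_size y i z"
  have fm: "?f i \<in> borel_measurable \<nu>" for i using jump_size_measurable_z by (intro borel_measurable_diff)
  have f2: "integrable \<nu> (\<lambda>z. (norm (?f i z))\<^sup>2)" for i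
  proof (rule Bochner_Integration.integrable_bound[of _ "\<lambda>z. 2 * (norm (jump_size x i z))\<^sup>2 + 2 * (norm (jump_size y i z))\<^sup>2"])
    show "integrable \<nu> (\<lambda>z. 2 * (norm (jump_size x i z))\<^sup>2 + 2 * (norm (jump_size y i z))\<^sup>2)"
      using jump_size_square by (intro Bochner_Integration.integrable_add integrable_mult_right)
    show "(\<lambda>z. (norm (?f i z))\<^sup>2) \<in> borel_measurable \<nu>" using fm by simp
    show "AE z in \<nu>. norm ((norm (?f i z))\<^sup>2) \<le> norm (2 * (norm (jump_size x i z))\<^sup>2 + 2 * (norm (jump_size y i z))\<^sup>2)"
      using norm_diff_sq_le by (intro AE_I2) simp
  qed
  have "AE w in M. integrable (jump i 0 w) (jump_size x i) \<and> integrable (jump i 0 w) (jump_size y i)" for x y i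
    using finite_poisson_measure.AE_integrable_n(1)[OF finite_poisson_jump jump_size_integrable, of i 0 x i]
      finite_poisson_measure.AE_integrable_n(1)[OF finite_poisson_jump jump_size_integrable, of i 0 y i]
    by eventually_elim simp
  then have ae: "AE w in M. \<forall>i. integrable (jump i 0 w) (jump_size x i) \<and> integrable (jump i 0 w) (jump_size y i)"
    by (rule eventually_all_finite)
  have "AE w in M. step 0 x w - step 0 y w = (\<chi> i. (drift_part x i - drift_part y i) + (diffusion x i - diffusion y i) *v dB i 0 w
      + ((\<integral>z. ?f i z \<partial>jump i 0 w) - (\<integral>z. ?f i z \<partial>Lam)))"
    using ae
  proof eventually_elim
    case (elim w)
    then show ?case
      using jump_size_integrable
      by (simp add: vec_eq_iff step_def matrix_vector_mult_diff_rdistrib algebra_simps)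
  qed
  then have "AE w in M. ennreal ((norm (step 0 x w - step 0 y w))\<^sup>2) = ennreal ((norm (\<chi> i. (drift_part x i - drift_part y i)
      + (diffusion x i - diffusion y i) *v dB i 0 w + ((\<integral>z. ?f i z \<partial>jump i 0 w) - (\<integral>z. ?f i z \<partial>Lam))))\<^sup>2)"
    by eventually_elim (simp only:)
  then have "(\<integral>\<^sup>+w. ennreal ((norm (step 0 x w - step 0 y w))\<^sup>2) \<partial>M)
    = (\<integral>\<^sup>+w. ennreal ((norm (\<chi> i. (drift_part x i - drift_part y i) + (diffusion x i - diffusion y i) *v dB i 0 w
      + ((\<integral>z. ?f i z \<partial>jump i 0 w) - (\<integral>z. ?f i z \<partial>Lam))))\<^sup>2) \<partial>M)"
    by (rule nn_integral_cong_AE)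
  also have "\<dots> \<le> ennreal (\<Sum>i\<in>UNIV. (norm (drift_part x i - drift_part y i))\<^sup>2
      + \<Delta> * (norm (diffusion x i - diffusion y i))\<^sup>2 + \<Delta> * (\<integral>z. (norm (?f i z))\<^sup>2 \<partial>\<nu>))"
    by (rule step_second_moment[OF fm f2])
  also have "\<dots> \<le> ennreal (r * (norm (x - y))\<^sup>2)"
    using step_contraction[of x y] by (intro ennreal_leI) (simp only: drift_part_def diffusion_def jump_size_def)
  finally show ?thesis .
qed

sublocale step: contracting_random_map M "step 0" r
proof
  show "(\<lambda>(x, w). step 0 x w) \<in> borel_measurable (borel \<Otimes>\<^sub>M M)" by (rule step_measurable_M)
  show "(\<integral>\<^sup>+w. ennreal ((norm (step 0 0 w))\<^sup>2) \<partial>M) < \<infinity>"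
    using step_second_moment[of "jump_size 0" "drift_part 0" "diffusion 0" 0, OF jump_size_measurable_z jump_size_square]
    unfolding step_def by (rule le_less_trans) simp
qed (use r step_contracts in auto)

section \<open>The scheme as a Markov chain on laws\<close>

lemma nn_integral_step:
  assumes h: "h \<in> borel_measurable borel"
  shows "(\<integral>\<^sup>+w. h (step k x w) \<partial>M) = (\<integral>\<^sup>+w. h (step 0 x w) \<partial>M)"
proof -
  have m: "step k x \<in> borel_measurable M" for k
    using measurable_compose[OF measurable_Pair1'[of x borel M] step_measurable_M[of k]] by simp
  have "distr M borel (step k x) = distr M borel (step 0 x)"
    unfolding step_def[abs_def] by (rule step_law[OF jump_size_integrable])
  then show ?thesis
    using nn_integral_distr[OF m[of k], of h] nn_integral_distr[OF m[of 0], of h] h by simp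
qed

lemma law_0:
  assumes "prob_space \<pi>" "sets \<pi> = sets borel"
  shows "law 0 \<pi> = \<pi>"
proof (rule measure_eqI)
  fix A assume "A \<in> sets (law 0 \<pi>)"
  then have A: "A \<in> sets \<pi>" by (simp add: scheme_law_def assms)
  have "(\<lambda>(x, w). euler 0 x w) -` A \<inter> space (\<pi> \<Otimes>\<^sub>M M) = A \<times> space M"
    using sets.sets_into_space[OF A] by (auto simp: space_pair_measure)
  moreover have "(\<lambda>(x, w). euler 0 x w) \<in> borel_measurable (\<pi> \<Otimes>\<^sub>M M)"
    using euler_measurable_M[of 0] by (simp add: assms cong: measurable_cong_sets sets_pair_measure_cong)
  ultimately show "emeasure (law 0 \<pi>) A = emeasure \<pi> A"
    using A by (simp add: scheme_law_def emeasure_distr assms emeasure_pair_measure_Times emeasure_space_1 del: tamed_euler.simps)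
qed (simp add: scheme_law_def assms)

text \<open>The Markov property. The configuration after \<open>k\<close> steps depends on the past
  windows, so the noise of window \<open>k\<close> may be replaced by an independent copy; for a
  fixed configuration \<open>step k\<close> may then be exchanged for \<open>step 0\<close>, the map
  behind \<open>push\<close>.\<close>

lemma law_Suc:
  assumes "prob_space \<pi>" and s: "sets \<pi> = sets borel"
  shows "law (Suc k) \<pi> = step.push (law k \<pi>)"
proof (rule measure_eqI)
  interpret \<pi>: prob_space \<pi> by fact
  interpret P: pair_prob_space \<pi> M ..
  have c: "measurable (\<pi> \<Otimes>\<^sub>M M) X = measurable (borel \<Otimes>\<^sub>M M) X" for X :: "(real^'d^'n) measure"
    using s by (intro measurable_cong_sets sets_pair_measure_cong) auto
  have em: "(\<lambda>(x, w). euler k x w) \<in> borel_measurable (\<pi> \<Otimes>\<^sub>M M)" for k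
    using euler_measurable_M unfolding c .
  fix A assume "A \<in> sets (law (Suc k) \<pi>)"
  then have A [measurable]: "A \<in> sets borel" by (simp add: scheme_law_def)
  define ind :: "real^'d^'n \<Rightarrow> ennreal" where "ind = indicator A"
  have ind [measurable]: "ind \<in> borel_measurable borel" by (simp add: ind_def)
  have ex: "euler k x \<in> borel_measurable (noise_algebra J)" if "{..<k} \<subseteq> J" for k x J
    using measurable_compose[OF measurable_Pair1'[of x borel "noise_algebra J"] euler_measurable[OF that]] by simp
  have "emeasure (law (Suc k) \<pi>) A = (\<integral>\<^sup>+y. ind y \<partial>law (Suc k) \<pi>)"
    by (simp add: ind_def scheme_law_def)
  also have "\<dots> = (\<integral>\<^sup>+p. ind (case p of (x, w) \<Rightarrow> euler (Suc k) x w) \<partial>(\<pi> \<Otimes>\<^sub>M M))"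
    unfolding scheme_law_def by (rule nn_integral_distr[OF em]) simp
  also have "\<dots> = (\<integral>\<^sup>+x. \<integral>\<^sup>+w. ind (euler (Suc k) x w) \<partial>M \<partial>\<pi>)"
    using measurable_compose[OF em[of "Suc k"] ind]
    by (subst nn_integral_fst[symmetric]) (auto simp: case_prod_unfold simp del: tamed_euler.simps)
  also have "\<dots> = (\<integral>\<^sup>+x. \<integral>\<^sup>+w. ind (step k (euler k x w) w) \<partial>M \<partial>\<pi>)"
    by (intro nn_integral_cong) (simp add: euler_Suc del: tamed_euler.simps)
  also have "\<dots> = (\<integral>\<^sup>+x. \<integral>\<^sup>+w. \<integral>\<^sup>+w'. ind (step k (euler k x w) w') \<partial>M \<partial>M \<partial>\<pi>)"
  proof (rule nn_integral_cong, rule freeze_present)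
    fix x
    have "(\<lambda>p. (euler k x (fst p), snd p)) \<in> measurable (noise_algebra {..<k} \<Otimes>\<^sub>M noise_algebra {k}) (borel \<Otimes>\<^sub>M noise_algebra {k})"
      by (intro measurable_Pair measurable_snd measurable_compose[OF measurable_fst ex]) simp
    from measurable_compose[OF measurable_compose[OF this step_measurable_noise] ind]
    show "(\<lambda>(w, w'). ind (step k (euler k x w) w')) \<in> borel_measurable (noise_algebra {..<k} \<Otimes>\<^sub>M noise_algebra {k})"
      by (simp add: case_prod_unfold)
  qed
  also have "\<dots> = (\<integral>\<^sup>+x. \<integral>\<^sup>+w. \<integral>\<^sup>+w'. ind (step 0 (euler k x w) w') \<partial>M \<partial>M \<partial>\<pi>)"
    by (rule nn_integral_cong, rule nn_integral_cong, rule nn_integral_step[OF ind])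
  also have "\<dots> = (\<integral>\<^sup>+p. \<integral>\<^sup>+w'. ind (step 0 (euler k (fst p) (snd p)) w') \<partial>M \<partial>(\<pi> \<Otimes>\<^sub>M M))"
  proof -
    have "(\<lambda>q. (euler k (fst (fst q)) (snd (fst q)), snd q)) \<in> measurable ((\<pi> \<Otimes>\<^sub>M M) \<Otimes>\<^sub>M M) (borel \<Otimes>\<^sub>M M)"
      using measurable_compose[OF measurable_fst em[of k], of M] by (intro measurable_Pair measurable_snd) (simp add: case_prod_unfold)
    from measurable_compose[OF measurable_compose[OF this step_measurable_M[of 0]] ind]
    have "(\<lambda>(p, w'). ind (step 0 (euler k (fst p) (snd p)) w')) \<in> borel_measurable ((\<pi> \<Otimes>\<^sub>M M) \<Otimes>\<^sub>M M)"
      by (simp add: case_prod_unfold)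
    from borel_measurable_nn_integral[OF this] show ?thesis
      by (subst nn_integral_fst[symmetric]) auto
  qed
  also have "\<dots> = (\<integral>\<^sup>+q. ind (case q of (p, w') \<Rightarrow> step 0 (case p of (x, w) \<Rightarrow> euler k x w) w') \<partial>((\<pi> \<Otimes>\<^sub>M M) \<Otimes>\<^sub>M M))"
    using em[of k] by (subst nn_integral_fst[symmetric]) (auto simp: case_prod_unfold)
  also have "\<dots> = (\<integral>\<^sup>+y. ind y \<partial>step.push (law k \<pi>))"
    unfolding scheme_law_def step.push_distr[OF P.prob_space_axioms em]
    using em[of k] by (subst nn_integral_distr) (auto simp: case_prod_unfold)
  also have "\<dots> = emeasure (step.push (law k \<pi>)) A"
    by (simp add: ind_def step.push_def)
  finally show "emeasure (law (Suc k) \<pi>) A = emeasure (step.push (law k \<pi>)) A" .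
qed (simp add: scheme_law_def step.push_def)

lemma law_P2: "\<pi> \<in> P2 \<Longrightarrow> law k \<pi> \<in> P2"
  by (induction k) (auto simp: law_0 law_Suc P2D intro: step.push_P2)

lemma law_W2:
  assumes "\<pi> \<in> P2" "\<pi>' \<in> P2"
  shows "(W2 (law k \<pi>) (law k \<pi>'))\<^sup>2 \<le> r ^ k * (W2 \<pi> \<pi>')\<^sup>2"
proof (induction k)
  case 0
  show ?case using assms by (simp add: law_0 P2D)
next
  case (Suc k)
  have "(W2 (law (Suc k) \<pi>) (law (Suc k) \<pi>'))\<^sup>2 \<le> r * (W2 (law k \<pi>) (law k \<pi>'))\<^sup>2"
    using step.push_W2[OF law_P2 law_P2] assms by (simp add: law_Suc P2D)
  also have "\<dots> \<le> r * (r ^ k * (W2 \<pi> \<pi>')\<^sup>2)"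
    using Suc r by (intro mult_left_mono) auto
  finally show ?case by (simp add: mult.assoc)
qed

theorem invariant_measure_unique_attracting:
  "\<exists>\<pi>. invariant_measure law \<pi> \<and> (\<forall>\<pi>'. invariant_measure law \<pi>' \<longrightarrow> \<pi>' = \<pi>) \<and>
     (\<forall>\<pi>'\<in>P2. \<forall>k. law k \<pi>' \<in> P2 \<and> (W2 (law k \<pi>') \<pi>)\<^sup>2 \<le> r ^ k * (W2 \<pi>' \<pi>)\<^sup>2)"
proof -
  obtain \<pi> where \<pi>: "\<pi> \<in> P2" "step.push \<pi> = \<pi>" using step.push_fixpoint_exists by blast
  have inv: "law k \<pi> = \<pi>" for k
    by (induction k) (use \<pi> P2D[OF \<pi>(1)] in \<open>auto simp: law_0 law_Suc\<close>)
  have "\<pi>' = \<pi>" if "invariant_measure law \<pi>'" for \<pi>'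
  proof (rule step.push_fixpoint_unique[OF _ \<pi>(1) _ \<pi>(2)])
    show p: "\<pi>' \<in> P2" using that by (simp add: invariant_measure_def)
    \<comment> \<open>Invariance under a single step already makes the measure a fixed point of
      \<open>push\<close>.\<close>
    have "law (Suc 0) \<pi>' = \<pi>'" using that by (simp only: invariant_measure_def)
    then show "step.push \<pi>' = \<pi>'" using P2D[OF p] by (simp add: law_Suc law_0)
  qed
  moreover have "(W2 (law k \<pi>') \<pi>)\<^sup>2 \<le> r ^ k * (W2 \<pi>' \<pi>)\<^sup>2" if "\<pi>' \<in> P2" for \<pi>' k
    using law_W2[OF that \<pi>(1), of k] by (simp add: inv)
  ultimately show ?thesis
    using \<pi> inv law_P2 by (intro exI[of _ \<pi>]) (auto simp: invariant_measure_def)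
qed

end

text \<open>Square integrability of \<open>\<gamma>\<close> gives the compensated integrals a
  meaning, since the Lipschitz bound controls differences. The conclusion records that the laws stay
  in \<open>P2\<close>, the domain on which \<open>W2\<close> is meaningful.\<close>

theorem theorem4p7:
  fixes Z :: "(real^'d) set" and \<nu> :: "(real^'d) measure"
    and b1 :: "real^'d \<Rightarrow> real^'d"
    and b2 :: "real^'d \<Rightarrow> (real^'d) measure \<Rightarrow> real^'d"
    and g :: "real^'d \<Rightarrow> (real^'d) measure \<Rightarrow> real^'m^'d"
    and \<gamma> :: "real^'d \<Rightarrow> (real^'d) measure \<Rightarrow> real^'d \<Rightarrow> real^'d"
    and M :: "'w measure"
    and B :: "'n::finite \<Rightarrow> real \<Rightarrow> 'w \<Rightarrow> real^'m"
    and N :: "'n \<Rightarrow> 'w \<Rightarrow> (real \<times> (real^'d)) measure"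
    and q L0 L1 L2 L3 L4 L5 lam3 \<rho> lam \<Delta>star :: real
  assumes Z: "0 \<notin> Z"
    and nu: "sets \<nu> = sets (restrict_space borel Z)" "finite_measure \<nu>"
    and noise: "particle_noise M \<nu> B N"
    and b1_measurable: "b1 \<in> borel_measurable borel"
    and b2_measurable: "(\<lambda>(x, \<mu>). b2 x \<mu>) \<in> borel_measurable (borel \<Otimes>\<^sub>M P2_borel)"
    and g_measurable: "(\<lambda>(x, \<mu>). g x \<mu>) \<in> borel_measurable (borel \<Otimes>\<^sub>M P2_borel)"
    and gamma_measurable:
      "(\<lambda>(x, \<mu>, z). \<gamma> x \<mu> z)
         \<in> borel_measurable (borel \<Otimes>\<^sub>M (P2_borel \<Otimes>\<^sub>M restrict_space borel Z))"
    and gamma_square_integrable: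
      "\<And>x \<mu>. \<mu> \<in> P2 \<Longrightarrow> integrable \<nu> (\<lambda>z. (norm (\<gamma> x \<mu> z))\<^sup>2)"
    and pos: "lam3 > 0" "q > 0" "L0 > 0" "L1 > 0" "L2 > 0" "L3 > 0" "L4 > 0" "L5 > 0"
    and g_lipschitz: "\<And>x1 x2 \<mu>1 \<mu>2. \<mu>1 \<in> P2 \<Longrightarrow> \<mu>2 \<in> P2 \<Longrightarrow>
      (norm (g x1 \<mu>1 - g x2 \<mu>2))\<^sup>2 \<le> lam3 * ((norm (x1 - x2))\<^sup>2 + (W2 \<mu>1 \<mu>2)\<^sup>2)"
    and gamma_lipschitz: "\<And>x1 x2 \<mu>1 \<mu>2. \<mu>1 \<in> P2 \<Longrightarrow> \<mu>2 \<in> P2 \<Longrightarrow>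
      (\<integral>\<^sup>+ z. ennreal ((norm (\<gamma> x1 \<mu>1 z - \<gamma> x2 \<mu>2 z))\<^sup>2) \<partial>\<nu>)
        \<le> ennreal (lam3 * ((norm (x1 - x2))\<^sup>2 + (W2 \<mu>1 \<mu>2)\<^sup>2))"
    and b1_growth: "\<And>x1 x2.
      (norm (b1 x1 - b1 x2))\<^sup>2
        \<le> L0 * (1 + norm x1 powr (2 * q) + norm x2 powr (2 * q)) * (norm (x1 - x2))\<^sup>2"
    and b1_monotone: "\<And>x1 x2.
      (x1 - x2) \<bullet> (b1 x1 - b1 x2)
        \<le> - L1 * (1 + norm x1 powr q + norm x2 powr q) * (norm (x1 - x2))\<^sup>2"
    and b1_cross_monotone: "\<And>x1 x2.
      (x1 - x2) \<bullet> ((norm x2 powr q) *\<^sub>R b1 x1 - (norm x1 powr q) *\<^sub>R b1 x2)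
        \<le> (L2 * (1 + norm x1 powr q + norm x2 powr q) - L3 * norm x1 powr q * norm x2 powr q)
            * (norm (x1 - x2))\<^sup>2"
    and b1_cross_growth: "\<And>x1 x2.
      (norm ((norm x2 powr q) *\<^sub>R b1 x1 - (norm x1 powr q) *\<^sub>R b1 x2))\<^sup>2
        \<le> L4 * (1 + norm x1 powr (2 * q) + norm x2 powr (2 * q)
                  + norm x1 powr (2 * q) * norm x2 powr (2 * q)) * (norm (x1 - x2))\<^sup>2"
    and b2_lipschitz: "\<And>x1 x2 \<mu>1 \<mu>2. \<mu>1 \<in> P2 \<Longrightarrow> \<mu>2 \<in> P2 \<Longrightarrow>
      (norm (b2 x1 \<mu>1 - b2 x2 \<mu>2))\<^sup>2 \<le> L5 * ((norm (x1 - x2))\<^sup>2 + (W2 \<mu>1 \<mu>2)\<^sup>2)"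
    and dissipative: "min L1 (2 * L3) - 1 - 6 * L5 - 2 * (real CARD('m) + 1) * lam3 > 0"
    and rho: "\<rho> = L1 - 1 - 6 * L5 - 2 * (real CARD('m) + 1) * lam3"
    and lam: "lam = (min L1 (2 * L3) - 1 - 6 * L5 - 2 * (real CARD('m) + 1) * lam3) / 2"
    and Delta_star: "\<Delta>star = Min {1, (L1 / (2 * L2))\<^sup>2, (lam / (8 * (3 * L0 + 4 * L4)))\<^sup>2,
                                  (\<rho> / (4 * L0))\<^sup>2, 1 / \<rho>}"
  shows "\<forall>\<Delta>. 0 < \<Delta> \<and> \<Delta> \<le> \<Delta>star \<longrightarrow>
    (\<exists>\<pi>. invariant_measure (scheme_law \<Delta> q b1 b2 g \<gamma> \<nu> M B N) \<pi> \<and>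
         (\<forall>\<pi>'. invariant_measure (scheme_law \<Delta> q b1 b2 g \<gamma> \<nu> M B N) \<pi>' \<longrightarrow> \<pi>' = \<pi>) \<and>
         (\<forall>\<mu>\<in>P2. \<forall>k::nat.
            scheme_law \<Delta> q b1 b2 g \<gamma> \<nu> M B N k (iid_law \<mu>) \<in> P2 \<and>
            (W2 (scheme_law \<Delta> q b1 b2 g \<gamma> \<nu> M B N k (iid_law \<mu>)) \<pi>)\<^sup>2
              \<le> exp (- lam * (real k * \<Delta>)) * (W2 (iid_law \<mu>) \<pi>)\<^sup>2))"
proof (intro allI impI)
  fix \<Delta> :: real assume \<Delta>: "0 < \<Delta> \<and> \<Delta> \<le> \<Delta>star"
  define K where "K = min L1 (2 * L3)"
  define h where "h = sqrt \<Delta>"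
  define r where "r = 1 - lam * \<Delta>"
  have K: "K \<le> L1" "K \<le> 2 * L3" by (auto simp: K_def)
  have m1: "1 \<le> real CARD('m)" by (simp add: Suc_le_eq)
  have lam2: "2 * lam = K - 1 - 6 * L5 - 2 * (real CARD('m) + 1) * lam3" and lam0: "0 < lam"
    using lam dissipative by (auto simp: K_def)
  \<comment> \<open>The isometries for diffusion and jumps lead to \<open>4 * lam3\<close>, which
    the hypothesis covers because the noise has at least one dimension.\<close>
  have mlam: "4 * lam3 \<le> 2 * (real CARD('m) + 1) * lam3"
    using m1 pos(1) by (intro mult_right_mono) auto
  have lamK: "lam \<le> K / 2" "1 < K" and rho2: "2 * lam \<le> \<rho>"
    using lam2 lam0 mlam pos rho K by linarith+
  have D: "0 < \<Delta>" "\<Delta> \<le> 1" "\<Delta> \<le> (L1 / (2 * L2))\<^sup>2" "\<Delta> \<le> (lam / (8 * (3 * L0 + 4 * L4)))\<^sup>2" "\<Delta> \<le> 1 / \<rho>"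
    using \<Delta> unfolding Delta_star by auto
  \<comment> \<open>The taming involves the root of the step size, and the squares in
    \<open>\<Delta>star\<close> are squared bounds on this root.\<close>
  have h: "0 < h" "h\<^sup>2 = \<Delta>" using D by (auto simp: h_def)
  have h1: "h \<le> L1 / (2 * L2)" "h \<le> lam / (8 * (3 * L0 + 4 * L4))"
  proof -
    show "h \<le> L1 / (2 * L2)"
      by (rule power2_le_imp_le) (unfold h(2), use D(3) pos in simp_all)
    show "h \<le> lam / (8 * (3 * L0 + 4 * L4))"
      by (rule power2_le_imp_le) (unfold h(2), use D(4) pos lam0 in simp_all)
  qed
  have hL2: "2 * h * L2 \<le> L1" using h1(1) pos by (simp add: field_simps)
  have hl: "h * (8 * (3 * L0 + 4 * L4)) \<le> lam"
    using h1(2) pos by (subst (asm) pos_le_divide_eq) auto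
  txt \<open>Comparing monotonicity with growth at a single point shows that \<open>L0\<close> dominates \<open>L1\<^sup>2\<close>, which
    together with \<open>L1 > 1\<close> keeps the step size away from 1.\<close>
  have L10: "L1 * L1 \<le> L0"
  proof -
    define e :: "real^'d" where "e = axis (SOME i. True) 1"
    have e: "norm e = 1" by (simp add: e_def)
    have "2 * L1 \<le> - (e \<bullet> (b1 e - b1 0))" using b1_monotone[of e 0] e pos(2) by simp
    also have "\<dots> \<le> norm e * norm (b1 e - b1 0)" using Cauchy_Schwarz_ineq2[of e "b1 e - b1 0"] by linarith
    finally have "2 * L1 \<le> norm (b1 e - b1 0)" using e by simp
    then have "(2 * L1)\<^sup>2 \<le> (norm (b1 e - b1 0))\<^sup>2" using pos by (intro power_mono) auto
    also have "\<dots> \<le> L0 * 2" using b1_growth[of e 0] e pos(2) by simp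
    finally have "4 * (L1 * L1) \<le> 2 * L0" by (simp add: power2_eq_square)
    moreover have "0 \<le> L1 * L1" by simp
    ultimately show ?thesis by linarith
  qed
  \<comment> \<open>From \<open>L1 \<le> L1 * L1 \<le> L0\<close> and
    \<open>h * (24 * L1) \<le> lam \<le> L1 / 2\<close> one even gets
    \<open>h \<le> 1 / 48\<close>.\<close>
  have h2: "h \<le> 1 / 2"
  proof -
    have "L1 \<le> L1 * L1" using K lamK pos by simp
    from order_trans[OF this L10] have "24 * L1 \<le> 8 * (3 * L0 + 4 * L4)" using pos by simp
    then have "h * (24 * L1) \<le> h * (8 * (3 * L0 + 4 * L4))" using h by (intro mult_left_mono) auto
    then have "h * (24 * L1) \<le> L1 / 2" using hl lamK K by linarith
    then have "h * 24 * L1 \<le> (1 / 2) * L1" by simp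
    then have "h * 24 \<le> 1 / 2" using pos by (subst (asm) mult_le_cancel_right_pos) auto
    then show ?thesis by simp
  qed
  \<comment> \<open>\<open>\<Delta> \<le> 1 / \<rho>\<close> and \<open>2 * lam \<le> \<rho>\<close>
    give \<open>lam * \<Delta> \<le> 1 / 2\<close>, which keeps \<open>r\<close> positive.\<close>
  have r01: "0 < r" "r < 1"
  proof -
    have "\<Delta> * \<rho> \<le> 1" using D(5) rho2 lam0 by (simp add: field_simps)
    moreover have "\<Delta> * (2 * lam) \<le> \<Delta> * \<rho>" using rho2 D(1) by (intro mult_left_mono) auto
    ultimately show "0 < r" unfolding r_def by (simp add: mult.commute)
    show "r < 1" using lam0 D(1) by (simp add: r_def)
  qed
  have contraction: "(\<Sum>i\<in>UNIV.
         (norm (x $ i + \<Delta> *\<^sub>R tamed_drift \<Delta> q b1 b2 (x $ i) (empirical_measure x)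
              - (y $ i + \<Delta> *\<^sub>R tamed_drift \<Delta> q b1 b2 (y $ i) (empirical_measure y))))\<^sup>2
       + \<Delta> * (norm (g (x $ i) (empirical_measure x) - g (y $ i) (empirical_measure y)))\<^sup>2
       + \<Delta> * (\<integral>z. (norm (\<gamma> (x $ i) (empirical_measure x) z - \<gamma> (y $ i) (empirical_measure y) z))\<^sup>2 \<partial>\<nu>))
      \<le> r * (norm (x - y))\<^sup>2" for x y :: "real^'d^'n"
  proof -
    let ?\<mu> = "empirical_measure x" and ?\<mu>' = "empirical_measure y"
    define V where "V = (W2 ?\<mu> ?\<mu>')\<^sup>2"
    define d where "d i = (norm (x $ i - y $ i))\<^sup>2" for i
    have V0: "0 \<le> V" by (simp add: V_def)
    have d0: "0 \<le> d i" for i by (simp add: d_def)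
    have S: "(\<Sum>i\<in>UNIV. d i) = (norm (x - y))\<^sup>2" by (simp add: d_def power2_norm_vec[of "x - y"])
    have NV: "real CARD('n) * V \<le> (norm (x - y))\<^sup>2"
      using empirical_W2[of x y] by (simp add: V_def field_simps)
    \<comment> \<open>The single \<open>\<Delta>\<close> next to \<open>d i\<close> and one of the
      three \<open>L5\<close> come from Young's inequality for the inner product with
      \<open>s\<close>, the other two \<open>L5\<close> from the square of the increment with
      \<open>\<Delta>\<^sup>2 \<le> \<Delta>\<close>; \<open>g\<close> and \<open>\<gamma>\<close>
      contribute \<open>lam3\<close> each.\<close>
    have "(norm (x $ i + \<Delta> *\<^sub>R tamed_drift \<Delta> q b1 b2 (x $ i) ?\<mu> - (y $ i + \<Delta> *\<^sub>R tamed_drift \<Delta> q b1 b2 (y $ i) ?\<mu>')))\<^sup>2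
       + \<Delta> * (norm (g (x $ i) ?\<mu> - g (y $ i) ?\<mu>'))\<^sup>2
       + \<Delta> * (\<integral>z. (norm (\<gamma> (x $ i) ?\<mu> z - \<gamma> (y $ i) ?\<mu>' z))\<^sup>2 \<partial>\<nu>)
      \<le> d i * (1 + \<Delta> * (lam - K) + \<Delta>) + \<Delta> * (3 * L5 + 2 * lam3) * (d i + V)" for i
    proof -
      define u v where "u = x $ i" and "v = y $ i"
      define p where "p = b1 u /\<^sub>R (1 + h * norm u powr q) - b1 v /\<^sub>R (1 + h * norm v powr q)"
      define s where "s = b2 u ?\<mu> - b2 v ?\<mu>'"
      have pw: "norm z powr (2 * q) = (norm z powr q)\<^sup>2" for z :: "real^'d"
        by (simp add: power2_eq_square powr_add[symmetric])
      have P: "2 * ((u - v) \<bullet> p) + 2 * \<Delta> * (norm p)\<^sup>2 \<le> (lam - K) * d i"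
        unfolding p_def h(2)[symmetric] d_def u_def[symmetric] v_def[symmetric]
        by (rule tamed_drift_dissipative[OF _ _ h(1) h2 pos(3,7) lam0 lamK(1) K hL2 hl
            b1_growth[of u v, unfolded pw] b1_monotone[of u v] b1_cross_monotone[of u v]
            b1_cross_growth[of v u, unfolded pw]]) simp_all
      have s: "(norm s)\<^sup>2 \<le> L5 * (d i + V)"
        unfolding s_def d_def V_def u_def v_def by (rule b2_lipschitz[OF empirical_P2 empirical_P2])
      have e: "x $ i + \<Delta> *\<^sub>R tamed_drift \<Delta> q b1 b2 (x $ i) ?\<mu> - (y $ i + \<Delta> *\<^sub>R tamed_drift \<Delta> q b1 b2 (y $ i) ?\<mu>')
          = (u - v) + \<Delta> *\<^sub>R (p + s)"
        by (simp add: tamed_drift_def u_def v_def p_def s_def h_def algebra_simps)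
      have A1: "(norm ((u - v) + \<Delta> *\<^sub>R (p + s)))\<^sup>2 = d i + 2 * \<Delta> * ((u - v) \<bullet> p) + 2 * \<Delta> * ((u - v) \<bullet> s) + \<Delta>\<^sup>2 * (norm (p + s))\<^sup>2"
        unfolding d_def u_def[symmetric] v_def[symmetric] power2_norm_eq_inner
        by (simp add: inner_add_left inner_add_right inner_commute power2_eq_square algebra_simps)
      have A2: "\<Delta>\<^sup>2 * (norm (p + s))\<^sup>2 \<le> \<Delta>\<^sup>2 * (2 * (norm p)\<^sup>2 + 2 * (norm s)\<^sup>2)"
        by (intro mult_left_mono norm_add_sq_le) simp
      have "0 \<le> (norm ((u - v) - s))\<^sup>2" by simp
      then have "2 * ((u - v) \<bullet> s) \<le> d i + (norm s)\<^sup>2"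
        unfolding d_def u_def[symmetric] v_def[symmetric] power2_norm_eq_inner
        by (simp add: inner_diff_left inner_diff_right inner_commute algebra_simps)
      then have A3: "\<Delta> * (2 * ((u - v) \<bullet> s)) \<le> \<Delta> * (d i + (norm s)\<^sup>2)" using D by (intro mult_left_mono) auto
      have A4: "\<Delta> * (2 * ((u - v) \<bullet> p) + 2 * \<Delta> * (norm p)\<^sup>2) \<le> \<Delta> * ((lam - K) * d i)"
        using P D by (intro mult_left_mono) auto
      have "\<Delta>\<^sup>2 \<le> \<Delta>" using D mult_left_mono[of \<Delta> 1 \<Delta>] by (simp add: power2_eq_square)
      then have "(\<Delta> + 2 * \<Delta>\<^sup>2) * (norm s)\<^sup>2 \<le> (3 * \<Delta>) * (L5 * (d i + V))"
        using s D by (intro mult_mono) auto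
      then have A: "(norm ((u - v) + \<Delta> *\<^sub>R (p + s)))\<^sup>2 \<le> d i * (1 + \<Delta> * (lam - K) + \<Delta>) + 3 * \<Delta> * L5 * (d i + V)"
        using A1 A2 A3 A4 by (simp add: power2_eq_square algebra_simps)
      have G: "\<Delta> * (norm (g (x $ i) ?\<mu> - g (y $ i) ?\<mu>'))\<^sup>2 \<le> \<Delta> * (lam3 * (d i + V))"
        unfolding d_def V_def using D by (intro mult_left_mono g_lipschitz empirical_P2) auto
      have "(\<integral>z. (norm (\<gamma> (x $ i) ?\<mu> z - \<gamma> (y $ i) ?\<mu>' z))\<^sup>2 \<partial>\<nu>) \<le> lam3 * (d i + V)"
        unfolding d_def V_def using pos
        by (intro integral_real_bounded gamma_lipschitz empirical_P2) auto
      then have J: "\<Delta> * (\<integral>z. (norm (\<gamma> (x $ i) ?\<mu> z - \<gamma> (y $ i) ?\<mu>' z))\<^sup>2 \<partial>\<nu>) \<le> \<Delta> * (lam3 * (d i + V))"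
        using D by (intro mult_left_mono) auto
      show ?thesis using A G J unfolding e by (simp add: algebra_simps)
    qed
    then have "(\<Sum>i\<in>UNIV.
         (norm (x $ i + \<Delta> *\<^sub>R tamed_drift \<Delta> q b1 b2 (x $ i) ?\<mu> - (y $ i + \<Delta> *\<^sub>R tamed_drift \<Delta> q b1 b2 (y $ i) ?\<mu>')))\<^sup>2
       + \<Delta> * (norm (g (x $ i) ?\<mu> - g (y $ i) ?\<mu>'))\<^sup>2
       + \<Delta> * (\<integral>z. (norm (\<gamma> (x $ i) ?\<mu> z - \<gamma> (y $ i) ?\<mu>' z))\<^sup>2 \<partial>\<nu>))
      \<le> (\<Sum>i\<in>UNIV. d i * (1 + \<Delta> * (lam - K) + \<Delta>) + \<Delta> * (3 * L5 + 2 * lam3) * (d i + V))"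
      by (rule sum_mono)
    also have "\<dots> = (norm (x - y))\<^sup>2 * (1 + \<Delta> * (lam - K) + \<Delta>) + \<Delta> * (3 * L5 + 2 * lam3) * ((norm (x - y))\<^sup>2 + real CARD('n) * V)"
      by (simp add: S[symmetric] sum.distrib sum_distrib_left sum_distrib_right distrib_left)
    \<comment> \<open>Summed over the particles, the Wasserstein term is at most the squared
      distance of the configurations; this doubles \<open>3 * L5\<close> and
      \<open>2 * lam3\<close>.\<close>
    also have "\<dots> \<le> (norm (x - y))\<^sup>2 * (1 + \<Delta> * (lam - K) + \<Delta>) + \<Delta> * (3 * L5 + 2 * lam3) * ((norm (x - y))\<^sup>2 + (norm (x - y))\<^sup>2)"
      using NV D pos by (intro add_left_mono mult_left_mono) auto
    also have "\<dots> = (1 + \<Delta> * (lam - K + 1 + 6 * L5 + 4 * lam3)) * (norm (x - y))\<^sup>2"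
      by (simp add: algebra_simps)
    also have "\<dots> \<le> r * (norm (x - y))\<^sup>2"
    proof (rule mult_right_mono)
      \<comment> \<open>The gap in the hypothesis is \<open>2 * lam\<close>: one half has been spent
        on the taming, the other half is the rate that remains.\<close>
      have "\<Delta> * (lam - K + 1 + 6 * L5 + 4 * lam3) \<le> \<Delta> * (- lam)"
        using lam2 mlam D by (intro mult_left_mono) auto
      then show "1 + \<Delta> * (lam - K + 1 + 6 * L5 + 4 * lam3) \<le> r" by (simp add: r_def mult.commute)
    qed simp
    finally show ?thesis .
  qed
  interpret S: tamed_euler_scheme M \<nu> B N \<Delta> q r b1 b2 g \<gamma>
  proof (intro tamed_euler_scheme.intro particle_noise_steps.intro tamed_euler_scheme_axioms.intro)
    show "(\<lambda>(x, \<mu>, z). \<gamma> x \<mu> z) \<in> borel_measurable (borel \<Otimes>\<^sub>M (P2_borel \<Otimes>\<^sub>M \<nu>))"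
      using gamma_measurable nu(1) by (simp cong: measurable_cong_sets sets_pair_measure_cong)
  qed (rule nu(2) noise D(1) b1_measurable b2_measurable g_measurable gamma_square_integrable r01 contraction | assumption)+
  obtain \<pi> where \<pi>: "invariant_measure S.law \<pi>" "\<forall>\<pi>'. invariant_measure S.law \<pi>' \<longrightarrow> \<pi>' = \<pi>"
    "\<And>\<pi>' k. \<pi>' \<in> P2 \<Longrightarrow> S.law k \<pi>' \<in> P2" "\<And>\<pi>' k. \<pi>' \<in> P2 \<Longrightarrow> (W2 (S.law k \<pi>') \<pi>)\<^sup>2 \<le> r ^ k * (W2 \<pi>' \<pi>)\<^sup>2"
    using S.invariant_measure_unique_attracting by blast
  have rk: "r ^ k \<le> exp (- lam * (real k * \<Delta>))" for k
  proof -
    have "r ^ k \<le> exp (- (lam * \<Delta>)) ^ k"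
      using r01 exp_ge_add_one_self[of "- (lam * \<Delta>)"] by (intro power_mono) (auto simp: r_def)
    also have "\<dots> = exp (- lam * (real k * \<Delta>))"
      by (simp add: exp_of_nat_mult[symmetric] ac_simps)
    finally show ?thesis .
  qed
  have bound: "(W2 (S.law k (iid_law \<mu>)) \<pi>)\<^sup>2 \<le> exp (- lam * (real k * \<Delta>)) * (W2 (iid_law \<mu>) \<pi>)\<^sup>2" if "\<mu> \<in> P2" for \<mu> k
    using \<pi>(4)[OF iid_law_P2[OF that], of k] mult_right_mono[OF rk[of k], of "(W2 (iid_law \<mu>) \<pi>)\<^sup>2"] by simp
  show "\<exists>\<pi>. invariant_measure S.law \<pi> \<and> (\<forall>\<pi>'. invariant_measure S.law \<pi>' \<longrightarrow> \<pi>' = \<pi>) \<and>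
         (\<forall>\<mu>\<in>P2. \<forall>k::nat. S.law k (iid_law \<mu>) \<in> P2 \<and>
            (W2 (S.law k (iid_law \<mu>)) \<pi>)\<^sup>2 \<le> exp (- lam * (real k * \<Delta>)) * (W2 (iid_law \<mu>) \<pi>)\<^sup>2)"
    by (intro exI[of _ \<pi>] conjI ballI allI \<pi>(1,2) \<pi>(3)[OF iid_law_P2] bound)
qed


end
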